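(* If the Klein cubic surface $K$ is realised as a $G_2(\mathbb{C})$ character variety (via the isomorphism, described in the context, between symmetric Fricke cubic surfaces and $G_2(\mathbb{C})$ character varieties), then the braid group orbit of size $7$ in $K$ corresponds to some triples of generators of the finite simple group $G_2(\mathbb{F}_2)'\subset G_2(\mathbb{C})$ of order $6048$. One such triple of generators is uniquely determined by the three lines passing through a single point in the Fano plane $\mathbb{P}^2(\mathbb{F}_2)$.
   Context: The Klein cubic surface $K$ is the smooth affine surface $xyz+x^2+y^2+z^2=x+y+z$ in $\mathbb{C}^3$, i.e. the symmetric Fricke cubic surface $xyz+x^2+y^2+z^2+b(x+y+z)+c=0$ with $b=-1$, $c=0$. It is a character variety of $\mathrm{SL}_2(\mathbb{C})$ representations of the fundamental group of the four-punctured sphere: its points are classes of triples $(M_1,M_2,M_3)\in\mathrm{SL}_2(\mathbb{C})^3$ up to diagonal conjugation, with $\mathrm{Tr}(M_1)=\mathrm{Tr}(M_2)=\mathrm{Tr}(M_3)=2\cos(2\pi/7)$, $\mathrm{Tr}(M_1M_2M_3)=2\cos(4\pi/7)$, and $x=\mathrm{Tr}(M_2M_3)$, $y=\mathrm{Tr}(M_1M_3)$, $z=\mathrm{Tr}(M_1M_2)$. Braid group action. For any group $H$ the three string braid group $B_3$ acts on $H^3$ via the generators $\beta_1(g_1,g_2,g_3)=(g_2,g_2^{-1}g_1g_2,g_3)$ and $\beta_2(g_1,g_2,g_3)=(g_1,g_3,g_3^{-1}g_2g_3)$. With $H=\mathrm{SL}_2(\mathbb{C})$ this induces an action on $K$,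 and the braid group orbit of size $7$ in $K$ consists of the points $(x,y,z)=(0,0,0),(0,0,1),(0,1,0),(1,0,0),(1,1,0),(1,0,1),(0,1,1)$. Octonions. $\mathbb{O}$ is the complex octonion algebra with basis $1,e_1,\dots,e_7$, where $1$ is the unit, $e_i^2=-1$, and for each $(i,j,k)$ among $124,235,346,457,561,672,713$ one has $e_ie_j=e_k=-e_je_i$, $e_je_k=e_i=-e_ke_j$, $e_ke_i=e_j=-e_ie_k$; these seven triples are the oriented lines of the Fano plane $\mathbb{P}^2(\mathbb{F}_2)$ with points $e_1,\dots,e_7$. $V$ is the span of $e_1,\dots,e_7$; $\mathrm{Tr}:\mathbb{O}\to\mathbb{C}$ is the linear map with kernel $V$ and $\mathrm{Tr}(1)=1$; $q\mapsto\bar q$ is the linear map fixing $1$ and equal to $-1$ on $V$; $\langle q_1,q_2\rangle=\mathrm{Tr}(q_1\bar q_2)$ and $n(q)=\langle q,q\rangle$. $G=G_2(\mathbb{C})$ is the group of algebra automorphisms of $\mathbb{O}$. For $v\in V$ with $n(v)=3$ put $a(v)=(1+v)/2$ and $T_{a(v)}(q)=a(v)\,q\,a(v)^{-1}$. The map $v\mapsto T_{a(v)}$ is a $G$-equivariant isomorphism from $\{v\in V\mid n(v)=3\}$ onto the unique six dimensional semisimple conjugacy class $\mathcal{C}\subset G$. A line of the Fano plane with points $e_i,e_j,e_k$ gives the element $v=e_i+e_j+e_k$ of norm $3$, and hence an element $T_{a(v)}\in\mathcal{C}$. So three lines through a single point give three elements of $\mathcal{C}$; for example the lines through $e_7$ give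 $g_i=T_{a(v_i)}$ with $v_1=e_1+e_3+e_7$, $v_2=e_2+e_6+e_7$, $v_3=e_4+e_5+e_7$. Realisation as a $G_2(\mathbb{C})$ character variety. Let $\mathbb{M}=\mathcal{C}^3/G$ be the affine geometric invariant theory quotient by diagonal conjugation. For triples $(T_{a(v_1)},T_{a(v_2)},T_{a(v_3)})$ the functions $p_1=\langle v_2,v_3\rangle$, $p_2=\langle v_1,v_3\rangle$, $p_3=\langle v_1,v_2\rangle$, $p_4=\langle v_1,v_2v_3\rangle$ identify $\mathbb{M}$ with $\mathbb{C}^4$. The formulae $p_1=1-2x$, $p_2=1-2y$, $p_3=1-2z$, $p_1+p_2+p_3+p_4=4b+5$ define an isomorphism from $\mathbb{M}$ to $\mathbb{C}^4$ with coordinates $(x,y,z,b)$. For a regular semisimple (twelve dimensional) conjugacy class $\mathcal{C}_\infty\subset G$, the character variety $\{(g_1,g_2,g_3,g_\infty)\mid g_1,g_2,g_3\in\mathcal{C},\ g_\infty\in\mathcal{C}_\infty,\ g_1g_2g_3g_\infty=1\}/G$ is a subvariety of $\mathbb{M}$ (via $(g_1,g_2,g_3)$), and this isomorphism identifies each of its connected components (also called $G_2(\mathbb{C})$ character varieties) with a smooth symmetric Fricke cubic surface, for some fixed values of $b,c$. The Klein cubic surface $K$ ($b=-1$, $c=0$) arises in this way, so its points become classes of triples $(g_1,g_2,g_3)\in\mathcal{C}^3$. $G_2(\mathbb{F}_2)'$ is the derived subgroup (of index two) of $G_2(\mathbb{F}_2)$; it is isomorphic to $U_3(3)$. *)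

theory Defs
  imports
    "HOL-Analysis.Analysis"
    "HOL-Algebra.Generated_Groups"
    "HOL-Algebra.SimpleGroups"
    "HOL-Library.Z2"
begin

section \<open>Automorphism groups of (non-associative) algebras\<close>

definition algebra_aut_group ::
    "('k::field \<Rightarrow> 'a::ab_group_add \<Rightarrow> 'a) \<Rightarrow> ('a \<Rightarrow> 'a \<Rightarrow> 'a) \<Rightarrow> ('a \<Rightarrow> 'a) monoid" where
  "algebra_aut_group smul prd =
     \<lparr>carrier = {f. bij f \<and> Vector_Spaces.linear smul smul f \<and> (\<forall>x y. f (prd x y) = prd (f x) (f y))},
      monoid.mult = (\<circ>), one = id\<rparr>"


section \<open>Complex octonions and the Fano plane\<close>

text \<open>Coordinate 0 is the coefficient of the unit, coordinate i (for i = 1, ..., 7) that of e_i.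
  (In the index type 8 the numerals are read modulo 8.)\<close>

type_synonym octonion = "complex ^ 8"

definition oct_e :: "8 \<Rightarrow> octonion" where
  "oct_e i = axis i 1"

definition oriented_fano_lines :: "(8 \<times> 8 \<times> 8) set" where
  "oriented_fano_lines = {(1,2,4), (2,3,5), (3,4,6), (4,5,7), (5,6,1), (6,7,2), (7,1,3)}"

text \<open>For distinct nonzero i, j one has e_i e_j = oct_sign i j k * e_k for the third point k of
  the line through i and j; in all other cases oct_sign vanishes.\<close>

definition oct_sign :: "8 \<Rightarrow> 8 \<Rightarrow> 8 \<Rightarrow> complex" where
  "oct_sign i j k =
     (if {(i,j,k), (j,k,i), (k,i,j)} \<inter> oriented_fano_lines \<noteq> {} then 1
      else if {(j,i,k), (i,k,j), (k,j,i)} \<inter> oriented_fano_lines \<noteq> {} then - 1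
      else 0)"

definition oct_mult :: "octonion \<Rightarrow> octonion \<Rightarrow> octonion" (infixl "\<odot>" 70) where
  "q \<odot> r = (\<chi> k. if k = 0 then q $ 0 * r $ 0 - (\<Sum>i\<in>UNIV - {0}. q $ i * r $ i)
                 else q $ 0 * r $ k + q $ k * r $ 0
                      + (\<Sum>i\<in>UNIV. \<Sum>j\<in>UNIV. oct_sign i j k * q $ i * r $ j))"

definition oct_tr :: "octonion \<Rightarrow> complex" where
  "oct_tr q = q $ 0"

definition oct_conj :: "octonion \<Rightarrow> octonion" where
  "oct_conj q = (\<chi> k. if k = 0 then q $ k else - q $ k)"

definition oct_form :: "octonion \<Rightarrow> octonion \<Rightarrow> complex" where
  "oct_form q r = oct_tr (q \<odot> oct_conj r)"

definition oct_n :: "octonion \<Rightarrow> complex" where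
  "oct_n q = oct_form q q"

definition oct_inv :: "octonion \<Rightarrow> octonion" where
  "oct_inv q = inverse (oct_n q) *s oct_conj q"

definition oct_V :: "octonion set" where
  "oct_V = {q. oct_tr q = 0}"

definition fano_lines :: "8 set set" where
  "fano_lines = (\<lambda>(i,j,k). {i,j,k}) ` oriented_fano_lines"

definition lines_through :: "8 \<Rightarrow> 8 set set" where
  "lines_through m = {L \<in> fano_lines. m \<in> L}"

definition line_vector :: "8 set \<Rightarrow> octonion" where
  "line_vector L = (\<Sum>i\<in>L. oct_e i)"


section \<open>The group of type \<open>G\<^sub>2\<close> over the complex numbers\<close>

abbreviation G2_C :: "(octonion \<Rightarrow> octonion) monoid" where
  "G2_C \<equiv> algebra_aut_group (*s) (\<odot>)"

type_synonym g2_triple = "(octonion \<Rightarrow> octonion) \<times> (octonion \<Rightarrow> octonion) \<times> (octonion \<Rightarrow> octonion)"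

definition norm3_vectors :: "octonion set" where
  "norm3_vectors = {v \<in> oct_V. oct_n v = 3}"

definition oct_a :: "octonion \<Rightarrow> octonion" where
  "oct_a v = (1/2) *s (oct_e 0 + v)"

definition oct_T :: "octonion \<Rightarrow> octonion \<Rightarrow> octonion" where
  "oct_T a q = (a \<odot> q) \<odot> oct_inv a"

definition six_dim_class :: "(octonion \<Rightarrow> octonion) set" where
  "six_dim_class = (\<lambda>v. oct_T (oct_a v)) ` norm3_vectors"

definition line_element :: "8 set \<Rightarrow> octonion \<Rightarrow> octonion" where
  "line_element L = oct_T (oct_a (line_vector L))"

fun conj_triple :: "(octonion \<Rightarrow> octonion) \<Rightarrow> g2_triple \<Rightarrow> g2_triple" where
  "conj_triple h (g1, g2, g3) =
     (h \<otimes>\<^bsub>G2_C\<^esub> g1 \<otimes>\<^bsub>G2_C\<^esub> inv\<^bsub>G2_C\<^esub> h,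
      h \<otimes>\<^bsub>G2_C\<^esub> g2 \<otimes>\<^bsub>G2_C\<^esub> inv\<^bsub>G2_C\<^esub> h,
      h \<otimes>\<^bsub>G2_C\<^esub> g3 \<otimes>\<^bsub>G2_C\<^esub> inv\<^bsub>G2_C\<^esub> h)"

definition triple_class :: "g2_triple \<Rightarrow> g2_triple set" where
  "triple_class t = {conj_triple h t | h. h \<in> carrier G2_C}"

fun generated_group :: "g2_triple \<Rightarrow> (octonion \<Rightarrow> octonion) set" where
  "generated_group (g1, g2, g3) = generate G2_C {g1, g2, g3}"


section \<open>Symmetric cubic surfaces as character varieties for \<open>G\<^sub>2\<close>\<close>

text \<open>The affine quotient of triples in the six-dimensional class by diagonal conjugation is
  identified with the affine space of points (x, y, z, b).  The relation below says that a triple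
  lies over the point (x, y, z, b) of that quotient.\<close>

fun over_moduli_point :: "g2_triple \<Rightarrow> complex \<times> complex \<times> complex \<times> complex \<Rightarrow> bool" where
  "over_moduli_point (g1, g2, g3) (x, y, z, b) \<longleftrightarrow>
     (\<exists>v1\<in>norm3_vectors. \<exists>v2\<in>norm3_vectors. \<exists>v3\<in>norm3_vectors.
        g1 = oct_T (oct_a v1) \<and> g2 = oct_T (oct_a v2) \<and> g3 = oct_T (oct_a v3) \<and>
        oct_form v2 v3 = 1 - 2 * x \<and> oct_form v1 v3 = 1 - 2 * y \<and> oct_form v1 v2 = 1 - 2 * z \<and>
        oct_form v2 v3 + oct_form v1 v3 + oct_form v1 v2 + oct_form v1 (v2 \<odot> v3) = 4 * b + 5)"

definition semisimple_elt :: "(octonion \<Rightarrow> octonion) \<Rightarrow> bool" where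
  "semisimple_elt g \<longleftrightarrow> vec.span {q. \<exists>c. g q = c *s q} = UNIV"

text \<open>The Lie algebra of the centraliser of g: the derivations of the octonions commuting with g.
  Since the group has dimension 14 and rank 2, a semisimple g is regular (has a
  twelve-dimensional conjugacy class) iff this space has dimension 2.\<close>

definition commuting_derivations :: "(octonion \<Rightarrow> octonion) \<Rightarrow> (complex ^ 8 ^ 8) set" where
  "commuting_derivations g =
     {D. (\<forall>q r. D *v (q \<odot> r) = (D *v q) \<odot> r + q \<odot> (D *v r)) \<and> (\<forall>q. D *v g q = g (D *v q))}"

definition regular_semisimple_class :: "(octonion \<Rightarrow> octonion) set \<Rightarrow> bool" where
  "regular_semisimple_class C \<longleftrightarrow>
     (\<exists>g\<in>carrier G2_C. semisimple_elt g \<and>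
        vector_space.dim (\<lambda>c (A :: complex ^ 8 ^ 8). \<chi> i j. c * A $ i $ j) (commuting_derivations g) = 2 \<and>
        C = {h \<otimes>\<^bsub>G2_C\<^esub> g \<otimes>\<^bsub>G2_C\<^esub> inv\<^bsub>G2_C\<^esub> h | h. h \<in> carrier G2_C})"

text \<open>The fourth element of a quadruple with product 1 is determined by the first three, so
  the character variety is described by triples.\<close>

definition character_triples :: "(octonion \<Rightarrow> octonion) set \<Rightarrow> g2_triple set" where
  "character_triples Cinf =
     {(g1, g2, g3) | g1 g2 g3. g1 \<in> six_dim_class \<and> g2 \<in> six_dim_class \<and> g3 \<in> six_dim_class \<and>
        (\<exists>ginf\<in>Cinf. g1 \<otimes>\<^bsub>G2_C\<^esub> g2 \<otimes>\<^bsub>G2_C\<^esub> g3 \<otimes>\<^bsub>G2_C\<^esub> ginf = \<one>\<^bsub>G2_C\<^esub>)}"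

definition character_variety ::
    "(octonion \<Rightarrow> octonion) set \<Rightarrow> (complex \<times> complex \<times> complex \<times> complex) set" where
  "character_variety Cinf = {m. \<exists>t\<in>character_triples Cinf. over_moduli_point t m}"


section \<open>The Klein cubic surface\<close>

definition klein_surface :: "(complex \<times> complex \<times> complex) set" where
  "klein_surface = {(x, y, z). x * y * z + x^2 + y^2 + z^2 = x + y + z}"

text \<open>The Klein surface sits in the quotient of triples as part of the slice b = -1.\<close>

fun klein_moduli :: "complex \<times> complex \<times> complex \<Rightarrow> complex \<times> complex \<times> complex \<times> complex" where
  "klein_moduli (x, y, z) = (x, y, z, - 1)"

definition klein_realised_by :: "(octonion \<Rightarrow> octonion) set \<Rightarrow> bool" where
  "klein_realised_by Cinf \<longleftrightarrow>
     regular_semisimple_class Cinf \<and>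
     klein_moduli ` klein_surface \<in> components (character_variety Cinf)"

definition klein_triples :: "complex \<times> complex \<times> complex \<Rightarrow> g2_triple set" where
  "klein_triples P = {t. over_moduli_point t (klein_moduli P)}"


section \<open>The braid group action\<close>

fun braid1 :: "('a, 'b) monoid_scheme \<Rightarrow> 'a \<times> 'a \<times> 'a \<Rightarrow> 'a \<times> 'a \<times> 'a" where
  "braid1 H (g1, g2, g3) = (g2, inv\<^bsub>H\<^esub> g2 \<otimes>\<^bsub>H\<^esub> g1 \<otimes>\<^bsub>H\<^esub> g2, g3)"

fun braid2 :: "('a, 'b) monoid_scheme \<Rightarrow> 'a \<times> 'a \<times> 'a \<Rightarrow> 'a \<times> 'a \<times> 'a" where
  "braid2 H (g1, g2, g3) = (g1, g3, inv\<^bsub>H\<^esub> g3 \<otimes>\<^bsub>H\<^esub> g2 \<otimes>\<^bsub>H\<^esub> g3)"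

text \<open>Two triples are in the same braid group orbit iff they are joined by a chain of
  generators and inverses of generators.\<close>

definition braid_moves :: "('a, 'b) monoid_scheme \<Rightarrow> (('a \<times> 'a \<times> 'a) \<times> ('a \<times> 'a \<times> 'a)) set" where
  "braid_moves H =
     {(t, braid1 H t) | t. t \<in> carrier H \<times> carrier H \<times> carrier H} \<union>
     {(t, braid2 H t) | t. t \<in> carrier H \<times> carrier H \<times> carrier H}"

definition braid_orbit :: "('a, 'b) monoid_scheme \<Rightarrow> 'a \<times> 'a \<times> 'a \<Rightarrow> ('a \<times> 'a \<times> 'a) set" where
  "braid_orbit H t = {s. (t, s) \<in> (braid_moves H \<union> (braid_moves H)\<inverse>)\<^sup>*}"

definition SL2_C :: "(complex ^ 2 ^ 2) monoid" where
  "SL2_C = \<lparr>carrier = {A. det A = 1}, monoid.mult = (**), one = mat 1\<rparr>"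

definition klein_sl2_triples :: "((complex ^ 2 ^ 2) \<times> (complex ^ 2 ^ 2) \<times> (complex ^ 2 ^ 2)) set" where
  "klein_sl2_triples =
     {(M1, M2, M3). M1 \<in> carrier SL2_C \<and> M2 \<in> carrier SL2_C \<and> M3 \<in> carrier SL2_C \<and>
        trace M1 = complex_of_real (2 * cos (2 * pi / 7)) \<and>
        trace M2 = complex_of_real (2 * cos (2 * pi / 7)) \<and>
        trace M3 = complex_of_real (2 * cos (2 * pi / 7)) \<and>
        trace (M1 ** M2 ** M3) = complex_of_real (2 * cos (4 * pi / 7))}"

fun sl2_coords ::
    "(complex ^ 2 ^ 2) \<times> (complex ^ 2 ^ 2) \<times> (complex ^ 2 ^ 2) \<Rightarrow> complex \<times> complex \<times> complex" where
  "sl2_coords (M1, M2, M3) = (trace (M2 ** M3), trace (M1 ** M3), trace (M1 ** M2))"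

definition klein_braid_orbit :: "complex \<times> complex \<times> complex \<Rightarrow> (complex \<times> complex \<times> complex) set" where
  "klein_braid_orbit P =
     {sl2_coords s | s M. M \<in> klein_sl2_triples \<and> sl2_coords M = P \<and> s \<in> braid_orbit SL2_C M}"


section \<open>The group of type \<open>G\<^sub>2\<close> over the field with two elements\<close>

text \<open>The structure constants of the basis 1, e_1, ..., e_7 define a degenerate algebra in
  characteristic 2.  The octonion algebra over a finite field is the split one, given here by
  Zorn's vector matrices: (a, u, w, b) stands for the matrix with diagonal entries a, b and
  off-diagonal entries the vectors u (upper right) and w (lower left).\<close>

type_synonym 'k zorn = "'k \<times> ('k ^ 3) \<times> ('k ^ 3) \<times> 'k"

definition dot3 :: "'k::field ^ 3 \<Rightarrow> 'k ^ 3 \<Rightarrow> 'k" where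
  "dot3 u w = (\<Sum>i\<in>UNIV. u $ i * w $ i)"

definition cross3_field :: "'k::field ^ 3 \<Rightarrow> 'k ^ 3 \<Rightarrow> 'k ^ 3" where
  "cross3_field u w =
     vector [u $ 2 * w $ 3 - u $ 3 * w $ 2, u $ 3 * w $ 1 - u $ 1 * w $ 3, u $ 1 * w $ 2 - u $ 2 * w $ 1]"

fun zorn_scale :: "'k::field \<Rightarrow> 'k zorn \<Rightarrow> 'k zorn" where
  "zorn_scale c (a, u, w, b) = (c * a, c *s u, c *s w, c * b)"

fun zorn_mult :: "'k::field zorn \<Rightarrow> 'k zorn \<Rightarrow> 'k zorn" where
  "zorn_mult (a, u, w, b) (a', u', w', b') =
     (a * a' + dot3 u w',
      a *s u' + b' *s u - cross3_field w w',
      a' *s w + b *s w' + cross3_field u u',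
      b * b' + dot3 w u')"

abbreviation G2_F2 :: "(bit zorn \<Rightarrow> bit zorn) monoid" where
  "G2_F2 \<equiv> algebra_aut_group zorn_scale zorn_mult"

definition G2_F2_derived :: "(bit zorn \<Rightarrow> bit zorn) monoid" where
  "G2_F2_derived = G2_F2\<lparr>carrier := derived G2_F2 (carrier G2_F2)\<rparr>"

end

theory Submission
  imports Defs
begin

text \<open>
  With \<open>a = (1 + v) / 2\<close> one has \<open>a\<^sup>2 = a - 1\<close>, and left multiplications by three such elements satisfy Clifford
  relations.  The span of the eight words \<open>1, a, b, c, ab, ac, bc, a(bc)\<close> is therefore a subalgebra whose
  structure depends only on the four invariants of the triple.  Applied to the square of the complex octonions
  this produces, as a graph, an automorphism between any two triples with the same invariants, so each of the
  seven points is a single conjugacy class of triples; braid moves, which do not change the generated group,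
  connect representatives of the seven classes.

  Applied over the integers to the product of the complex octonions and the Zorn algebra over the field with two
  elements, the same statement gives the reduction modulo 2 of an integral octonion ring.  It is injective
  on the group generated by the three line elements, because two congruent integral elements of norm 1 are equal
  or opposite.  The image is the group generated by the conjugations with the 56 elements
  \<open>w\<^sup>2 = w - 1\<close>.  It has index two in \<open>G\<^sub>2(2)\<close>: the full group has order \<open>56 * 27 * 8\<close> by successive
  stabilisers, and the subgroup preserves one half of the 72 nontrivial idempotents.  A normal subgroup of it moving some
  \<open>w\<close> identifies the conjugations of all adjacent pairs up to inversion, hence contains all of them.
\<close>

section \<open>Automorphism groups and alternative algebras\<close>

text \<open>The integral span of 1 and the e_i is useless modulo 2, since its structure constants
  degenerate there. Halving, as in \<open>a = (1 + v) / 2\<close>, leads to a larger order whose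
  reduction is the split algebra, and the parameters in the relations of these halves are integers
  at all seven points. Arguing with the relations between three elements, not with a multiplication
  table for eight, lets one closure argument serve the complex numbers, characteristic two and the
  integral product of both; it may therefore neither divide by 2 nor use associativity. That the
  eight words span is not automatic: it is checked once for the lines and carried along braid moves,
  which do not change the generated subalgebra. Finiteness of the line group is never checked
  directly. It follows from the isomorphism with a group in characteristic two, where questions are
  decided by running through 256 elements.\<close>

lemma linear_iff_preserves:
  assumes "vector_space s"
  shows "Vector_Spaces.linear s s f \<longleftrightarrow> (\<forall>x y. f (x + y) = f x + f y) \<and> (\<forall>c x. f (s c x) = s c (f x))"
  using assms by (simp add: Vector_Spaces.linear_iff)

lemma carrier_algebra_aut:
  assumes "vector_space s"
  shows "f \<in> carrier (algebra_aut_group s m) \<longleftrightarrow> bij f \<and> (\<forall>x y. f (x + y) = f x + f y)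
    \<and> (\<forall>c x. f (s c x) = s c (f x)) \<and> (\<forall>x y. f (m x y) = m (f x) (f y))"
  by (auto simp: algebra_aut_group_def linear_iff_preserves[OF assms])

lemma algebra_aut_inv:
  assumes "vector_space s" "f \<in> carrier (algebra_aut_group s m)"
  shows "Hilbert_Choice.inv f \<in> carrier (algebra_aut_group s m)"
proof -
  have f: "bij f" "\<And>x y. f (x + y) = f x + f y" "\<And>c x. f (s c x) = s c (f x)"
    "\<And>x y. f (m x y) = m (f x) (f y)"
    using assms by (auto simp: carrier_algebra_aut)
  have "Hilbert_Choice.inv f (x + y) = Hilbert_Choice.inv f x + Hilbert_Choice.inv f y" for x y
    by (rule inv_f_eq) (use f in \<open>auto simp: bij_is_inj bij_is_surj surj_f_inv_f\<close>)
  moreover have "Hilbert_Choice.inv f (s c x) = s c (Hilbert_Choice.inv f x)" for c x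
    by (rule inv_f_eq) (use f in \<open>auto simp: bij_is_inj bij_is_surj surj_f_inv_f\<close>)
  moreover have "Hilbert_Choice.inv f (m x y) = m (Hilbert_Choice.inv f x) (Hilbert_Choice.inv f y)" for x y
    by (rule inv_f_eq) (use f in \<open>auto simp: bij_is_inj bij_is_surj surj_f_inv_f\<close>)
  ultimately show ?thesis
    using f(1) by (simp add: carrier_algebra_aut[OF assms(1)] bij_imp_bij_inv)
qed

lemma mult_algebra_aut [simp]: "f \<otimes>\<^bsub>algebra_aut_group s m\<^esub> g = f \<circ> g"
  and one_algebra_aut [simp]: "\<one>\<^bsub>algebra_aut_group s m\<^esub> = id"
  by (simp_all add: algebra_aut_group_def)

lemma group_algebra_aut:
  assumes "vector_space s"
  shows "group (algebra_aut_group s m)"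
proof (rule groupI)
  fix f assume "f \<in> carrier (algebra_aut_group s m)"
  then show "\<exists>g\<in>carrier (algebra_aut_group s m). g \<otimes>\<^bsub>algebra_aut_group s m\<^esub> f = \<one>\<^bsub>algebra_aut_group s m\<^esub>"
    using algebra_aut_inv[OF assms] by (intro bexI[of _ "Hilbert_Choice.inv f"])
      (auto simp: carrier_algebra_aut[OF assms] bij_is_inj)
qed (auto simp: carrier_algebra_aut[OF assms] intro: bij_comp simp flip: id_def)

text \<open>Scalars form only a commutative ring because one instance has integer scalars. Right
  alternativity is derived from \<open>left_alt\<close> by means of the involution.\<close>

locale alternative_algebra = module scale
  for scale :: "'k::comm_ring_1 \<Rightarrow> 'a::ab_group_add \<Rightarrow> 'a" (infixr \<open>*c\<close> 75) +
  fixes mul :: "'a \<Rightarrow> 'a \<Rightarrow> 'a" (infixl \<open>\<star>\<close> 70) and unit :: 'a (\<open>\<e>\<close>) and cnj :: "'a \<Rightarrow> 'a"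
  assumes mul_add: "x \<star> (y + z) = x \<star> y + x \<star> z"
    and add_mul: "(x + y) \<star> z = x \<star> z + y \<star> z"
    and mul_scale: "x \<star> (c *c y) = c *c (x \<star> y)"
    and scale_mul: "(c *c x) \<star> y = c *c (x \<star> y)"
    and unit_mul [simp]: "\<e> \<star> x = x"
    and mul_unit [simp]: "x \<star> \<e> = x"
    and left_alt: "x \<star> (x \<star> y) = (x \<star> x) \<star> y"
    and cnj_add: "cnj (x + y) = cnj x + cnj y"
    and cnj_scale: "cnj (c *c x) = c *c cnj x"
    and cnj_mul: "cnj (x \<star> y) = cnj y \<star> cnj x"
    and cnj_cnj [simp]: "cnj (cnj x) = x"
begin

lemma mul_zero [simp]: "x \<star> 0 = 0" and zero_mul [simp]: "0 \<star> x = 0" and cnj_zero [simp]: "cnj 0 = 0"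
  using mul_add[of x 0 0] add_mul[of 0 0 x] cnj_add[of 0 0] by simp_all

lemma mul_minus: "x \<star> (- y) = - (x \<star> y)" and minus_mul: "(- x) \<star> y = - (x \<star> y)"
  and cnj_minus: "cnj (- y) = - cnj y"
  using mul_add[of x y "- y"] add_mul[of x "- x" y] cnj_add[of y "- y"]
  by (simp_all add: eq_neg_iff_add_eq_0 add.commute)

lemma mul_diff: "x \<star> (y - z) = x \<star> y - x \<star> z" and diff_mul: "(x - y) \<star> z = x \<star> z - y \<star> z"
  and cnj_diff: "cnj (x - y) = cnj x - cnj y"
  using mul_add[of x y "- z"] add_mul[of x "- y" z] cnj_add[of x "- y"]
  by (simp_all add: mul_minus minus_mul cnj_minus)

lemmas mul_distribs = mul_add add_mul mul_diff diff_mul mul_minus minus_mul mul_scale scale_mul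

lemma cnj_unit [simp]: "cnj \<e> = \<e>"
  by (metis cnj_cnj cnj_mul mul_unit)

lemma right_alt: "(y \<star> x) \<star> x = y \<star> (x \<star> x)"
  by (metis cnj_cnj cnj_mul left_alt)

lemma left_alt_linear: "x \<star> (y \<star> z) + y \<star> (x \<star> z) = (x \<star> y + y \<star> x) \<star> z"
  using left_alt[of "x + y" z] by (simp add: mul_distribs left_alt algebra_simps)

lemma right_alt_linear: "(z \<star> x) \<star> y + (z \<star> y) \<star> x = z \<star> (x \<star> y + y \<star> x)"
  using right_alt[of z "x + y"] by (simp add: mul_distribs right_alt algebra_simps)

text \<open>Linearised alternativity, read as a rule for moving brackets: a product acting on
  \<open>z\<close> is traded for \<open>x\<close> and \<open>y\<close> multiplying \<open>z\<close>
  one after the other. This replaces associativity throughout.\<close>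

lemma mul_mul_left: "(x \<star> y) \<star> z = x \<star> (y \<star> z) + x \<star> (z \<star> y) - (x \<star> z) \<star> y"
  using right_alt_linear[of x y z] by (simp add: mul_distribs algebra_simps)

lemma mul_mul_right: "z \<star> (x \<star> y) = (z \<star> x) \<star> y + (x \<star> z) \<star> y - x \<star> (z \<star> y)"
  using left_alt_linear[of z x y] by (simp add: mul_distribs algebra_simps)

lemma flexible: "(x \<star> y) \<star> x = x \<star> (y \<star> x)"
  using mul_mul_left[of x y x] by (simp add: left_alt)

text \<open>Expanding by linearised alternativity leaves two surplus pairs. By \<open>c\<close> and
  \<open>d\<close> both are equal to
  \<open>(x \<star> x) \<star> (y \<star> z + z \<star> y)\<close>, and they cancel. No division
  occurs, so the identity is available in characteristic two.\<close>

lemma left_moufang: "((x \<star> y) \<star> x) \<star> z = x \<star> (y \<star> (x \<star> z))"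
proof -
  have a: "(x \<star> y) \<star> (x \<star> z) = x \<star> (y \<star> (x \<star> z)) + x \<star> ((x \<star> z) \<star> y) - (x \<star> (x \<star> z)) \<star> y"
    by (rule mul_mul_left)
  have b: "((x \<star> y) \<star> x) \<star> z = (x \<star> y) \<star> (x \<star> z) + x \<star> ((x \<star> y) \<star> z) - (x \<star> (x \<star> y)) \<star> z"
    using left_alt_linear[of "x \<star> y" x z] by (simp add: mul_distribs algebra_simps)
  have c: "x \<star> ((x \<star> z) \<star> y) + x \<star> ((x \<star> y) \<star> z) = (x \<star> x) \<star> (y \<star> z + z \<star> y)"
    by (metis left_alt mul_add right_alt_linear add.commute)
  have d: "(x \<star> (x \<star> z)) \<star> y + (x \<star> (x \<star> y)) \<star> z = (x \<star> x) \<star> (y \<star> z + z \<star> y)"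
    by (metis left_alt right_alt_linear add.commute)
  have "((x \<star> y) \<star> x) \<star> z = x \<star> (y \<star> (x \<star> z)) + (x \<star> ((x \<star> z) \<star> y) + x \<star> ((x \<star> y) \<star> z))
      - ((x \<star> (x \<star> z)) \<star> y + (x \<star> (x \<star> y)) \<star> z)"
    unfolding b a by (simp add: algebra_simps)
  then show ?thesis by (simp only: c d add_diff_cancel_right')
qed

lemma right_moufang: "((z \<star> x) \<star> y) \<star> x = z \<star> (x \<star> (y \<star> x))"
proof -
  have "cnj (((z \<star> x) \<star> y) \<star> x) = cnj (z \<star> (x \<star> (y \<star> x)))"
    by (simp add: cnj_mul flip: left_moufang)
  then show ?thesis by (metis cnj_cnj)
qed

text \<open>For \<open>a \<star> a = a - \<e>\<close> the element \<open>\<e> - a\<close> is the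
  inverse of \<open>a\<close>, so this is the inner map x to a x a^-1, written without
  division.\<close>

definition conjugation :: "'a \<Rightarrow> 'a \<Rightarrow> 'a" where
  "conjugation a x = (a \<star> x) \<star> (\<e> - a)"

lemma conjugation_add: "conjugation a (x + y) = conjugation a x + conjugation a y"
  and conjugation_scale: "conjugation a (c *c x) = c *c conjugation a x"
  by (simp_all add: conjugation_def mul_distribs scale_right_diff_distrib)

context
  fixes a assumes sq: "a \<star> a = a - \<e>"
begin

lemma conjugation_alt: "conjugation a x = a \<star> (x \<star> (\<e> - a))"
  by (simp add: conjugation_def mul_distribs flexible)

lemma conjugation_inverse: "conjugation a (conjugation (\<e> - a) x) = x"
proof -
  have "conjugation a (conjugation (\<e> - a) x) = (a \<star> ((\<e> - a) \<star> (x \<star> a))) \<star> (\<e> - a)"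
    by (simp add: conjugation_def mul_distribs flexible)
  also have "a \<star> ((\<e> - a) \<star> (x \<star> a)) = x \<star> a" by (simp add: mul_distribs left_alt sq)
  finally show ?thesis by (simp add: mul_distribs right_alt sq)
qed

text \<open>Because \<open>a \<star> a\<close> is the negative of the inverse
  \<open>\<e> - a\<close>, the two signs cancel. The square of a conjugation is thus its inverse,
  and its cube is trivial.\<close>

lemma conjugation_twice: "conjugation a (conjugation a x) = conjugation (\<e> - a) x"
proof -
  have "conjugation a (conjugation a x) = (a \<star> (a \<star> (x \<star> (\<e> - a)))) \<star> (\<e> - a)"
    by (simp only: conjugation_alt) (simp add: flip: conjugation_def conjugation_alt)
  also have "\<dots> = ((a \<star> a) \<star> x) \<star> ((\<e> - a) \<star> (\<e> - a))"
    by (simp add: left_alt sq mul_distribs flexible right_alt)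
  also have "\<dots> = conjugation (\<e> - a) x"
    by (simp add: conjugation_def sq mul_distribs)
  finally show ?thesis .
qed

text \<open>Since \<open>a\<^sup>3 = - 1\<close>, both \<open>a\<inverse> = - a\<^sup>2\<close> and \<open>a = - a\<^sup>-\<^sup>2\<close>, which puts the two factors
  into a shape to which the Moufang identities apply.\<close>

lemma conjugation_mul: "conjugation a (x \<star> y) = conjugation a x \<star> conjugation a y"
proof -
  define b where "b = \<e> - a"
  have ba: "b \<star> (a \<star> z) = z" "a \<star> (b \<star> z) = z" "(z \<star> a) \<star> b = z" for z
    by (simp_all add: b_def mul_distribs left_alt right_alt sq)
  have aa: "a \<star> a = - b" and bb: "b \<star> b = - a" by (simp_all add: b_def mul_distribs sq)
  have x: "conjugation a x = - (((a \<star> x) \<star> a) \<star> a)"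
    by (simp add: conjugation_def right_alt aa mul_minus flip: b_def)
  have y: "conjugation a y = - (b \<star> (b \<star> (y \<star> b)))"
    by (simp add: conjugation_alt left_alt bb minus_mul flip: b_def)
  have "conjugation a x \<star> conjugation a y = (((a \<star> x) \<star> a) \<star> a) \<star> (b \<star> ((b \<star> y) \<star> b))"
    by (simp add: x y mul_minus minus_mul flexible)
  also have "\<dots> = (((a \<star> x) \<star> a) \<star> (b \<star> y)) \<star> b"
    using right_moufang[of "((a \<star> x) \<star> a) \<star> a" b "b \<star> y"] by (simp add: ba)
  also have "\<dots> = (a \<star> (x \<star> y)) \<star> b" by (simp add: left_moufang ba)
  finally show ?thesis by (simp add: conjugation_def b_def)
qed

end

section \<open>Multiplicative closure of spans of words\<close>

definition idealizer :: "'a set \<Rightarrow> 'a set" where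
  "idealizer S = {p. \<forall>s\<in>S. p \<star> s \<in> S \<and> s \<star> p \<in> S}"

text \<open>By \<open>mul_mul_left\<close> and \<open>mul_mul_right\<close> a product of
  \<open>p\<close> and \<open>q\<close> acts on \<open>S\<close> through successive multiplications
  by \<open>p\<close> and \<open>q\<close>. Closure of a span under multiplication then has to be
  checked on generators only.\<close>

lemma idealizer_mul:
  assumes "subspace S" "p \<in> idealizer S" "q \<in> idealizer S"
  shows "p \<star> q \<in> idealizer S"
  unfolding idealizer_def
proof (intro CollectI ballI conjI)
  fix s assume s: "s \<in> S"
  have pq: "p \<star> s \<in> S" "s \<star> p \<in> S" "q \<star> s \<in> S" "s \<star> q \<in> S" if "s \<in> S" for s
    using assms that by (auto simp: idealizer_def)
  show "(p \<star> q) \<star> s \<in> S"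
    unfolding mul_mul_left[of p q s] by (intro subspace_diff subspace_add assms pq s)
  show "s \<star> (p \<star> q) \<in> S"
    unfolding mul_mul_right[of s p q] by (intro subspace_diff subspace_add assms pq s)
qed

lemma subspace_idealizer:
  assumes "subspace S" shows "subspace (idealizer S)"
  by (rule subspaceI) (auto simp: idealizer_def mul_distribs intro: subspace_add subspace_scale subspace_0 assms)

definition words :: "'a \<Rightarrow> 'a \<Rightarrow> 'a \<Rightarrow> 'a list" where
  "words a b c = [\<e>, a, b, c, a \<star> b, a \<star> c, b \<star> c, a \<star> (b \<star> c)]"

lemma words_subset_iff: "set (words a b c) \<subseteq> S \<longleftrightarrow>
    \<e> \<in> S \<and> a \<in> S \<and> b \<in> S \<and> c \<in> S \<and> a \<star> b \<in> S \<and> a \<star> c \<in> S \<and> b \<star> c \<in> S \<and> a \<star> (b \<star> c) \<in> S"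
  by (simp add: words_def)

lemma words_subset:
  assumes "\<And>x y. x \<in> S \<Longrightarrow> y \<in> S \<Longrightarrow> x \<star> y \<in> S" "\<e> \<in> S" "a \<in> S" "b \<in> S" "c \<in> S"
  shows "set (words a b c) \<subseteq> S"
  using assms by (simp add: words_subset_iff)

end

text \<open>Left multiplications by \<open>a\<close>, \<open>b\<close>, \<open>c\<close> satisfy Clifford relations, so eight words span a left
  ideal for them; the trace condition makes this span stable under the involution as well.\<close>

locale word_triple = alternative_algebra +
  fixes a b c :: 'b and r s t u :: 'a
  assumes sq: "a \<star> a = a - \<e>" "b \<star> b = b - \<e>" "c \<star> c = c - \<e>"
    and anti: "b \<star> a = a + b - r *c \<e> - a \<star> b" "c \<star> a = a + c - s *c \<e> - a \<star> c"
      "c \<star> b = b + c - t *c \<e> - b \<star> c"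
    and cnj: "cnj a = \<e> - a" "cnj b = \<e> - b" "cnj c = \<e> - c"
    and cnj3: "cnj (a \<star> (b \<star> c)) = u *c \<e> - a \<star> (b \<star> c)"
begin

abbreviation "W \<equiv> span (set (words a b c))"

lemma W_words: "\<e> \<in> W" "a \<in> W" "b \<in> W" "c \<in> W" "a \<star> b \<in> W" "a \<star> c \<in> W" "b \<star> c \<in> W" "a \<star> (b \<star> c) \<in> W"
  by (auto intro!: span_base simp: words_def)

text \<open>The anticommutation relations, multiplied by an arbitrary \<open>x\<close> through
  linearised left alternativity, move the letters into the order a, b, c; repeated letters are
  reduced by \<open>sq\<close>.\<close>

lemma W_left:
  assumes "x \<in> W" shows "a \<star> x \<in> W \<and> b \<star> x \<in> W \<and> c \<star> x \<in> W"
proof -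
  have sq': "p \<star> (p \<star> x) = p \<star> x - x" if "p \<in> {a, b, c}" for p x
    using that by (auto simp: left_alt sq mul_distribs)
  have ba: "b \<star> (a \<star> x) = a \<star> x + b \<star> x - r *c x - a \<star> (b \<star> x)"
    and ca: "c \<star> (a \<star> x) = a \<star> x + c \<star> x - s *c x - a \<star> (c \<star> x)"
    and cb: "c \<star> (b \<star> x) = b \<star> x + c \<star> x - t *c x - b \<star> (c \<star> x)" for x
    using left_alt_linear[of a b x] left_alt_linear[of a c x] left_alt_linear[of b c x]
    by (simp_all add: anti mul_distribs algebra_simps)
  note mems = W_words span_add span_diff span_scale
  have "subspace {x. a \<star> x \<in> W \<and> b \<star> x \<in> W \<and> c \<star> x \<in> W}"
    by (rule subspaceI) (auto simp: mul_distribs intro: span_add span_scale span_zero)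
  moreover have "set (words a b c) \<subseteq> {x. a \<star> x \<in> W \<and> b \<star> x \<in> W \<and> c \<star> x \<in> W}"
    by (simp add: words_subset_iff sq' sq ba ca cb anti mul_distribs mems)
  ultimately show ?thesis using span_minimal assms by blast
qed

text \<open>The involution reverses a word, and for words of two letters the result is reordered by
  \<open>anti\<close>. For \<open>a \<star> (b \<star> c)\<close> the reversed word is bracketed to
  the left, out of reach of left multiplications; this is the case for which \<open>cnj3\<close> is
  imposed.\<close>

lemma W_cnj:
  assumes "x \<in> W" shows "cnj x \<in> W"
proof -
  note mems = W_words W_left span_add span_diff span_scale
  have "subspace {x. cnj x \<in> W}"
    by (rule subspaceI) (auto simp: cnj_add cnj_scale intro: span_add span_scale span_zero)
  moreover have "set (words a b c) \<subseteq> {x. cnj x \<in> W}"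
    unfolding words_subset_iff mem_Collect_eq cnj3 by (simp add: cnj cnj_mul anti mul_distribs mems)
  ultimately show ?thesis using span_minimal assms by blast
qed

lemma W_mul:
  assumes "x \<in> W" "y \<in> W" shows "x \<star> y \<in> W"
proof -
  have "p \<in> idealizer W" if "p \<in> {a, b, c}" for p
    unfolding idealizer_def
  proof (intro CollectI ballI conjI)
    fix s assume s: "s \<in> W"
    show "p \<star> s \<in> W" using W_left[OF s] that by auto
    \<comment> \<open>So far only left multiplications are controlled. Since
      \<open>cnj p = \<e> - p\<close>, the involution turns right multiplication by \<open>p\<close>
      into left multiplication by \<open>\<e> - p\<close>.\<close>
    have "s \<star> p = cnj ((\<e> - p) \<star> cnj s)" using that by (auto simp: cnj_mul cnj_diff cnj)
    also have "\<dots> \<in> W"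
      using W_left[OF W_cnj[OF s]] that by (intro W_cnj) (auto simp: mul_distribs intro: span_diff W_cnj s)
    finally show "s \<star> p \<in> W" .
  qed
  moreover have "\<e> \<in> idealizer W" by (simp add: idealizer_def)
  ultimately have "set (words a b c) \<subseteq> idealizer W"
    by (intro words_subset idealizer_mul) auto
  then have "W \<subseteq> idealizer W" by (intro span_minimal subspace_idealizer) auto
  then show ?thesis using assms by (auto simp: idealizer_def)
qed

end

section \<open>Zorn matrices over the field with two elements\<close>

lemma bit_minus [simp]: "- (x::bit) = x" "(x::bit) - y = x + y"
  by (cases x; cases y; simp)+

definition zorn_one :: "'k::field zorn" where "zorn_one = (1, 0, 0, 1)"

fun zorn_cnj :: "'k::field zorn \<Rightarrow> 'k zorn" where
  "zorn_cnj (a, u, w, b) = (b, - u, - w, a)"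

lemma alternative_algebra_zorn:
  "alternative_algebra (zorn_scale :: 'k::field \<Rightarrow> _) zorn_mult zorn_one zorn_cnj"
proof unfold_locales
  fix c d :: 'k and x y z :: "'k zorn"
  obtain a u w b A U W B p q r s where xyz: "x = (a, u, w, b)" "y = (A, U, W, B)" "z = (p, q, r, s)"
    by (metis prod.exhaust)
  note defs = xyz zorn_one_def dot3_def cross3_field_def vec_eq_iff forall_3 sum_3 vector_3
  show "zorn_scale c (x + y) = zorn_scale c x + zorn_scale c y"
    "zorn_scale (c + d) x = zorn_scale c x + zorn_scale d x"
    "zorn_scale c (zorn_scale d x) = zorn_scale (c * d) x"
    "zorn_scale 1 x = x"
    "zorn_mult x (y + z) = zorn_mult x y + zorn_mult x z"
    "zorn_mult (x + y) z = zorn_mult x z + zorn_mult y z"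
    "zorn_mult x (zorn_scale c y) = zorn_scale c (zorn_mult x y)"
    "zorn_mult (zorn_scale c x) y = zorn_scale c (zorn_mult x y)"
    "zorn_mult zorn_one x = x" "zorn_mult x zorn_one = x"
    "zorn_cnj (x + y) = zorn_cnj x + zorn_cnj y"
    "zorn_cnj (zorn_scale c x) = zorn_scale c (zorn_cnj x)"
    "zorn_cnj (zorn_mult x y) = zorn_mult (zorn_cnj y) (zorn_cnj x)"
    "zorn_cnj (zorn_cnj x) = x"
    by (simp_all add: defs algebra_simps)
  show "zorn_mult x (zorn_mult x y) = zorn_mult (zorn_mult x x) y"
    by (simp add: defs algebra_simps)
qed

interpretation zorn: alternative_algebra "zorn_scale :: bit \<Rightarrow> _" zorn_mult zorn_one zorn_cnj
  by (rule alternative_algebra_zorn)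

lemma vector_space_zorn: "vector_space (zorn_scale :: bit \<Rightarrow> _)"
  by unfold_locales (rule zorn.scale_right_distrib zorn.scale_left_distrib zorn.scale_scale zorn.scale_one)+

interpretation F2: group G2_F2
  by (rule group_algebra_aut[OF vector_space_zorn])

text \<open>Boolean octuples stand for the elements of the Zorn algebra in the finite checks.  Exclusive or is a
  separate constant because the simplifier would split a negated equation of booleans.\<close>

type_synonym o8 = "bool \<times> bool \<times> bool \<times> bool \<times> bool \<times> bool \<times> bool \<times> bool"

definition xor2 :: "bool \<Rightarrow> bool \<Rightarrow> bool" (infixl "\<oplus>" 65) where "x \<oplus> y \<longleftrightarrow> x = (\<not> y)"

fun bmul :: "o8 \<Rightarrow> o8 \<Rightarrow> o8" where
 "bmul (a,u1,u2,u3,w1,w2,w3,b) (A,U1,U2,U3,W1,W2,W3,B) =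
   ((a \<and> A) \<oplus> (u1 \<and> W1) \<oplus> (u2 \<and> W2) \<oplus> (u3 \<and> W3),
    (a \<and> U1) \<oplus> (B \<and> u1) \<oplus> (w2 \<and> W3) \<oplus> (w3 \<and> W2),
    (a \<and> U2) \<oplus> (B \<and> u2) \<oplus> (w3 \<and> W1) \<oplus> (w1 \<and> W3),
    (a \<and> U3) \<oplus> (B \<and> u3) \<oplus> (w1 \<and> W2) \<oplus> (w2 \<and> W1),
    (A \<and> w1) \<oplus> (b \<and> W1) \<oplus> (u2 \<and> U3) \<oplus> (u3 \<and> U2),
    (A \<and> w2) \<oplus> (b \<and> W2) \<oplus> (u3 \<and> U1) \<oplus> (u1 \<and> U3),
    (A \<and> w3) \<oplus> (b \<and> W3) \<oplus> (u1 \<and> U2) \<oplus> (u2 \<and> U1),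
    (b \<and> B) \<oplus> (w1 \<and> U1) \<oplus> (w2 \<and> U2) \<oplus> (w3 \<and> U3))"

fun badd :: "o8 \<Rightarrow> o8 \<Rightarrow> o8" where
 "badd (a,u1,u2,u3,w1,w2,w3,b) (A,U1,U2,U3,W1,W2,W3,B) =
   (a \<oplus> A, u1 \<oplus> U1, u2 \<oplus> U2, u3 \<oplus> U3, w1 \<oplus> W1, w2 \<oplus> W2, w3 \<oplus> W3, b \<oplus> B)"

fun zo :: "o8 \<Rightarrow> bit zorn" where
  "zo (a,u1,u2,u3,w1,w2,w3,b) = (of_bool a, vector [of_bool u1, of_bool u2, of_bool u3],
     vector [of_bool w1, of_bool w2, of_bool w3], of_bool b)"

definition bone :: o8 where "bone = (True,False,False,False,False,False,False,True)"
definition bswap :: "o8 \<Rightarrow> o8" where "bswap = (\<lambda>(a,u1,u2,u3,w1,w2,w3,b). (b,w1,w2,w3,u1,u2,u3,a))"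

definition zorn_swap :: "bit zorn \<Rightarrow> bit zorn" where
  "zorn_swap = (\<lambda>(a, u, w, b). (b, w, u, a))"

lemma of_bool_xor: "of_bool (x \<oplus> y) = (of_bool x + of_bool y :: bit)"
  by (cases x; cases y; simp add: xor2_def)

lemma zo_mul [simp]: "zorn_mult (zo x) (zo y) = zo (bmul x y)"
  by (cases x rule: zo.cases; cases y rule: zo.cases)
     (simp add: of_bool_xor of_bool_conj dot3_def cross3_field_def vec_eq_iff forall_3 sum_3 vector_3 ac_simps del: add_bit_eq_xor mult_bit_eq_and)

lemma zo_add [simp]: "zo x + zo y = zo (badd x y)"
  by (cases x rule: zo.cases; cases y rule: zo.cases)
     (simp add: of_bool_xor vec_eq_iff forall_3 vector_3 del: add_bit_eq_xor)

lemma zo_one: "zorn_one = zo bone"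
  by (simp add: zorn_one_def bone_def vec_eq_iff forall_3 vector_3)

lemma zo_swap [simp]: "zorn_swap (zo x) = zo (bswap x)"
  by (cases x rule: zo.cases) (simp add: zorn_swap_def bswap_def)

lemma zo_inject [simp]: "zo x = zo y \<longleftrightarrow> x = y"
  by (cases x rule: zo.cases; cases y rule: zo.cases)
     (auto simp: vec_eq_iff forall_3 vector_3 of_bool_eq_iff)

lemma zo_surj: "\<exists>y. x = zo y"
proof -
  have "of_bool (b = 1) = b" for b :: bit by (cases b) auto
  then show ?thesis
    by (cases x; intro exI[of _ "case x of (a, u, w, b) \<Rightarrow> (a = 1, u $ 1 = 1, u $ 2 = 1, u $ 3 = 1, w $ 1 = 1, w $ 2 = 1, w $ 3 = 1, b = 1)"])
       (simp add: vec_eq_iff forall_3 vector_3)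
qed

lemma finite_zorn [simp]: "finite (S :: bit zorn set)"
proof -
  have "S \<subseteq> range zo" by (metis rangeI subsetI zo_surj)
  then show ?thesis by (meson finite finite_imageI finite_subset)
qed

lemma zorn_char2: "x + x = (0 :: bit zorn)" "- x = (x :: bit zorn)" "x - y = x + (y :: bit zorn)"
  by (cases x; cases y; simp add: vec_eq_iff zero_prod_def)+

section \<open>Enumerations in the algebra with 256 elements\<close>

definition bits8 :: "o8 list" where
  "bits8 = (let bs = [False, True] in List.product bs (List.product bs (List.product bs (List.product bs
    (List.product bs (List.product bs (List.product bs bs)))))))"

definition bcomp :: "o8 \<Rightarrow> o8" where "bcomp x = badd bone x"
definition bconj :: "o8 \<Rightarrow> o8 \<Rightarrow> o8" where "bconj w x = bmul (bmul w x) (bcomp w)"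
definition bword :: "o8 list \<Rightarrow> o8 \<Rightarrow> o8" where "bword ws x = foldr bconj ws x"

text \<open>One round of orbit growth: images under the word and under its square are added. The
  cube of a single conjugation is trivial, so for a one-letter word this already gives whole orbits
  of the cyclic group.\<close>

definition grow :: "o8 list \<Rightarrow> o8 list \<Rightarrow> o8 list" where
  "grow ws xs = (let ys = map (bword ws) xs in remdups (xs @ ys @ map (bword ws) ys))"

text \<open>Three units with the relations that the reductions of the three line elements satisfy.\<close>

definition gen1 :: o8 where "gen1 = (False,False,False,True,False,False,True,True)"
definition gen2 :: o8 where "gen2 = (False,False,True,False,False,True,True,True)"
definition gen3 :: o8 where "gen3 = (True,False,True,False,False,True,False,False)"

definition bunit :: "o8 \<Rightarrow> bool" where "bunit x \<longleftrightarrow> bmul x x = badd x bone"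
text \<open>The anticommutation relation of \<open>word_triple\<close> with parameter 1. For a unit
  \<open>x\<close> the complement \<open>bcomp x\<close> satisfies the same equation in
  characteristic two and has to be excluded.\<close>

definition badj :: "o8 \<Rightarrow> o8 \<Rightarrow> bool" where
  "badj x y \<longleftrightarrow> badd (bmul y x) (bmul x y) = badd (badd x y) bone \<and> y \<noteq> bcomp x"
text \<open>For units the complement is the conjugate, so the left side is the conjugate of the
  right side: this is the trace condition of \<open>word_triple\<close> with last parameter
  0.\<close>

definition bthird :: "o8 \<Rightarrow> o8 \<Rightarrow> o8 \<Rightarrow> bool" where
  "bthird x y z \<longleftrightarrow> bmul (bmul (bcomp z) (bcomp y)) (bcomp x) = bmul x (bmul y z)"

definition bunits :: "o8 list" where "bunits = filter bunit bits8"
definition bnbrs :: "o8 list" where "bnbrs = filter (badj gen1) bunits"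
definition bthirds :: "o8 list" where "bthirds = filter (\<lambda>z. badj gen2 z \<and> bthird gen1 gen2 z) bnbrs"

text \<open>The idempotents other than 0 and 1 form two orbits of length 36 under the group generated
  by the conjugations; they are exchanged by the swap of the two diagonal entries.\<close>

fun bidem :: "o8 \<Rightarrow> bool" where
  "bidem (a,u1,u2,u3,w1,w2,w3,b) \<longleftrightarrow> b = (\<not> a) \<and> \<not> ((u1 \<and> w1) \<oplus> (u2 \<and> w2) \<oplus> (u3 \<and> w3))
     \<and> a = ((u1 \<or> u2 \<or> u3) = (w1 \<or> w2 \<or> w3))"

text \<open>These words, and the ones in the orbit lemmas, come from a search through the Cayley graph.\<close>

definition rot :: "o8 list" where "rot = [gen3,gen2,gen3,gen1,gen1,gen3,gen2,gen2,gen3,gen1,gen3]"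
definition flip_word :: "o8 list" where "flip_word = [gen3,gen2,gen3,gen2,gen1,gen3,gen2,gen1]"

lemma set_bits8: "set bits8 = UNIV" and distinct_bits8: "distinct bits8"
proof -
  have *: "set [False, True] = UNIV" "distinct [False, True]" by auto
  show "set bits8 = UNIV" by (simp only: bits8_def Let_def set_product * UNIV_Times_UNIV)
  show "distinct bits8" unfolding bits8_def Let_def by (intro distinct_product *)
qed

lemma length_bunits: "length bunits = 56"
  by code_simp

lemma bunits_orbit:
  "let L = foldr grow [[gen1], [gen2], [gen3], [gen1], [gen2], [gen3]] [gen1] in list_all (\<lambda>x. x \<in> set L) bunits"
  by code_simp

lemma bword_bone: "bword [gen1] bone = bone" "bword [gen2] bone = bone" "bword [gen3] bone = bone"
  by code_simp+

lemma length_bnbrs: "length bnbrs = 27"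
  by code_simp

lemma bnbrs_orbit:
  "let L = foldr grow [[gen1], [gen2,gen1,gen2,gen3,gen1,gen3], [gen2,gen1,gen3,gen1,gen2,gen3,gen3]] [gen2] in list_all (\<lambda>x. x \<in> set L) bnbrs"
  by code_simp

lemma bnbrs_words: "bword [gen1] gen1 = gen1" "bword [gen2,gen1,gen2,gen3,gen1,gen3] gen1 = gen1" "bword [gen2,gen1,gen3,gen1,gen2,gen3,gen3] gen1 = gen1"
  by code_simp+

lemma length_bthirds: "length bthirds = 8"
  by code_simp

lemma rot_fixes: "bword rot gen1 = gen1" "bword rot gen2 = gen2"
  and flip_fixes: "bword flip_word (bswap gen1) = gen1" "bword flip_word (bswap gen2) = gen2"
  by code_simp+

lemma bthirds_orbit:
  "let r = bword rot; f = bword flip_word (bswap gen3)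
   in list_all (\<lambda>x. x \<in> set [gen3, r gen3, r (r gen3), r (r (r gen3)), f, r f, r (r f), r (r (r f))]) bthirds"
  by code_simp

lemma bidem_invariant:
  "list_all (\<lambda>x. bidem (bconj gen1 x) \<and> bidem (bconj gen2 x) \<and> bidem (bconj gen3 x)) (filter bidem bits8)"
  by code_simp

text \<open>The count behind it is 56 = 1 + 1 + 27 + 27: \<open>y\<close> and \<open>bcomp y\<close>
  are never both adjacent to \<open>gen1\<close>, because replacing \<open>y\<close> by
  \<open>bcomp y\<close> changes only one side of the defining equation.\<close>

lemma badj_or_comp:
  "list_all (\<lambda>y. y = gen1 \<or> y = bcomp gen1 \<or> badj gen1 y \<or> badj gen1 (bcomp y)) bunits"
  by code_simp

lemma g_units: "bunit gen1" "bunit gen2" "bunit gen3"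
  and g_adj: "badj gen1 gen2" "badj gen1 gen3" "badj gen2 gen3" "badj gen3 gen2" "badj gen2 gen1" "badj gen3 gen1"
  and g_third: "bthird gen1 gen2 gen3"
  by code_simp+

text \<open>Together with \<open>badj gen1 gen2\<close> this is a path of three adjacent steps from
  \<open>gen1\<close> to its own complement. In the simplicity proof it links a conjugation with its
  inverse.\<close>

lemma adj_path: "let z = (False,False,False,True,True,False,True,True)
    in bunit z \<and> badj gen2 z \<and> badj z (bcomp gen1)"
  by code_simp

section \<open>The eight words span modulo 2\<close>

definition extend :: "o8 \<Rightarrow> o8 list \<Rightarrow> o8 list" where "extend w xs = xs @ map (badd w) xs"

definition bwords :: "o8 list" where
  "bwords = [bone, gen1, gen2, gen3, bmul gen1 gen2, bmul gen1 gen3, bmul gen2 gen3, bmul gen1 (bmul gen2 gen3)]"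

definition bbasis :: "o8 list" where
  "bbasis = map (\<lambda>i. (i = 0, i = 1, i = 2, i = 3, i = 4, i = 5, i = 6, i = 7)) [0::nat, 1, 2, 3, 4, 5, 6, 7]"

text \<open>Each \<open>extend\<close> doubles the list, so the fold produces all 256 subset sums of
  the words, starting from zero, written as \<open>badd bone bone\<close>. The coordinate vectors
  are found among them.\<close>

lemma bbasis_in_words_span:
  "list_all (\<lambda>x. x \<in> set (foldr extend bwords [badd bone bone])) bbasis"
  by code_simp

lemma bbasis_closure:
  assumes E: "\<And>x y. x \<in> E \<Longrightarrow> y \<in> E \<Longrightarrow> badd x y \<in> E" and b: "set bbasis \<subseteq> E"
  shows "x \<in> E"
proof -
  have "badd bone bone \<in> E"
    using E[of "(True,False,False,False,False,False,False,False)" "(True,False,False,False,False,False,False,False)"] b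
    by (simp add: bbasis_def bone_def xor2_def)
  then have z: "(False,False,False,False,False,False,False,False) \<in> E" by (simp add: bone_def xor2_def)
  have b': "(a,False,False,False,False,False,False,False) \<in> E" "(False,a,False,False,False,False,False,False) \<in> E"
    "(False,False,a,False,False,False,False,False) \<in> E" "(False,False,False,a,False,False,False,False) \<in> E"
    "(False,False,False,False,a,False,False,False) \<in> E" "(False,False,False,False,False,a,False,False) \<in> E"
    "(False,False,False,False,False,False,a,False) \<in> E" "(False,False,False,False,False,False,False,a) \<in> E" for a
    using b z by (cases a; simp add: bbasis_def)+
  obtain a u1 u2 u3 w1 w2 w3 b where x: "x = (a,u1,u2,u3,w1,w2,w3,b)" by (metis prod.exhaust)
  have "badd (badd (badd (badd (badd (badd (badd (a,False,False,False,False,False,False,False)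
      (False,u1,False,False,False,False,False,False)) (False,False,u2,False,False,False,False,False))
      (False,False,False,u3,False,False,False,False)) (False,False,False,False,w1,False,False,False))
      (False,False,False,False,False,w2,False,False)) (False,False,False,False,False,False,w3,False))
      (False,False,False,False,False,False,False,b) \<in> E"
    by (intro E b')
  then show ?thesis by (simp add: x xor2_def)
qed

text \<open>The form in which spanning is used: the additively closed set will be the set where two
  automorphisms agree, or the image of the reduction map.\<close>

lemma bwords_closure:
  assumes E: "\<And>x y. x \<in> E \<Longrightarrow> y \<in> E \<Longrightarrow> badd x y \<in> E" and b: "set bwords \<subseteq> E"
  shows "x \<in> E"
proof -
  have "badd bone bone \<in> E" using E b by (simp add: bwords_def)
  moreover have "set ws \<subseteq> E \<Longrightarrow> set xs \<subseteq> E \<Longrightarrow> set (foldr extend ws xs) \<subseteq> E" for ws xs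
  proof (induction ws)
    case (Cons w ws)
    then have "w \<in> E" "set (foldr extend ws xs) \<subseteq> E" by simp_all
    then show ?case unfolding foldr.simps comp_def extend_def set_append set_map using E by blast
  qed simp
  ultimately have "set (foldr extend bwords [badd bone bone]) \<subseteq> E" using b by simp
  then have "set bbasis \<subseteq> E" using bbasis_in_words_span unfolding list_all_iff by blast
  then show ?thesis using E bbasis_closure by blast
qed

section \<open>The automorphism group of the Zorn algebra\<close>

declare split_paired_All [simp del] split_paired_Ex [simp del]

definition zorn_units :: "bit zorn set" where
  "zorn_units = {w. zorn_mult w w = w - zorn_one}"

definition zorn_adj :: "bit zorn \<Rightarrow> bit zorn \<Rightarrow> bool" where
  "zorn_adj x y \<longleftrightarrow> zorn_mult y x + zorn_mult x y = x + y - zorn_one \<and> y \<noteq> zorn_one - x"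

definition zorn_third :: "bit zorn \<Rightarrow> bit zorn \<Rightarrow> bit zorn \<Rightarrow> bool" where
  "zorn_third x y z \<longleftrightarrow> zorn_mult (zorn_mult (zorn_one - z) (zorn_one - y)) (zorn_one - x)
     = zorn_mult x (zorn_mult y z)"

lemma zo_comp [simp]: "zorn_one - zo x = zo (bcomp x)"
  by (simp add: zorn_char2 zo_one bcomp_def)

lemma zo_minus_one [simp]: "zo x - zorn_one = zo (badd x bone)"
  by (simp add: zorn_char2 zo_one)

lemma zo_unit [simp]: "zo x \<in> zorn_units \<longleftrightarrow> bunit x"
  and zo_adj [simp]: "zorn_adj (zo x) (zo y) \<longleftrightarrow> badj x y"
  and zo_third [simp]: "zorn_third (zo x) (zo y) (zo z) \<longleftrightarrow> bthird x y z"
  by (simp_all add: zorn_units_def zorn_adj_def zorn_third_def bunit_def badj_def bthird_def)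

lemma zo_conj [simp]: "zorn.conjugation (zo w) (zo x) = zo (bconj w x)"
  by (simp add: zorn.conjugation_def bconj_def)

lemma zorn_aut_iff: "f \<in> carrier G2_F2 \<longleftrightarrow> bij f \<and> (\<forall>x y. f (x + y) = f x + f y)
    \<and> (\<forall>c x. f (zorn_scale c x) = zorn_scale c (f x)) \<and> (\<forall>x y. f (zorn_mult x y) = zorn_mult (f x) (f y))"
  by (rule carrier_algebra_aut[OF vector_space_zorn])

lemma zorn_aut:
  assumes "f \<in> carrier G2_F2"
  shows "f (x + y) = f x + f y" "f (x - y) = f x - f y" "f (zorn_mult x y) = zorn_mult (f x) (f y)"
    "f zorn_one = zorn_one" "f x = f y \<longleftrightarrow> x = y"
proof -
  show m: "f (x + y) = f x + f y" "f (zorn_mult x y) = zorn_mult (f x) (f y)" for x y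
    using assms unfolding zorn_aut_iff by blast+
  show i: "f x = f y \<longleftrightarrow> x = y" for x y using assms unfolding zorn_aut_iff bij_def inj_def by blast
  show "f (x - y) = f x - f y" using m by (simp add: zorn_char2)
  obtain e where "f e = zorn_one" using assms by (metis zorn_aut_iff bij_pointE)
  then show "f zorn_one = zorn_one" using m(2)[of zorn_one e] by simp
qed

lemma zorn_aut_rel:
  assumes "f \<in> carrier G2_F2"
  shows "f x \<in> zorn_units \<longleftrightarrow> x \<in> zorn_units" "zorn_adj (f x) (f y) \<longleftrightarrow> zorn_adj x y"
    "zorn_third (f x) (f y) (f z) \<longleftrightarrow> zorn_third x y z"
proof -
  have c: "f x - zorn_one = f (x - zorn_one)" "zorn_one - f x = f (zorn_one - x)" for x
    by (simp_all only: zorn_aut(2,4)[OF assms])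
  note hom = zorn_aut(1,3)[OF assms, symmetric] c zorn_aut(5)[OF assms]
  show "f x \<in> zorn_units \<longleftrightarrow> x \<in> zorn_units" "zorn_adj (f x) (f y) \<longleftrightarrow> zorn_adj x y"
    "zorn_third (f x) (f y) (f z) \<longleftrightarrow> zorn_third x y z"
    by (simp_all only: zorn_units_def zorn_adj_def zorn_third_def mem_Collect_eq hom)
qed

lemma zorn_aut_conj:
  assumes "f \<in> carrier G2_F2"
  shows "f (zorn.conjugation w x) = zorn.conjugation (f w) (f x)"
  using zorn_aut[OF assms] by (simp add: zorn.conjugation_def)

lemma zorn_unit_comp: "w \<in> zorn_units \<Longrightarrow> zorn_one - w \<in> zorn_units"
  by (simp add: zorn_units_def zorn.mul_distribs)

lemma zorn_unitsD: "w \<in> zorn_units \<Longrightarrow> zorn_mult w w = w - zorn_one"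
  by (simp add: zorn_units_def)

lemma zorn_conj_inverse:
  assumes "w \<in> zorn_units"
  shows "zorn.conjugation w \<circ> zorn.conjugation (zorn_one - w) = id"
    "zorn.conjugation (zorn_one - w) \<circ> zorn.conjugation w = id"
  using zorn.conjugation_inverse[of w] zorn.conjugation_inverse[of "zorn_one - w"] zorn_unitsD[OF assms]
    zorn_unitsD[OF zorn_unit_comp[OF assms]]
  by (simp_all add: fun_eq_iff)

lemma zorn_conj_aut:
  assumes "w \<in> zorn_units" shows "zorn.conjugation w \<in> carrier G2_F2"
proof -
  have "bij (zorn.conjugation w)" using zorn_conj_inverse[OF assms] by (rule o_bij[rotated])
  then show ?thesis using zorn_unitsD[OF assms]
    by (simp add: zorn_aut_iff zorn.conjugation_add zorn.conjugation_scale zorn.conjugation_mul)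
qed

lemma zorn_conj_inv:
  assumes "w \<in> zorn_units" shows "inv\<^bsub>G2_F2\<^esub> (zorn.conjugation w) = zorn.conjugation (zorn_one - w)"
  using zorn_conj_aut zorn_unit_comp[OF assms] assms zorn_conj_inverse[OF assms]
  by (intro F2.inv_equality) auto

lemma zorn_conj_conj:
  assumes "f \<in> carrier G2_F2"
  shows "f \<circ> zorn.conjugation w \<circ> inv\<^bsub>G2_F2\<^esub> f = zorn.conjugation (f w)"
proof -
  have "zorn.conjugation (f w) \<circ> f = f \<circ> zorn.conjugation w"
    using zorn_aut_conj[OF assms] by (simp add: fun_eq_iff)
  then have "f \<circ> zorn.conjugation w \<circ> inv\<^bsub>G2_F2\<^esub> f = zorn.conjugation (f w) \<circ> (f \<circ> inv\<^bsub>G2_F2\<^esub> f)"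
    by (simp add: o_assoc)
  then show ?thesis using F2.r_inv[OF assms] by simp
qed

lemma zorn_swap_aut: "zorn_swap \<in> carrier G2_F2"
proof -
  have s: "zorn_swap \<circ> zorn_swap = id" by (auto simp: zorn_swap_def fun_eq_iff)
  then have "bij zorn_swap" by (rule o_bij[OF _ s])
  then show ?thesis unfolding zorn_aut_iff
  proof (intro conjI allI)
    fix x y :: "bit zorn" and c
    obtain a u w b A U W B where xy: "x = (a, u, w, b)" "y = (A, U, W, B)" by (metis prod.exhaust)
    show "zorn_swap (x + y) = zorn_swap x + zorn_swap y"
      "zorn_swap (zorn_scale c x) = zorn_scale c (zorn_swap x)"
      by (simp_all add: xy zorn_swap_def)
    show "zorn_swap (zorn_mult x y) = zorn_mult (zorn_swap x) (zorn_swap y)"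
      by (simp add: xy zorn_swap_def dot3_def cross3_field_def vec_eq_iff forall_3 vector_3 sum_3 ac_simps
          del: add_bit_eq_xor mult_bit_eq_and)
  qed
qed

lemma zorn_swap_swap: "zorn_swap \<circ> zorn_swap = id"
  by (auto simp: zorn_swap_def fun_eq_iff)

section \<open>The group generated by the conjugations and its orbits\<close>

definition unit_group :: "(bit zorn \<Rightarrow> bit zorn) set" where
  "unit_group = generate G2_F2 {zorn.conjugation (zo gen1), zorn.conjugation (zo gen2), zorn.conjugation (zo gen3)}"

lemma zo_g_units: "zo gen1 \<in> zorn_units" "zo gen2 \<in> zorn_units" "zo gen3 \<in> zorn_units"
  using g_units by (simp_all only: zo_unit)

lemma subgroup_unit_group: "subgroup unit_group G2_F2"
  unfolding unit_group_def using zorn_conj_aut zo_g_units by (intro F2.generate_is_subgroup) auto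

lemma unit_group_aut: "f \<in> unit_group \<Longrightarrow> f \<in> carrier G2_F2"
  by (rule subgroup.mem_carrier[OF subgroup_unit_group])

lemma unit_group_comp: "f \<in> unit_group \<Longrightarrow> g \<in> unit_group \<Longrightarrow> f \<circ> g \<in> unit_group"
  using subgroup.m_closed[OF subgroup_unit_group] by simp

lemma unit_group_id: "id \<in> unit_group"
  using subgroup.one_closed[OF subgroup_unit_group] by simp

lemma unit_group_inv: "f \<in> unit_group \<Longrightarrow> inv\<^bsub>G2_F2\<^esub> f \<in> unit_group"
  by (rule subgroup.m_inv_closed[OF subgroup_unit_group])

lemma zorn_inv_comp:
  assumes "f \<in> carrier G2_F2"
  shows "inv\<^bsub>G2_F2\<^esub> f \<circ> f = id" "f \<circ> inv\<^bsub>G2_F2\<^esub> f = id"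
    "(inv\<^bsub>G2_F2\<^esub> f) (f x) = x" "f ((inv\<^bsub>G2_F2\<^esub> f) x) = x"
proof -
  show *: "inv\<^bsub>G2_F2\<^esub> f \<circ> f = id" "f \<circ> inv\<^bsub>G2_F2\<^esub> f = id"
    using F2.l_inv[OF assms] F2.r_inv[OF assms] by simp_all
  show "(inv\<^bsub>G2_F2\<^esub> f) (f x) = x" "f ((inv\<^bsub>G2_F2\<^esub> f) x) = x"
    using *[THEN fun_cong, of x] by simp_all
qed

lemma bword_unit_group:
  assumes "set ws \<subseteq> {gen1, gen2, gen3}"
  shows "\<exists>f\<in>unit_group. \<forall>x. f (zo x) = zo (bword ws x)"
  using assms
proof (induction ws)
  case Nil
  then show ?case by (intro bexI[OF _ unit_group_id]) (simp add: bword_def)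
next
  case (Cons w ws)
  then obtain f where f: "f \<in> unit_group" "\<forall>x. f (zo x) = zo (bword ws x)" by auto
  have "zorn.conjugation (zo w) \<in> unit_group"
    using Cons.prems unfolding unit_group_def by (auto intro: generate.incl)
  then show ?case using f by (intro bexI[OF _ unit_group_comp[of "zorn.conjugation (zo w)" f]]) (auto simp: bword_def)
qed

text \<open>The fixed point \<open>p\<close> lets one notion describe two orbits: with
  \<open>p = gen1\<close> the orbit under a stabiliser, and with \<open>p = bone\<close>, which
  every automorphism fixes, the full orbit.\<close>

definition reachable :: "o8 \<Rightarrow> o8 \<Rightarrow> o8 \<Rightarrow> bool" where
  "reachable p a x \<longleftrightarrow> (\<exists>f\<in>unit_group. f (zo p) = zo p \<and> f (zo a) = zo x)"

lemma reachable_grow: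
  assumes "set ws \<subseteq> {gen1, gen2, gen3}" "bword ws p = p" "\<forall>x\<in>set xs. reachable p a x"
  shows "\<forall>x\<in>set (grow ws xs). reachable p a x"
proof -
  obtain f where f: "f \<in> unit_group" "\<And>x. f (zo x) = zo (bword ws x)"
    using bword_unit_group[OF assms(1)] by auto
  have "reachable p a (bword ws x)" if r: "reachable p a x" for x
  proof -
    obtain h where h: "h \<in> unit_group" "h (zo p) = zo p" "h (zo a) = zo x"
      using r unfolding reachable_def by blast
    show ?thesis unfolding reachable_def
      by (intro bexI[OF _ unit_group_comp[OF f(1) h(1)]]) (simp add: h f assms(2))
  qed
  then show ?thesis using assms(3) by (simp add: grow_def Let_def ball_Un)
qed

lemma reachable_foldr_grow:
  assumes "\<forall>ws\<in>set L. set ws \<subseteq> {gen1, gen2, gen3} \<and> bword ws p = p"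
  shows "\<forall>x\<in>set (foldr grow L [a]). reachable p a x"
  using assms
proof (induction L)
  case Nil
  have "reachable p a a" unfolding reachable_def by (rule bexI[OF _ unit_group_id]) simp
  then show ?case by simp
next
  case (Cons ws L)
  have "set ws \<subseteq> {gen1, gen2, gen3}" "bword ws p = p" using Cons.prems by simp_all
  moreover have "\<forall>x\<in>set (foldr grow L [a]). reachable p a x" using Cons.prems by (intro Cons.IH) simp
  ultimately show ?case unfolding foldr.simps comp_def by (rule reachable_grow)
qed

lemma zorn_cases: obtains y where "x = zo y"
  using zo_surj by blast

lemma bunits_iff: "x \<in> set bunits \<longleftrightarrow> bunit x"
  and bnbrs_iff: "x \<in> set bnbrs \<longleftrightarrow> bunit x \<and> badj gen1 x"
  and bthirds_iff: "x \<in> set bthirds \<longleftrightarrow> bunit x \<and> badj gen1 x \<and> badj gen2 x \<and> bthird gen1 gen2 x"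
  by (auto simp: bunits_def bnbrs_def bthirds_def set_bits8)

lemma unit_orbit:
  assumes "x \<in> zorn_units" shows "\<exists>f\<in>unit_group. f (zo gen1) = x"
proof -
  obtain y where y: "x = zo y" by (rule zorn_cases)
  have "\<forall>x\<in>set (foldr grow [[gen1], [gen2], [gen3], [gen1], [gen2], [gen3]] [gen1]). reachable bone gen1 x"
    by (rule reachable_foldr_grow) (simp add: bword_bone)
  moreover have "y \<in> set bunits" using assms unfolding y zo_unit bunits_iff .
  ultimately have "reachable bone gen1 y" using bunits_orbit unfolding Let_def list_all_iff by blast
  then show ?thesis unfolding reachable_def y by blast
qed

lemma adj_orbit_fixed:
  assumes "x \<in> zorn_units" "zorn_adj (zo gen1) x"
  shows "\<exists>f\<in>unit_group. f (zo gen1) = zo gen1 \<and> f (zo gen2) = x"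
proof -
  obtain y where y: "x = zo y" by (rule zorn_cases)
  have "\<forall>x\<in>set (foldr grow [[gen1], [gen2,gen1,gen2,gen3,gen1,gen3], [gen2,gen1,gen3,gen1,gen2,gen3,gen3]] [gen2]). reachable gen1 gen2 x"
    by (rule reachable_foldr_grow) (simp add: bnbrs_words)
  moreover have "y \<in> set bnbrs" using assms unfolding y zo_unit zo_adj bnbrs_iff by blast
  ultimately have "reachable gen1 gen2 y" using bnbrs_orbit unfolding Let_def list_all_iff by blast
  then show ?thesis unfolding reachable_def y .
qed

lemma adj_orbit:
  assumes "x \<in> zorn_units" "y \<in> zorn_units" "zorn_adj x y"
  shows "\<exists>f\<in>unit_group. f (zo gen1) = x \<and> f (zo gen2) = y"
proof -
  obtain f where f: "f \<in> unit_group" "f (zo gen1) = x" using unit_orbit[OF assms(1)] by blast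
  define f' where "f' = inv\<^bsub>G2_F2\<^esub> f"
  have f': "f' \<in> unit_group" "f (f' y) = y" "f' x = zo gen1"
    using unit_group_inv[OF f(1)] zorn_inv_comp(3,4)[OF unit_group_aut[OF f(1)]] f(2)
    by (simp_all only: f'_def f(2)[symmetric])
  have "f' y \<in> zorn_units" "zorn_adj (zo gen1) (f' y)"
    using zorn_aut_rel(1)[OF unit_group_aut[OF f'(1)], of y] zorn_aut_rel(2)[OF unit_group_aut[OF f'(1)], of x y]
      assms f'(3) by simp_all
  from adj_orbit_fixed[OF this] obtain h where h: "h \<in> unit_group" "h (zo gen1) = zo gen1" "h (zo gen2) = f' y"
    by blast
  show ?thesis by (rule bexI[OF _ unit_group_comp[OF f(1) h(1)]]) (simp add: h f f')
qed

text \<open>Inside \<open>unit_group\<close> the stabiliser of \<open>zo gen1\<close> and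
  \<open>zo gen2\<close> consists of the four powers of \<open>rot\<close> and reaches half of the
  eight candidates. The swap, corrected by \<open>flip_word\<close> so that it fixes both units,
  reaches the other half.\<close>

lemma third_orbit:
  assumes "x \<in> zorn_units" "zorn_adj (zo gen1) x" "zorn_adj (zo gen2) x" "zorn_third (zo gen1) (zo gen2) x"
  shows "\<exists>f\<in>unit_group \<union> (\<lambda>f. f \<circ> zorn_swap) ` unit_group.
    f (zo gen1) = zo gen1 \<and> f (zo gen2) = zo gen2 \<and> f (zo gen3) = x"
proof -
  obtain y where y: "x = zo y" by (rule zorn_cases)
  obtain r where r: "r \<in> unit_group" "\<And>x. r (zo x) = zo (bword rot x)"
    using bword_unit_group[of rot] by (auto simp: rot_def)
  obtain s where s: "s \<in> unit_group" "\<And>x. s (zo x) = zo (bword flip_word x)"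
    using bword_unit_group[of flip_word] by (auto simp: flip_word_def)
  let ?S = "unit_group \<union> (\<lambda>f. f \<circ> zorn_swap) ` unit_group"
  define P where "P y \<longleftrightarrow> (\<exists>f\<in>?S. f (zo gen1) = zo gen1 \<and> f (zo gen2) = zo gen2 \<and> f (zo gen3) = zo y)" for y
  have 1: "P gen3" unfolding P_def by (rule bexI[of _ id]) (simp_all add: unit_group_id)
  have 2: "P (bword flip_word (bswap gen3))" unfolding P_def
    by (rule bexI[of _ "s \<circ> zorn_swap"]) (simp_all add: s flip_fixes)
  have 3: "P (bword rot y)" if P: "P y" for y
  proof -
    obtain f where f: "f \<in> ?S" "f (zo gen1) = zo gen1" "f (zo gen2) = zo gen2" "f (zo gen3) = zo y"
      using P unfolding P_def by blast
    have "r \<circ> f \<in> ?S" using f(1) unit_group_comp[OF r(1)] by (auto simp: o_assoc)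
    then show ?thesis unfolding P_def by (rule bexI[rotated]) (simp add: f r rot_fixes)
  qed
  have "y \<in> set bthirds" using assms unfolding y zo_unit zo_adj zo_third bthirds_iff by blast
  then have "y \<in> set (let r = bword rot; f = bword flip_word (bswap gen3) in [gen3, r gen3, r (r gen3), r (r (r gen3)), f, r f, r (r f), r (r (r f))])"
    using bthirds_orbit unfolding Let_def list_all_iff by blast
  then have "P y" unfolding Let_def list.set by (elim insertE emptyE) (simp_all only: 1 2 3)
  then show ?thesis unfolding P_def y .
qed

text \<open>The set where two automorphisms agree is closed under sums and products, so it contains
  the eight words and hence everything.\<close>

lemma zorn_aut_eqI:
  assumes f: "f \<in> carrier G2_F2" and g: "g \<in> carrier G2_F2"
    and eq: "f (zo gen1) = g (zo gen1)" "f (zo gen2) = g (zo gen2)" "f (zo gen3) = g (zo gen3)"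
  shows "f = g"
proof
  fix x
  obtain y where y: "x = zo y" by (rule zorn_cases)
  note fg = zorn_aut(1,3,4)[OF f] zorn_aut(1,3,4)[OF g]
  define E where "E = {y. f (zo y) = g (zo y)}"
  have E: "badd x y \<in> E" "bmul x y \<in> E" if "x \<in> E" "y \<in> E" for x y
    using that fg(1,2)[of "zo x" "zo y"] fg(4,5)[of "zo x" "zo y"] by (simp_all add: E_def)
  have "bone \<in> E" using fg(3,6) by (simp add: E_def zo_one)
  moreover have "gen1 \<in> E" "gen2 \<in> E" "gen3 \<in> E" using eq by (simp_all add: E_def)
  ultimately have "set bwords \<subseteq> E" by (simp add: bwords_def E)
  then have "y \<in> E" using E(1) bwords_closure by blast
  then show "f x = g x" by (simp add: E_def y)
qed

lemma zo_g_rel: "zorn_adj (zo gen1) (zo gen2)" "zorn_adj (zo gen1) (zo gen3)" "zorn_adj (zo gen2) (zo gen3)"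
  "zorn_third (zo gen1) (zo gen2) (zo gen3)"
  using g_adj g_third by (simp_all only: zo_adj zo_third)

text \<open>Some element of \<open>unit_group\<close> matches \<open>f\<close> on the first two
  generators. After dividing by it, the image of the third generator is one of the candidates of
  \<open>third_orbit\<close>, and three values determine an automorphism.\<close>

lemma zorn_aut_cosets:
  assumes f: "f \<in> carrier G2_F2"
  shows "f \<in> unit_group \<or> f \<circ> zorn_swap \<in> unit_group"
proof -
  note rel = zorn_aut_rel[OF f]
  obtain h where h: "h \<in> unit_group" "h (zo gen1) = f (zo gen1)" "h (zo gen2) = f (zo gen2)"
    using adj_orbit[of "f (zo gen1)" "f (zo gen2)"] rel zo_g_units zo_g_rel by metis
  define k where "k = inv\<^bsub>G2_F2\<^esub> h"
  have k: "k \<in> unit_group" "h \<circ> k = id" "k (f (zo gen1)) = zo gen1" "k (f (zo gen2)) = zo gen2"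
    using unit_group_inv[OF h(1)] zorn_inv_comp[OF unit_group_aut[OF h(1)]]
    by (simp_all only: k_def h(2,3)[symmetric])
  have kf: "k \<circ> f \<in> carrier G2_F2" using F2.m_closed[OF unit_group_aut[OF k(1)] f] by simp
  note rel = zorn_aut_rel[OF kf]
  obtain l where l: "l \<in> unit_group \<union> (\<lambda>f. f \<circ> zorn_swap) ` unit_group"
    "l (zo gen1) = zo gen1" "l (zo gen2) = zo gen2" "l (zo gen3) = (k \<circ> f) (zo gen3)"
    using third_orbit[of "(k \<circ> f) (zo gen3)"] rel[of "zo gen3"] rel(2)[of "zo gen1" "zo gen3"] rel(2)[of "zo gen2" "zo gen3"]
      rel(3)[of "zo gen1" "zo gen2" "zo gen3"] zo_g_units zo_g_rel k(3,4) unfolding comp_apply by auto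
  have "l \<in> carrier G2_F2"
    using l(1) unit_group_aut F2.m_closed[OF _ zorn_swap_aut] by auto
  then have "l = k \<circ> f" using zorn_aut_eqI[OF _ kf] l k by simp
  then have "f = h \<circ> l" using k(2) by (simp add: o_assoc)
  then show ?thesis using l(1) unit_group_comp[OF h(1)] zorn_swap_swap by (auto simp: o_assoc[symmetric])
qed

lemma conj_in_unit_group:
  assumes "w \<in> zorn_units" shows "zorn.conjugation w \<in> unit_group"
proof -
  obtain f where f: "f \<in> unit_group" "f (zo gen1) = w" using unit_orbit[OF assms] by blast
  have "zorn.conjugation (zo gen1) \<in> unit_group" unfolding unit_group_def by (rule generate.incl) simp
  then have "f \<circ> zorn.conjugation (zo gen1) \<circ> inv\<^bsub>G2_F2\<^esub> f \<in> unit_group"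
    by (intro unit_group_comp unit_group_inv f(1))
  then show ?thesis unfolding zorn_conj_conj[OF unit_group_aut[OF f(1)]] f(2) .
qed

text \<open>The set of units is defined by an equation and so is preserved by every automorphism;
  with this generating set normality in the full group is immediate.\<close>

lemma unit_group_eq: "unit_group = generate G2_F2 (zorn.conjugation ` zorn_units)"
proof
  show "unit_group \<subseteq> generate G2_F2 (zorn.conjugation ` zorn_units)"
    unfolding unit_group_def using zo_g_units by (intro F2.mono_generate) blast
  show "generate G2_F2 (zorn.conjugation ` zorn_units) \<subseteq> unit_group"
    using conj_in_unit_group by (intro F2.generate_subgroup_incl subgroup_unit_group) blast
qed

lemma normal_unit_group: "unit_group \<lhd> G2_F2"
  unfolding unit_group_eq
proof (rule F2.normal_generateI)
  show "zorn.conjugation ` zorn_units \<subseteq> carrier G2_F2" using zorn_conj_aut by blast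
  fix h g assume "h \<in> zorn.conjugation ` zorn_units" and g: "g \<in> carrier G2_F2"
  then obtain w where w: "w \<in> zorn_units" "h = zorn.conjugation w" by blast
  have "g \<otimes>\<^bsub>G2_F2\<^esub> h \<otimes>\<^bsub>G2_F2\<^esub> inv\<^bsub>G2_F2\<^esub> g = zorn.conjugation (g w)"
    unfolding mult_algebra_aut w(2) by (rule zorn_conj_conj[OF g])
  then show "g \<otimes>\<^bsub>G2_F2\<^esub> h \<otimes>\<^bsub>G2_F2\<^esub> inv\<^bsub>G2_F2\<^esub> g \<in> zorn.conjugation ` zorn_units"
    using zorn_aut_rel(1)[OF g] w(1) by blast
qed

lemma zorn_conj_twice:
  assumes "w \<in> zorn_units"
  shows "zorn.conjugation w \<circ> zorn.conjugation w = zorn.conjugation (zorn_one - w)"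
  using zorn.conjugation_twice[OF zorn_unitsD[OF assms]] by (simp add: fun_eq_iff)

lemma bidem_bconj:
  assumes "g \<in> {gen1, gen2, gen3}" "bidem x" shows "bidem (bconj g x)"
proof -
  have "x \<in> set (filter bidem bits8)" using assms(2) by (simp add: set_bits8)
  then show ?thesis using bidem_invariant assms(1) unfolding list_all_iff by blast
qed

lemma unit_group_bidem:
  assumes "f \<in> unit_group" shows "f ` zo ` Collect bidem \<subseteq> zo ` Collect bidem"
  using assms unfolding unit_group_def
proof (induction rule: generate.induct)
  case one
  then show ?case by simp
next
  case (incl h)
  then obtain g where g: "h = zorn.conjugation (zo g)" "g \<in> {gen1, gen2, gen3}" by blast
  then show ?case using bidem_bconj[OF g(2)] by (simp add: image_subset_iff del: bidem.simps)
next
  case (inv h)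
  then obtain g where g: "h = zorn.conjugation (zo g)" "g \<in> {gen1, gen2, gen3}" by blast
  \<comment> \<open>The inverse of a conjugation is its square, so the enumeration for the
    generators suffices.\<close>
  have "inv\<^bsub>G2_F2\<^esub> h = h \<circ> h"
    using g zo_g_units zorn_conj_inv zorn_conj_twice by (metis empty_iff insert_iff)
  then show ?case using bidem_bconj[OF g(2)] g(1) by (simp add: image_subset_iff del: bidem.simps)
next
  case (eng h1 h2)
  then show ?case unfolding mult_algebra_aut image_comp[symmetric] by blast
qed

lemma zorn_swap_not_unit: "zorn_swap \<notin> unit_group"
proof
  assume "zorn_swap \<in> unit_group"
  \<comment> \<open>The diagonal idempotent with entries 1 and 0 lies in the invariant half, its
    swap in the other one.\<close>
  let ?e = "(True,False,False,False,False,False,False,False)"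
  have "zorn_swap (zo ?e) \<in> zo ` Collect bidem"
  proof -
    have "bidem ?e" by (simp add: xor2_def)
    then show ?thesis using unit_group_bidem[OF \<open>zorn_swap \<in> unit_group\<close>] by blast
  qed
  then have "bidem (bswap ?e)" unfolding zo_swap image_iff Bex_def zo_inject mem_Collect_eq by blast
  then show False by (simp add: bswap_def)
qed

lemma zorn_swap_inv: "inv\<^bsub>G2_F2\<^esub> zorn_swap = zorn_swap"
  using zorn_swap_aut zorn_swap_swap by (intro F2.inv_equality) auto

text \<open>Membership behaves like a sign. For two factors outside, \<open>zorn_swap\<close> is
  inserted twice between them, and normality turns the second factor into an element of the
  group.\<close>

lemma comp_unit_group_iff:
  assumes "f \<in> carrier G2_F2" "g \<in> carrier G2_F2"
  shows "f \<circ> g \<in> unit_group \<longleftrightarrow> (f \<in> unit_group \<longleftrightarrow> g \<in> unit_group)"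
proof -
  have l: "g \<in> unit_group" if "f \<in> unit_group" "f \<circ> g \<in> unit_group"
    using unit_group_comp[OF unit_group_inv[OF that(1)] that(2)] zorn_inv_comp(1)[OF assms(1)] by (simp add: o_assoc)
  have r: "f \<in> unit_group" if "g \<in> unit_group" "f \<circ> g \<in> unit_group"
    using unit_group_comp[OF that(2) unit_group_inv[OF that(1)]] zorn_inv_comp(2)[OF assms(2)] by (simp flip: o_assoc)
  have "f \<circ> g \<in> unit_group" if "f \<notin> unit_group" "g \<notin> unit_group"
  proof -
    have fg: "f \<circ> zorn_swap \<in> unit_group" "g \<circ> zorn_swap \<in> unit_group"
      using zorn_aut_cosets assms that by blast+
    have "zorn_swap \<circ> (g \<circ> zorn_swap) \<circ> zorn_swap \<in> unit_group"
      using normal.inv_op_closed2[OF normal_unit_group zorn_swap_aut fg(2)] by (simp add: zorn_swap_inv)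
    then have "zorn_swap \<circ> g \<in> unit_group" using zorn_swap_swap by (simp flip: o_assoc)
    from unit_group_comp[OF fg(1) this] show ?thesis
      using zorn_swap_swap by (metis (no_types, lifting) comp_assoc comp_id fun.map_id)
  qed
  then show ?thesis using l r unit_group_comp by blast
qed

text \<open>Each factor occurs twice in a commutator, so its sign is trivial. Conversely some
  \<open>l\<close> in the group maps a unit \<open>w\<close> to its complement; the commutator of
  \<open>l\<close> with the conjugation by \<open>w\<close> is the square of the inverse
  conjugation, which is that conjugation again.\<close>

lemma derived_G2_F2: "derived G2_F2 (carrier G2_F2) = unit_group"
proof
  show "derived G2_F2 (carrier G2_F2) \<subseteq> unit_group"
    unfolding derived_def
  proof (intro F2.generate_subgroup_incl subgroup_unit_group UN_least singletonI subsetI; clarsimp)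
    fix f g assume fg: "f \<in> carrier G2_F2" "g \<in> carrier G2_F2"
    have inv: "inv\<^bsub>G2_F2\<^esub> h \<in> unit_group \<longleftrightarrow> h \<in> unit_group" if "h \<in> carrier G2_F2" for h
      using comp_unit_group_iff[OF that F2.inv_closed[OF that]] zorn_inv_comp(2)[OF that] unit_group_id by simp
    have c: "f \<circ> g \<in> carrier G2_F2" "f \<circ> g \<circ> inv\<^bsub>G2_F2\<^esub> f \<in> carrier G2_F2"
      using fg F2.m_closed F2.inv_closed by (metis mult_algebra_aut)+
    show "f \<circ> g \<circ> inv\<^bsub>G2_F2\<^esub> f \<circ> inv\<^bsub>G2_F2\<^esub> g \<in> unit_group"
      unfolding comp_unit_group_iff[OF c(2) F2.inv_closed[OF fg(2)]] comp_unit_group_iff[OF c(1) F2.inv_closed[OF fg(1)]]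
        comp_unit_group_iff[OF fg] inv[OF fg(1)] inv[OF fg(2)] by blast
  qed
  show "unit_group \<subseteq> derived G2_F2 (carrier G2_F2)"
    unfolding unit_group_def
  proof (intro F2.generate_subgroup_incl F2.derived_is_subgroup subsetI order.refl)
    fix f assume "f \<in> {zorn.conjugation (zo gen1), zorn.conjugation (zo gen2), zorn.conjugation (zo gen3)}"
    then obtain w where w: "w \<in> zorn_units" "f = zorn.conjugation w" using zo_g_units by blast
    obtain h k where h: "h \<in> unit_group" "h (zo gen1) = w" and k: "k \<in> unit_group" "k (zo gen1) = zorn_one - w"
      using unit_orbit[OF w(1)] unit_orbit[OF zorn_unit_comp[OF w(1)]] by blast
    define l where "l = k \<circ> inv\<^bsub>G2_F2\<^esub> h"
    have l: "l \<in> unit_group" "l w = zorn_one - w"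
      using unit_group_comp[OF k(1) unit_group_inv[OF h(1)]] zorn_inv_comp(3)[OF unit_group_aut[OF h(1)], of "zo gen1"]
      by (simp_all add: l_def h(2) k(2))
    have "l \<circ> zorn.conjugation w \<circ> inv\<^bsub>G2_F2\<^esub> l \<circ> inv\<^bsub>G2_F2\<^esub> (zorn.conjugation w)
        = zorn.conjugation (zorn_one - w) \<circ> zorn.conjugation (zorn_one - w)"
      by (simp only: zorn_conj_conj[OF unit_group_aut[OF l(1)]] zorn_conj_inv[OF w(1)] l(2))
    also have "\<dots> = f" using zorn_conj_twice[OF zorn_unit_comp[OF w(1)]] w(2) by simp
    finally have "f \<in> derived_set G2_F2 (carrier G2_F2)"
      using unit_group_aut[OF l(1)] zorn_conj_aut[OF w(1)] unfolding mult_algebra_aut by blast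
    then show "f \<in> derived G2_F2 (carrier G2_F2)" unfolding derived_def by (rule generate.incl)
  qed
qed

section \<open>Orders of the two groups\<close>

lemma card_orbit_stabilizer:
  assumes fin: "finite G" and comp: "\<And>f g. f \<in> G \<Longrightarrow> g \<in> G \<Longrightarrow> f \<circ> g \<in> G"
    and inv: "\<And>f. f \<in> G \<Longrightarrow> \<exists>g\<in>G. g \<circ> f = id \<and> f \<circ> g = id"
  shows "card G = card ((\<lambda>f. f x) ` G) * card {f \<in> G. f x = x}"
proof -
  have "card {f \<in> G. f x = y} = card {f \<in> G. f x = x}" if y: "y \<in> (\<lambda>f. f x) ` G" for y
  proof -
    obtain h k where h: "h \<in> G" "h x = y" "k \<in> G" "k \<circ> h = id" "h \<circ> k = id"
      using y inv by blast
    have "k y = x" using h(2,4) by (metis comp_apply id_apply)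
    then have "bij_betw (\<lambda>f. h \<circ> f) {f \<in> G. f x = x} {f \<in> G. f x = y}"
      using h by (intro bij_betwI[of _ _ _ "\<lambda>f. k \<circ> f"]) (auto simp: o_assoc comp)
    then show ?thesis by (simp add: bij_betw_same_card)
  qed
  then have "(\<Sum>y\<in>(\<lambda>f. f x) ` G. card {f \<in> G. f x = y}) = card ((\<lambda>f. f x) ` G) * card {f \<in> G. f x = x}"
    by simp
  moreover have "card G = (\<Sum>y\<in>(\<lambda>f. f x) ` G. card {f \<in> G. f x = y})"
    using sum.image_gen[OF fin, of "\<lambda>_. 1::nat" "\<lambda>f. f x"] by simp
  ultimately show ?thesis by simp
qed

lemma card_zo: "distinct xs \<Longrightarrow> card (zo ` set xs) = length xs"
  by (subst card_image) (auto simp: inj_on_def distinct_card)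

lemma finite_G2_F2: "finite (carrier G2_F2)"
proof (rule finite_imageD)
  let ?p = "\<lambda>f. (f (zo gen1), f (zo gen2), f (zo gen3))"
  have "?p ` carrier G2_F2 \<subseteq> UNIV \<times> UNIV \<times> UNIV" by blast
  then show "finite (?p ` carrier G2_F2)"
    by (rule finite_subset) (intro finite_cartesian_product finite_zorn)
  show "inj_on ?p (carrier G2_F2)" using zorn_aut_eqI by (intro inj_onI) blast
qed

lemma card_G2_F2: "card (carrier G2_F2) = 12096"
proof -
  let ?A = "carrier G2_F2"
  let ?B = "{f \<in> ?A. f (zo gen1) = zo gen1}"
  let ?C = "{f \<in> ?B. f (zo gen2) = zo gen2}"
  have A: "f \<circ> g \<in> ?A" "\<exists>g\<in>?A. g \<circ> f = id \<and> f \<circ> g = id" if "f \<in> ?A" "g \<in> ?A" for f g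
    using F2.m_closed[OF that] F2.inv_closed[OF that(1)] zorn_inv_comp[OF that(1)] by auto
  have B: "f \<circ> g \<in> ?B" "\<exists>g\<in>?B. g \<circ> f = id \<and> f \<circ> g = id" if fg: "f \<in> ?B" "g \<in> ?B" for f g
  proof -
    show "f \<circ> g \<in> ?B" using fg A(1)[of f g] by simp
    obtain h where h: "h \<in> ?A" "h \<circ> f = id" "f \<circ> h = id" using fg A(2)[of f f] by blast
    then have "h (zo gen1) = zo gen1" using fg by (metis (mono_tags) comp_apply id_apply mem_Collect_eq)
    then show "\<exists>g\<in>?B. g \<circ> f = id \<and> f \<circ> g = id" using h by blast
  qed
  have C: "f \<circ> g \<in> ?C" "\<exists>g\<in>?C. g \<circ> f = id \<and> f \<circ> g = id" if fg: "f \<in> ?C" "g \<in> ?C" for f g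
  proof -
    show "f \<circ> g \<in> ?C" using fg B(1)[of f g] by simp
    obtain h where h: "h \<in> ?B" "h \<circ> f = id" "f \<circ> h = id" using fg B(2)[of f f] by blast
    then have "h (zo gen2) = zo gen2" using fg by (metis (mono_tags) comp_apply id_apply mem_Collect_eq)
    then show "\<exists>g\<in>?C. g \<circ> f = id \<and> f \<circ> g = id" using h by blast
  qed
  have dist: "distinct bunits" "distinct bnbrs" "distinct bthirds"
    by (simp_all add: bunits_def bnbrs_def bthirds_def distinct_bits8)
  have units: "zorn_units = zo ` set bunits"
  proof (intro equalityI subsetI)
    fix x assume "x \<in> zorn_units"
    then show "x \<in> zo ` set bunits" by (cases x rule: zorn_cases) (use bunits_iff zo_unit in blast)
  next
    fix x assume "x \<in> zo ` set bunits"
    then show "x \<in> zorn_units" using bunits_iff zo_unit by blast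
  qed
  have nbrs: "{x \<in> zorn_units. zorn_adj (zo gen1) x} = zo ` set bnbrs"
  proof (intro equalityI subsetI)
    fix x assume "x \<in> {x \<in> zorn_units. zorn_adj (zo gen1) x}"
    then have "x \<in> zorn_units" "zorn_adj (zo gen1) x" by blast+
    then show "x \<in> zo ` set bnbrs" by (cases x rule: zorn_cases) (use bnbrs_iff zo_unit zo_adj in blast)
  next
    fix x assume "x \<in> zo ` set bnbrs"
    then show "x \<in> {x \<in> zorn_units. zorn_adj (zo gen1) x}" using bnbrs_iff zo_unit zo_adj by blast
  qed
  have thirds: "{x \<in> zorn_units. zorn_adj (zo gen1) x \<and> zorn_adj (zo gen2) x \<and> zorn_third (zo gen1) (zo gen2) x}
      = zo ` set bthirds" (is "?T = _")
  proof (intro equalityI subsetI)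
    fix x assume "x \<in> ?T"
    then have "x \<in> zorn_units" "zorn_adj (zo gen1) x" "zorn_adj (zo gen2) x" "zorn_third (zo gen1) (zo gen2) x" by blast+
    then show "x \<in> zo ` set bthirds" by (cases x rule: zorn_cases) (use bthirds_iff zo_unit zo_adj zo_third in blast)
  next
    fix x assume "x \<in> zo ` set bthirds"
    then show "x \<in> ?T" using bthirds_iff zo_unit zo_adj zo_third by blast
  qed
  have oA: "(\<lambda>f. f (zo gen1)) ` ?A = zorn_units"
  proof
    show "(\<lambda>f. f (zo gen1)) ` ?A \<subseteq> zorn_units" using zorn_aut_rel(1) zo_g_units by blast
    show "zorn_units \<subseteq> (\<lambda>f. f (zo gen1)) ` ?A" using unit_orbit unit_group_aut by blast
  qed
  have oB: "(\<lambda>f. f (zo gen2)) ` ?B = {x \<in> zorn_units. zorn_adj (zo gen1) x}"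
  proof (intro equalityI subsetI)
    fix x assume "x \<in> (\<lambda>f. f (zo gen2)) ` ?B"
    then obtain f where f: "f \<in> ?A" "f (zo gen1) = zo gen1" "x = f (zo gen2)" by blast
    then show "x \<in> {x \<in> zorn_units. zorn_adj (zo gen1) x}"
      using zorn_aut_rel(1)[OF f(1), of "zo gen2"] zorn_aut_rel(2)[OF f(1), of "zo gen1" "zo gen2"] zo_g_units zo_g_rel
      unfolding f(2,3) by blast
  next
    fix x assume "x \<in> {x \<in> zorn_units. zorn_adj (zo gen1) x}"
    then have "x \<in> zorn_units" "zorn_adj (zo gen1) x" by blast+
    from adj_orbit_fixed[OF this] show "x \<in> (\<lambda>f. f (zo gen2)) ` ?B" using unit_group_aut by blast
  qed
  have oC: "(\<lambda>f. f (zo gen3)) ` ?C = ?T"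
  proof (intro equalityI subsetI)
    fix x assume "x \<in> (\<lambda>f. f (zo gen3)) ` ?C"
    then obtain f where f: "f \<in> ?A" "f (zo gen1) = zo gen1" "f (zo gen2) = zo gen2" "x = f (zo gen3)" by blast
    then show "x \<in> ?T"
      using zorn_aut_rel(1)[OF f(1), of "zo gen3"] zorn_aut_rel(2)[OF f(1), of "zo gen1" "zo gen3"]
        zorn_aut_rel(2)[OF f(1), of "zo gen2" "zo gen3"] zorn_aut_rel(3)[OF f(1), of "zo gen1" "zo gen2" "zo gen3"]
        zo_g_units zo_g_rel unfolding f(2,3,4) by blast
  next
    fix x assume "x \<in> ?T"
    then have "x \<in> zorn_units" "zorn_adj (zo gen1) x" "zorn_adj (zo gen2) x" "zorn_third (zo gen1) (zo gen2) x" by blast+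
    from third_orbit[OF this] obtain f where f: "f \<in> unit_group \<union> (\<lambda>f. f \<circ> zorn_swap) ` unit_group"
      "f (zo gen1) = zo gen1" "f (zo gen2) = zo gen2" "f (zo gen3) = x" by blast
    have "f \<in> ?A" using f(1) unit_group_aut A(1)[OF _ zorn_swap_aut] by blast
    then show "x \<in> (\<lambda>f. f (zo gen3)) ` ?C" using f by blast
  qed
  have id: "{f \<in> ?C. f (zo gen3) = zo gen3} = {id}"
  proof (intro equalityI subsetI)
    fix f assume "f \<in> {f \<in> ?C. f (zo gen3) = zo gen3}"
    then have "f = id" by (intro zorn_aut_eqI) (auto simp: unit_group_aut unit_group_id)
    then show "f \<in> {id}" by simp
  qed (simp add: unit_group_aut unit_group_id)
  have "card ?A = card zorn_units * card ?B"
    using card_orbit_stabilizer[of ?A "zo gen1"] finite_G2_F2 A oA by simp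
  moreover have "card ?B = card (zo ` set bnbrs) * card ?C"
    using card_orbit_stabilizer[of ?B "zo gen2", unfolded oB nbrs] finite_G2_F2 B by simp
  moreover have "card ?C = card (zo ` set bthirds) * 1"
    using card_orbit_stabilizer[of ?C "zo gen3", unfolded oC thirds id] finite_G2_F2 C by simp
  ultimately show ?thesis
    using dist by (simp add: units card_zo length_bunits length_bnbrs length_bthirds)
qed

lemma card_unit_group: "card unit_group = 6048"
proof -
  let ?s = "(\<lambda>f. f \<circ> zorn_swap) ` unit_group"
  have ss: "f \<circ> zorn_swap \<circ> zorn_swap = f" for f :: "_ \<Rightarrow> bit zorn"
    using zorn_swap_swap by (simp flip: o_assoc)
  have fin: "finite unit_group" using finite_G2_F2 unit_group_aut by (meson finite_subset subsetI)
  have "carrier G2_F2 = unit_group \<union> ?s"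
  proof (intro equalityI subsetI)
    fix f assume "f \<in> carrier G2_F2"
    then show "f \<in> unit_group \<union> ?s" using zorn_aut_cosets[of f] ss[of f] by (metis UnCI image_eqI)
  next
    fix f assume "f \<in> unit_group \<union> ?s"
    then show "f \<in> carrier G2_F2" using unit_group_aut F2.m_closed[OF _ zorn_swap_aut] by auto
  qed
  moreover have "unit_group \<inter> ?s = {}"
    using comp_unit_group_iff[OF unit_group_aut zorn_swap_aut] zorn_swap_not_unit by blast
  moreover have "card ?s = card unit_group"
    using ss by (intro card_image inj_onI) metis
  ultimately have "card (carrier G2_F2) = 2 * card unit_group"
    using fin by (simp add: card_Un_disjoint)
  then show ?thesis by (simp add: card_G2_F2)
qed

section \<open>Simplicity\<close>

lemma adj_or_comp:
  assumes "x \<in> zorn_units" "y \<in> zorn_units" "y \<noteq> x" "y \<noteq> zorn_one - x"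
  shows "zorn_adj x y \<or> zorn_adj x (zorn_one - y)"
proof -
  obtain f where f: "f \<in> unit_group" "f (zo gen1) = x" using unit_orbit[OF assms(1)] by blast
  note f' = unit_group_aut[OF f(1)]
  define z where "z = (inv\<^bsub>G2_F2\<^esub> f) y"
  have z: "f z = y" unfolding z_def by (rule zorn_inv_comp(4)[OF f'])
  have fc: "f (zorn_one - z) = zorn_one - y" "f (zorn_one - zo gen1) = zorn_one - x"
    by (simp_all only: zorn_aut(2,4)[OF f'] z f(2))
  obtain w where w: "z = zo w" by (rule zorn_cases)
  have "z \<in> zorn_units" using zorn_aut_rel(1)[OF f', of z] assms(2) z by simp
  then have "w \<in> set bunits" unfolding w zo_unit bunits_iff .
  moreover have "z \<noteq> zo gen1" "z \<noteq> zorn_one - zo gen1" using assms(3,4) f(2) z fc by metis+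
  then have "w \<noteq> gen1" "w \<noteq> bcomp gen1" unfolding w zo_comp zo_inject by blast+
  ultimately have "badj gen1 w \<or> badj gen1 (bcomp w)" using badj_or_comp unfolding list_all_iff by blast
  then have "zorn_adj (zo gen1) z \<or> zorn_adj (zo gen1) (zorn_one - z)" unfolding w zo_comp zo_adj .
  then show ?thesis
    using zorn_aut_rel(2)[OF f', of "zo gen1" z] zorn_aut_rel(2)[OF f', of "zo gen1" "zorn_one - z"]
    unfolding f(2) z fc by blast
qed

lemma not_badj_comp: "\<not> badj gen1 (bcomp gen2)" "\<not> badj gen1 (bcomp gen3)" "\<not> badj (bcomp gen1) gen2"
  by code_simp+

lemma bconj_comp: "bconj (bcomp gen1) (bcomp gen2) \<noteq> bconj gen1 gen2"
  "bconj (bcomp gen1) (bcomp gen2) \<noteq> bcomp (bconj gen1 gen2)"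
  by code_simp+

text \<open>An automorphism mapping every unit \<open>w\<close> to \<open>w\<close> or \<open>1 - w\<close> fixes or complements the
  pairwise adjacent generators simultaneously; the latter is incompatible with its value on a conjugate.\<close>

lemma moved_unit:
  assumes f: "f \<in> carrier G2_F2" and "f \<noteq> id"
  shows "\<exists>w\<in>zorn_units. f w \<noteq> w \<and> f w \<noteq> zorn_one - w"
proof (rule ccontr)
  assume "\<not> ?thesis"
  then have *: "f w = w \<or> f w = zorn_one - w" if "w \<in> zorn_units" for w using that by blast
  have adj: "zorn_adj (f (zo gen1)) (f (zo gen2))" "zorn_adj (f (zo gen1)) (f (zo gen3))"
    using zorn_aut_rel(2)[OF f] zo_g_rel by blast+
  have cases: "f (zo gen1) = zo gen1 \<or> f (zo gen1) = zo (bcomp gen1)" "f (zo gen2) = zo gen2 \<or> f (zo gen2) = zo (bcomp gen2)"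
    "f (zo gen3) = zo gen3 \<or> f (zo gen3) = zo (bcomp gen3)"
    using *[OF zo_g_units(1)] *[OF zo_g_units(2)] *[OF zo_g_units(3)] unfolding zo_comp by blast+
  show False
  proof (cases "f (zo gen1) = zo gen1")
    case True
    then have "f (zo gen2) = zo gen2" "f (zo gen3) = zo gen3"
      using cases adj not_badj_comp by (metis zo_adj)+
    then have "f = id" using True by (intro zorn_aut_eqI f) (simp_all add: unit_group_aut unit_group_id)
    then show False using \<open>f \<noteq> id\<close> by simp
  next
    case False
    then have 1: "f (zo gen1) = zo (bcomp gen1)" using cases by blast
    then have 2: "f (zo gen2) = zo (bcomp gen2)" using cases adj not_badj_comp by (metis zo_adj)
    have c: "f (zo (bconj gen1 gen2)) = zo (bconj (bcomp gen1) (bcomp gen2))"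
      using zorn_aut_conj[OF f, of "zo gen1" "zo gen2"] by (simp only: zo_conj 1 2)
    have u: "zo (bconj gen1 gen2) \<in> zorn_units"
      using zorn_aut_rel(1)[OF zorn_conj_aut[OF zo_g_units(1)], of "zo gen2"] zo_g_units(2) by (simp only: zo_conj)
    show False using *[OF u, unfolded c zo_comp zo_inject] bconj_comp by blast
  qed
qed

lemma zo_path: "\<exists>z\<in>zorn_units. zorn_adj (zo gen2) z \<and> zorn_adj z (zorn_one - zo gen1)"
  using adj_path unfolding Let_def zo_comp by (metis zo_unit zo_adj)

text \<open>The relation that two units have conjugations agreeing modulo \<open>N\<close> is
  transitive and stable under the whole group. Adjacent pairs form a single orbit, so one moved unit
  decides all of them. A chain from a unit to its complement makes a conjugation agree with its
  inverse modulo \<open>N\<close>; as its cube is trivial, it lies in \<open>N\<close>.\<close>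

lemma normal_unit_group_trivial:
  assumes N: "N \<lhd> G2_F2\<lparr>carrier := unit_group\<rparr>" and "N \<noteq> {id}"
  shows "N = unit_group"
proof -
  have sub: "N \<subseteq> unit_group" and Ncomp: "\<And>f g. f \<in> N \<Longrightarrow> g \<in> N \<Longrightarrow> f \<circ> g \<in> N" and Nid: "id \<in> N"
    using normal_imp_subgroup[OF N] by (auto simp: subgroup_def)
  have inv: "inv\<^bsub>G2_F2\<lparr>carrier := unit_group\<rparr>\<^esub> f = inv\<^bsub>G2_F2\<^esub> f" if "f \<in> unit_group" for f
    using F2.m_inv_consistent[OF subgroup_unit_group that] .
  have Ninv: "inv\<^bsub>G2_F2\<^esub> f \<in> N" if "f \<in> N" for f
    using subgroup.m_inv_closed[OF normal_imp_subgroup[OF N] that] inv sub that by auto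
  have Nconj: "f \<circ> n \<circ> inv\<^bsub>G2_F2\<^esub> f \<in> N" if "f \<in> unit_group" "n \<in> N" for f n
    using normal.inv_op_closed2[OF N, of f n] inv that by simp
  \<comment> \<open>The conjugation with \<open>zorn_one - x\<close> is the inverse of the one with
    \<open>x\<close>, so the product is the quotient of the conjugations with \<open>y\<close> and
    \<open>x\<close>.\<close>
  define E where "E x y \<longleftrightarrow> x \<in> zorn_units \<and> y \<in> zorn_units \<and>
    zorn.conjugation y \<circ> zorn.conjugation (zorn_one - x) \<in> N" for x y
  have E_map: "E (f x) (f y)" if f: "f \<in> unit_group" and E: "E x y" for f x y
  proof -
    note f' = unit_group_aut[OF f]
    have "f \<circ> (zorn.conjugation y \<circ> zorn.conjugation (zorn_one - x)) \<circ> inv\<^bsub>G2_F2\<^esub> f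
        = (f \<circ> zorn.conjugation y \<circ> inv\<^bsub>G2_F2\<^esub> f) \<circ> (f \<circ> zorn.conjugation (zorn_one - x) \<circ> inv\<^bsub>G2_F2\<^esub> f)"
      using zorn_inv_comp(1)[OF f'] by (metis (no_types, lifting) comp_assoc comp_id id_comp)
    also have "\<dots> = zorn.conjugation (f y) \<circ> zorn.conjugation (zorn_one - f x)"
      by (simp only: zorn_conj_conj[OF f'] zorn_aut(2,4)[OF f'])
    finally have "zorn.conjugation (f y) \<circ> zorn.conjugation (zorn_one - f x) \<in> N"
      using Nconj[OF f] E unfolding E_def by metis
    then show ?thesis using E zorn_aut_rel(1)[OF f'] unfolding E_def by blast
  qed
  have E_trans: "E x z" if "E x y" "E y z" for x y z
  proof -
    have "(zorn.conjugation z \<circ> zorn.conjugation (zorn_one - y)) \<circ> (zorn.conjugation y \<circ> zorn.conjugation (zorn_one - x)) \<in> N"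
      using that Ncomp unfolding E_def by blast
    moreover have "zorn.conjugation (zorn_one - y) \<circ> zorn.conjugation y = id"
      using zorn_conj_inverse(2)[of y] that unfolding E_def by blast
    ultimately have "zorn.conjugation z \<circ> zorn.conjugation (zorn_one - x) \<in> N"
      by (metis (no_types, lifting) comp_assoc id_comp)
    then show ?thesis using that unfolding E_def by blast
  qed
  \<comment> \<open>The quotient of the two conjugations is a commutator with \<open>f\<close>,
    hence an element of the normal subgroup.\<close>
  have E_moved: "E w (f w)" if f: "f \<in> N" and w: "w \<in> zorn_units" for f w
  proof -
    note f' = unit_group_aut[OF subsetD[OF sub f]]
    have "f \<circ> (zorn.conjugation w \<circ> inv\<^bsub>G2_F2\<^esub> f \<circ> inv\<^bsub>G2_F2\<^esub> (zorn.conjugation w)) \<in> N"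
      by (intro Ncomp f Nconj conj_in_unit_group w Ninv)
    also have "f \<circ> (zorn.conjugation w \<circ> inv\<^bsub>G2_F2\<^esub> f \<circ> inv\<^bsub>G2_F2\<^esub> (zorn.conjugation w))
        = zorn.conjugation (f w) \<circ> zorn.conjugation (zorn_one - w)"
      unfolding zorn_conj_conj[OF f', symmetric] zorn_conj_inv[OF w] by (simp only: o_assoc)
    finally show ?thesis using w zorn_aut_rel(1)[OF f'] unfolding E_def by blast
  qed
  have E_comp: "N = unit_group" if E: "E w (zorn_one - w)" for w
  proof
    have w: "w \<in> zorn_units" using E unfolding E_def by blast
    have Nw: "zorn.conjugation w \<in> N"
      using E zorn_conj_twice[OF zorn_unit_comp[OF w]] unfolding E_def by simp
    have "zorn.conjugation v \<in> N" if v: "v \<in> zorn_units" for v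
    proof -
      obtain h k where h: "h \<in> unit_group" "h (zo gen1) = w" and k: "k \<in> unit_group" "k (zo gen1) = v"
        using unit_orbit[OF w] unit_orbit[OF v] by blast
      define l where "l = k \<circ> inv\<^bsub>G2_F2\<^esub> h"
      have l: "l \<in> unit_group" "l w = v"
        using unit_group_comp[OF k(1) unit_group_inv[OF h(1)]] zorn_inv_comp(3)[OF unit_group_aut[OF h(1)], of "zo gen1"]
        by (simp_all add: l_def h(2) k(2))
      show ?thesis using Nconj[OF l(1) Nw] unfolding zorn_conj_conj[OF unit_group_aut[OF l(1)]] l(2) .
    qed
    then have gens: "{zorn.conjugation (zo gen1), zorn.conjugation (zo gen2), zorn.conjugation (zo gen3)} \<subseteq> N"
      using zo_g_units by blast
    have "subgroup N G2_F2" using F2.incl_subgroup[OF subgroup_unit_group normal_imp_subgroup[OF N]] .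
    then show "unit_group \<subseteq> N" unfolding unit_group_def using gens by (rule F2.generate_subgroup_incl[rotated])
    show "N \<subseteq> unit_group" by (rule sub)
  qed
  obtain f where f: "f \<in> N" "f \<noteq> id" using \<open>N \<noteq> {id}\<close> Nid by blast
  note f' = unit_group_aut[OF subsetD[OF sub f(1)]]
  obtain w where w: "w \<in> zorn_units" "f w \<noteq> w" "f w \<noteq> zorn_one - w" using moved_unit[OF f' f(2)] by blast
  have fw: "f w \<in> zorn_units" using zorn_aut_rel(1)[OF f'] w(1) by blast
  from adj_or_comp[OF w(1) fw w(2,3)] show ?thesis
  proof
    assume "zorn_adj w (f w)"
    have E: "E x y" if xy: "x \<in> zorn_units" "y \<in> zorn_units" "zorn_adj x y" for x y
    proof -
      obtain h k where h: "h \<in> unit_group" "h (zo gen1) = w" "h (zo gen2) = f w"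
        and k: "k \<in> unit_group" "k (zo gen1) = x" "k (zo gen2) = y"
        using adj_orbit[OF w(1) fw \<open>zorn_adj w (f w)\<close>] adj_orbit[OF xy] by blast
      have "E (h (zo gen1)) (h (zo gen2))" using E_moved[OF f(1) w(1)] h by simp
      from E_map[OF k(1) E_map[OF unit_group_inv[OF h(1)] this]] show ?thesis
        by (simp only: zorn_inv_comp(3)[OF unit_group_aut[OF h(1)]] k)
    qed
    \<comment> \<open>The path \<open>gen1\<close>, \<open>gen2\<close>, z, complement of
      \<open>gen1\<close>: along it all conjugations agree modulo \<open>N\<close>.\<close>
    obtain z where z: "z \<in> zorn_units" "zorn_adj (zo gen2) z" "zorn_adj z (zorn_one - zo gen1)"
      using zo_path by blast
    have "E (zo gen1) (zorn_one - zo gen1)"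
      using E_trans[OF E_trans[OF E[OF zo_g_units(1,2) zo_g_rel(1)] E[OF zo_g_units(2) z(1,2)]]
          E[OF z(1) zorn_unit_comp[OF zo_g_units(1)] z(3)]] .
    then show ?thesis by (rule E_comp)
  next
    assume adj: "zorn_adj w (zorn_one - f w)"
    have E: "E x (zorn_one - y)" if xy: "x \<in> zorn_units" "y \<in> zorn_units" "zorn_adj x y" for x y
    proof -
      obtain h k where h: "h \<in> unit_group" "h (zo gen1) = w" "h (zo gen2) = zorn_one - f w"
        and k: "k \<in> unit_group" "k (zo gen1) = x" "k (zo gen2) = y"
        using adj_orbit[OF w(1) zorn_unit_comp[OF fw] adj] adj_orbit[OF xy] by blast
      have "h (zorn_one - zo gen2) = f w"
        by (simp only: zorn_aut(2,4)[OF unit_group_aut[OF h(1)]] h diff_diff_eq2 add_diff_cancel_left')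
      then have "E (h (zo gen1)) (h (zorn_one - zo gen2))" using E_moved[OF f(1) w(1)] h by simp
      from E_map[OF k(1) E_map[OF unit_group_inv[OF h(1)] this]] show ?thesis
        by (simp only: zorn_inv_comp(3)[OF unit_group_aut[OF h(1)]] zorn_aut(2,4)[OF unit_group_aut[OF k(1)]] k)
    qed
    \<comment> \<open>Complementing both entries inverts both conjugations. The inverse of the given
      element of \<open>N\<close> has its factors in the wrong order, and a conjugation by
      \<open>zorn_one - x\<close> exchanges them.\<close>
    have E': "E (zorn_one - x) y" if "E x (zorn_one - y)" for x y
    proof -
      have xy: "x \<in> zorn_units" "y \<in> zorn_units" "zorn.conjugation (zorn_one - y) \<circ> zorn.conjugation (zorn_one - x) \<in> N"
        using that zorn_unit_comp[of "zorn_one - y"] unfolding E_def by auto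
      have i: "inv\<^bsub>G2_F2\<^esub> (zorn.conjugation (zorn_one - y) \<circ> zorn.conjugation (zorn_one - x))
          = zorn.conjugation x \<circ> zorn.conjugation y"
        using F2.inv_mult_group[OF zorn_conj_aut[OF zorn_unit_comp[OF xy(2)]] zorn_conj_aut[OF zorn_unit_comp[OF xy(1)]]]
        unfolding mult_algebra_aut zorn_conj_inv[OF zorn_unit_comp[OF xy(2)]] zorn_conj_inv[OF zorn_unit_comp[OF xy(1)]]
        by simp
      have "zorn.conjugation (zorn_one - x) \<circ> (zorn.conjugation x \<circ> zorn.conjugation y)
          \<circ> inv\<^bsub>G2_F2\<^esub> (zorn.conjugation (zorn_one - x)) \<in> N"
        using Nconj[OF conj_in_unit_group[OF zorn_unit_comp[OF xy(1)]] Ninv[OF xy(3)]] unfolding i .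
      then have "zorn.conjugation y \<circ> zorn.conjugation x \<in> N"
        unfolding zorn_conj_inv[OF zorn_unit_comp[OF xy(1)]] o_assoc zorn_conj_inverse(2)[OF xy(1)] by simp
      then show ?thesis using xy zorn_unit_comp[OF xy(1)] unfolding E_def by simp
    qed
    \<comment> \<open>In this case every adjacent step also inverts. The triangle of the three
      generators has odd length, so going around it leads from \<open>gen1\<close> to its
      complement.\<close>
    have "zorn_adj (zo gen3) (zo gen1)" using g_adj by (simp only: zo_adj)
    then have "E (zo gen1) (zorn_one - zo gen2)" "E (zorn_one - zo gen2) (zo gen3)" "E (zo gen3) (zorn_one - zo gen1)"
      using E[OF zo_g_units(1,2) zo_g_rel(1)] E'[OF E[OF zo_g_units(2,3) zo_g_rel(3)]] E[OF zo_g_units(3,1)]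
      by blast+
    then have "E (zo gen1) (zorn_one - zo gen1)" using E_trans by blast
    then show ?thesis by (rule E_comp)
  qed
qed

lemma simple_group_G2_F2_derived: "simple_group G2_F2_derived"
  unfolding G2_F2_derived_def derived_G2_F2
proof (intro simple_group.intro simple_group_axioms.intro)
  show "group (G2_F2\<lparr>carrier := unit_group\<rparr>)" by (rule F2.subgroup_imp_group[OF subgroup_unit_group])
  show "1 < order (G2_F2\<lparr>carrier := unit_group\<rparr>)" by (simp add: order_def card_unit_group)
  fix H assume "H \<lhd> G2_F2\<lparr>carrier := unit_group\<rparr>"
  then show "H = carrier (G2_F2\<lparr>carrier := unit_group\<rparr>) \<or> H = {\<one>\<^bsub>G2_F2\<lparr>carrier := unit_group\<rparr>\<^esub>}"
    using normal_unit_group_trivial by auto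
qed

lemma order_G2_F2_derived: "order G2_F2_derived = 6048"
  by (simp add: G2_F2_derived_def derived_G2_F2 order_def card_unit_group)

section \<open>Complex octonions\<close>

lemma UNIV_8: "(UNIV :: 8 set) = {0, 1, 2, 3, 4, 5, 6, 7}"
  by (rule sym, rule card_seteq) simp_all

lemma forall_8: "(\<forall>i::8. P i) \<longleftrightarrow> P 0 \<and> P 1 \<and> P 2 \<and> P 3 \<and> P 4 \<and> P 5 \<and> P 6 \<and> P 7"
  using UNIV_8 by (metis (no_types, lifting) UNIV_I empty_iff insert_iff)

lemma sum_8: "sum f (UNIV :: 8 set) = f 0 + f 1 + f 2 + f 3 + f 4 + f 5 + f 6 + f 7"
  unfolding UNIV_8 by (simp add: add.assoc)

lemma sum_8_nonzero: "sum f (UNIV - {0 :: 8}) = (f 1 :: complex) + f 2 + f 3 + f 4 + f 5 + f 6 + f 7"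
  by (subst sum_diff1) (simp_all add: sum_8)

text \<open>A constructor with explicit coordinates, so that octonion identities become polynomial
  identities in scalars.\<close>

definition oct :: "complex \<Rightarrow> complex \<Rightarrow> complex \<Rightarrow> complex \<Rightarrow> complex \<Rightarrow> complex \<Rightarrow> complex \<Rightarrow> complex \<Rightarrow> octonion" where
  "oct a b c d e f g h = (\<chi> i. if i = 0 then a else if i = 1 then b else if i = 2 then c else if i = 3 then d
     else if i = 4 then e else if i = 5 then f else if i = 6 then g else h)"

lemma oct_nth [simp]:
  "oct a b c d e f g h $ 0 = a" "oct a b c d e f g h $ 1 = b" "oct a b c d e f g h $ 2 = c"
  "oct a b c d e f g h $ 3 = d" "oct a b c d e f g h $ 4 = e" "oct a b c d e f g h $ 5 = f"
  "oct a b c d e f g h $ 6 = g" "oct a b c d e f g h $ 7 = h"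
  by (simp_all add: oct_def)

lemma oct_eq_iff: "x = y \<longleftrightarrow> x $ 0 = y $ 0 \<and> x $ 1 = y $ 1 \<and> x $ 2 = y $ 2 \<and> x $ 3 = y $ 3
    \<and> x $ 4 = y $ 4 \<and> x $ 5 = y $ 5 \<and> x $ 6 = y $ 6 \<and> x $ 7 = y $ 7" for x y :: octonion
  by (simp add: vec_eq_iff forall_8)

lemma oct_cases: obtains a b c d e f g h where "x = oct a b c d e f g h"
proof
  show "x = oct (x $ 0) (x $ 1) (x $ 2) (x $ 3) (x $ 4) (x $ 5) (x $ 6) (x $ 7)"
    by (simp add: oct_eq_iff)
qed

lemma oct_inject [simp]: "oct a b c d e f g h = oct a' b' c' d' e' f' g' h' \<longleftrightarrow>
    a = a' \<and> b = b' \<and> c = c' \<and> d = d' \<and> e = e' \<and> f = f' \<and> g = g' \<and> h = h'"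
  by (simp add: oct_eq_iff)

lemma oct_add [simp]: "oct a b c d e f g h + oct a' b' c' d' e' f' g' h' =
    oct (a + a') (b + b') (c + c') (d + d') (e + e') (f + f') (g + g') (h + h')"
  and oct_diff [simp]: "oct a b c d e f g h - oct a' b' c' d' e' f' g' h' =
    oct (a - a') (b - b') (c - c') (d - d') (e - e') (f - f') (g - g') (h - h')"
  and oct_minus [simp]: "- oct a b c d e f g h = oct (- a) (- b) (- c) (- d) (- e) (- f) (- g) (- h)"
  and oct_scale [simp]: "r *s oct a b c d e f g h =
    oct (r * a) (r * b) (r * c) (r * d) (r * e) (r * f) (r * g) (r * h)"
  and oct_conj_oct [simp]: "oct_conj (oct a b c d e f g h) = oct a (- b) (- c) (- d) (- e) (- f) (- g) (- h)"
  and oct_zero: "0 = oct 0 0 0 0 0 0 0 0"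
  by (simp_all add: oct_eq_iff oct_conj_def)

lemma oct_tr_oct [simp]: "oct_tr (oct a b c d e f g h) = a"
  by (simp add: oct_tr_def)

lemma oct_e_oct: "oct_e 0 = oct 1 0 0 0 0 0 0 0" "oct_e 1 = oct 0 1 0 0 0 0 0 0"
  "oct_e 2 = oct 0 0 1 0 0 0 0 0" "oct_e 3 = oct 0 0 0 1 0 0 0 0" "oct_e 4 = oct 0 0 0 0 1 0 0 0"
  "oct_e 5 = oct 0 0 0 0 0 1 0 0" "oct_e 6 = oct 0 0 0 0 0 0 1 0" "oct_e 7 = oct 0 0 0 0 0 0 0 1"
  by (simp_all add: oct_eq_iff oct_e_def axis_def)

lemma oct_mult_oct [simp]: "oct a b c d e f g h \<odot> oct a' b' c' d' e' f' g' h' = oct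
    (a*a' - b*b' - c*c' - d*d' - e*e' - f*f' - g*g' - h*h')
    (a*b' + b*a' + c*e' - e*c' + f*g' - g*f' + d*h' - h*d')
    (a*c' + c*a' + d*f' - f*d' + g*h' - h*g' + e*b' - b*e')
    (a*d' + d*a' + e*g' - g*e' + h*b' - b*h' + f*c' - c*f')
    (a*e' + e*a' + f*h' - h*f' + b*c' - c*b' + g*d' - d*g')
    (a*f' + f*a' + g*b' - b*g' + c*d' - d*c' + h*e' - e*h')
    (a*g' + g*a' + h*c' - c*h' + d*e' - e*d' + b*f' - f*b')
    (a*h' + h*a' + b*d' - d*b' + e*f' - f*e' + c*g' - g*c')"
  by (simp add: oct_eq_iff oct_mult_def sum_8 sum_8_nonzero oct_sign_def oriented_fano_lines_def)

lemma alternative_algebra_octonion: "alternative_algebra (*s) (\<odot>) (oct_e 0) oct_conj"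
proof (intro alternative_algebra.intro alternative_algebra_axioms.intro)
  show "module ((*s) :: complex \<Rightarrow> octonion \<Rightarrow> octonion)"
    by unfold_locales (simp_all add: algebra_simps vec_eq_iff)
  fix c d :: complex and x y z :: octonion
  obtain x0 x1 x2 x3 x4 x5 x6 x7 where x: "x = oct x0 x1 x2 x3 x4 x5 x6 x7" by (rule oct_cases)
  obtain y0 y1 y2 y3 y4 y5 y6 y7 where y: "y = oct y0 y1 y2 y3 y4 y5 y6 y7" by (rule oct_cases)
  obtain z0 z1 z2 z3 z4 z5 z6 z7 where z: "z = oct z0 z1 z2 z3 z4 z5 z6 z7" by (rule oct_cases)
  note defs = x y z oct_e_oct
  show "x \<odot> (y + z) = x \<odot> y + x \<odot> z" "(x + y) \<odot> z = x \<odot> z + y \<odot> z"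
    "x \<odot> (c *s y) = c *s (x \<odot> y)" "(c *s x) \<odot> y = c *s (x \<odot> y)"
    "oct_e 0 \<odot> x = x" "x \<odot> oct_e 0 = x"
    "oct_conj (x + y) = oct_conj x + oct_conj y" "oct_conj (c *s x) = c *s oct_conj x"
    "oct_conj (x \<odot> y) = oct_conj y \<odot> oct_conj x" "oct_conj (oct_conj x) = x"
    by (simp_all add: defs algebra_simps)
  show "x \<odot> (x \<odot> y) = (x \<odot> x) \<odot> y"
    unfolding x y oct_mult_oct oct_inject by (intro conjI; simp add: algebra_simps)
qed

interpretation octonion: alternative_algebra "(*s)" "(\<odot>)" "oct_e 0" oct_conj
  by (rule alternative_algebra_octonion)

section \<open>The group \<open>G\<^sub>2\<close> over the complex numbers\<close>

lemma vector_space_octonion: "vector_space ((*s) :: complex \<Rightarrow> octonion \<Rightarrow> octonion)"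
  by (rule vec.vector_space_axioms)

interpretation G2C: group G2_C
  by (rule group_algebra_aut[OF vector_space_octonion])

lemma oct_form_oct [simp]: "oct_form (oct a b c d e f g h) (oct a' b' c' d' e' f' g' h') =
    a*a' + b*b' + c*c' + d*d' + e*e' + f*f' + g*g' + h*h'"
  by (simp add: oct_form_def)

lemma oct_form_alt: "oct_form x y = x $ 0 * y $ 0 + x $ 1 * y $ 1 + x $ 2 * y $ 2 + x $ 3 * y $ 3
    + x $ 4 * y $ 4 + x $ 5 * y $ 5 + x $ 6 * y $ 6 + x $ 7 * y $ 7"
  by (cases x rule: oct_cases; cases y rule: oct_cases) simp

lemma oct_conj_tr: "oct_conj x = (2 * oct_tr x) *s oct_e 0 - x"
  by (cases x rule: oct_cases) (simp add: oct_e_oct)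

lemma oct_V_conj: "v \<in> oct_V \<Longrightarrow> oct_conj v = - v"
  by (simp add: oct_V_def oct_conj_tr)

lemma oct_mul_conj: "x \<odot> oct_conj x = oct_n x *s oct_e 0"
  by (cases x rule: oct_cases) (simp add: oct_e_oct oct_n_def algebra_simps)

lemma oct_form_tr: "x \<odot> oct_conj y + y \<odot> oct_conj x = (2 * oct_form x y) *s oct_e 0"
  by (cases x rule: oct_cases; cases y rule: oct_cases) (simp add: oct_e_oct algebra_simps)

lemma oct_tr_linear [simp]: "oct_tr (x + y) = oct_tr x + oct_tr y" "oct_tr (x - y) = oct_tr x - oct_tr y"
  "oct_tr (- x) = - oct_tr x" "oct_tr (c *s x) = c * oct_tr x" "oct_tr (oct_e 0) = 1"
  by (simp_all add: oct_tr_def oct_e_def)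

lemma oct_tr_mul_V: "v \<in> oct_V \<Longrightarrow> w \<in> oct_V \<Longrightarrow> oct_tr (v \<odot> w) = - oct_form v w"
  by (simp add: oct_form_def oct_V_conj octonion.mul_minus)

lemma oct_tr_mul_mul_V:
  assumes "u \<in> oct_V" "v \<in> oct_V" "w \<in> oct_V"
  shows "oct_tr (u \<odot> (v \<odot> w)) = - oct_form u (v \<odot> w)"
  using assms unfolding oct_form_def oct_conj_tr[of "v \<odot> w"]
  by (simp add: octonion.mul_distribs oct_V_def)

lemma oct_V_anticomm:
  assumes "v \<in> oct_V" "w \<in> oct_V"
  shows "v \<odot> w + w \<odot> v = - (2 * oct_form v w) *s oct_e 0"
proof -
  have "- (v \<odot> w + w \<odot> v) = (2 * oct_form v w) *s oct_e 0"
    using oct_form_tr[of v w] assms by (simp add: oct_V_conj octonion.mul_minus)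
  then show ?thesis unfolding vec.scale_minus_left minus_equation_iff[of "v \<odot> w + w \<odot> v"] by simp
qed

lemma oct_V_sq:
  assumes "v \<in> oct_V" shows "v \<odot> v = (- oct_n v) *s oct_e 0"
proof -
  have "- (v \<odot> v) = oct_n v *s oct_e 0"
    using oct_mul_conj[of v] by (simp add: oct_V_conj[OF assms] octonion.mul_minus)
  then show ?thesis unfolding vec.scale_minus_left minus_equation_iff[of "v \<odot> v"] by simp
qed

lemma norm3D:
  assumes "v \<in> norm3_vectors"
  shows "v \<in> oct_V" "v \<odot> v = - 3 *s oct_e 0"
proof -
  show v: "v \<in> oct_V" using assms by (simp add: norm3_vectors_def)
  show "v \<odot> v = - 3 *s oct_e 0"
    using oct_V_sq[OF v] assms by (simp add: norm3_vectors_def)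
qed

lemma oct_a_eq: "v = 2 *s oct_a v - oct_e 0"
  by (simp add: oct_a_def)

lemma oct_a_sq:
  assumes "v \<in> norm3_vectors" shows "oct_a v \<odot> oct_a v = oct_a v - oct_e 0"
  by (simp add: oct_a_def octonion.mul_distribs norm3D(2)[OF assms] vec_eq_iff)

lemma oct_a_conj:
  assumes "v \<in> oct_V" shows "oct_conj (oct_a v) = oct_e 0 - oct_a v"
  by (simp add: oct_a_def octonion.cnj_scale octonion.cnj_add oct_V_conj[OF assms] vec_eq_iff)

lemma oct_a_anticomm:
  assumes "v \<in> oct_V" "w \<in> oct_V"
  shows "oct_a w \<odot> oct_a v = oct_a v + oct_a w - ((1 + oct_form v w) / 2) *s oct_e 0 - oct_a v \<odot> oct_a w"
proof -
  have "w \<odot> v = - (2 * oct_form v w) *s oct_e 0 - v \<odot> w"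
    using oct_V_anticomm[OF assms] by (simp add: algebra_simps)
  then show ?thesis
    by (simp add: oct_a_def octonion.mul_distribs vec_eq_iff) (simp add: field_simps)
qed

lemma oct_a_third:
  assumes V: "u \<in> oct_V" "v \<in> oct_V" "w \<in> oct_V"
  shows "oct_conj (oct_a u \<odot> (oct_a v \<odot> oct_a w))
    = ((1 - (oct_form v w + oct_form u w + oct_form u v + oct_form u (v \<odot> w))) / 4) *s oct_e 0
      - oct_a u \<odot> (oct_a v \<odot> oct_a w)"
proof -
  have tr: "oct_tr (oct_a u \<odot> (oct_a v \<odot> oct_a w))
      = (1 - (oct_form v w + oct_form u w + oct_form u v + oct_form u (v \<odot> w))) / 8"
    using V by (simp add: oct_a_def octonion.mul_distribs oct_tr_mul_V oct_tr_mul_mul_V oct_V_def field_simps)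
  have "2 * oct_tr (oct_a u \<odot> (oct_a v \<odot> oct_a w))
      = (1 - (oct_form v w + oct_form u w + oct_form u v + oct_form u (v \<odot> w))) / 4" unfolding tr by simp
  then show ?thesis by (simp only: oct_conj_tr)
qed

lemma oct_T_eq:
  assumes "v \<in> norm3_vectors" shows "oct_T (oct_a v) = octonion.conjugation (oct_a v)"
proof -
  have "oct_a v \<odot> oct_conj (oct_a v) = oct_e 0"
    by (simp add: oct_a_conj norm3D(1)[OF assms] octonion.mul_diff oct_a_sq[OF assms])
  then have "oct_n (oct_a v) = 1" by (simp add: oct_n_def oct_form_def)
  then have "oct_inv (oct_a v) = oct_e 0 - oct_a v"
    by (simp add: oct_inv_def oct_a_conj norm3D(1)[OF assms])
  then show ?thesis by (simp add: oct_T_def octonion.conjugation_def fun_eq_iff)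
qed

lemma G2C_iff: "f \<in> carrier G2_C \<longleftrightarrow> bij f \<and> (\<forall>x y. f (x + y) = f x + f y)
    \<and> (\<forall>c x. f (c *s x) = c *s f x) \<and> (\<forall>x y. f (x \<odot> y) = f x \<odot> f y)"
  by (rule carrier_algebra_aut[OF vector_space_octonion])

lemma octonion_scalar_square:
  assumes "x \<odot> x = c *s oct_e 0" shows "oct_tr x = 0 \<or> x = oct_tr x *s oct_e 0"
  using assms by (cases x rule: oct_cases) (auto simp: oct_e_oct algebra_simps)

context
  fixes f assumes f: "f \<in> carrier G2_C"
begin

lemma G2C_linear: "f (x + y) = f x + f y" "f (x - y) = f x - f y" "f (c *s x) = c *s f x" "f (- x) = - f x"
proof -
  show m: "f (x + y) = f x + f y" "f (c *s x) = c *s f x" for x y c using f by (auto simp: G2C_iff)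
  show n: "f (- x) = - f x" for x using m(2)[of "-1" x] by simp
  show "f (x - y) = f x - f y" using m(1)[of x "- y"] n[of y] by simp
qed

lemma G2C_mul: "f (x \<odot> y) = f x \<odot> f y" and G2C_inj: "f x = f y \<longleftrightarrow> x = y"
  using f by (auto simp: G2C_iff bij_def inj_eq)

lemma G2C_one: "f (oct_e 0) = oct_e 0"
proof -
  obtain e where "f e = oct_e 0" using f by (metis G2C_iff bij_pointE)
  then show ?thesis using G2C_mul[of "oct_e 0" e] by simp
qed

text \<open>The elements with scalar square are those of \<open>oct_V\<close> and the scalars, and
  automorphisms preserve scalar squares. A scalar image could only come from the same
  scalar.\<close>

lemma G2C_V:
  assumes "v \<in> oct_V" shows "f v \<in> oct_V"
proof -
  have "v \<odot> v = (- oct_n v) *s oct_e 0" by (rule oct_V_sq[OF assms])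
  then have "f v \<odot> f v = (- oct_n v) *s oct_e 0" by (metis G2C_mul G2C_linear(3) G2C_one)
  from octonion_scalar_square[OF this] show ?thesis
  proof
    assume "f v = oct_tr (f v) *s oct_e 0"
    moreover have "f (oct_tr (f v) *s oct_e 0) = oct_tr (f v) *s oct_e 0" by (simp only: G2C_linear(3) G2C_one)
    ultimately have "f v = f (oct_tr (f v) *s oct_e 0)" by (rule trans[OF _ sym])
    then have "v = oct_tr (f v) *s oct_e 0" by (simp only: G2C_inj)
    then have "oct_tr v = oct_tr (f v)" by (metis mult.right_neutral oct_tr_linear(4,5))
    then show ?thesis using assms by (simp add: oct_V_def)
  qed (simp add: oct_V_def)
qed

lemma G2C_tr: "oct_tr (f x) = oct_tr x"
proof -
  have "x - oct_tr x *s oct_e 0 \<in> oct_V" by (simp add: oct_V_def)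
  from G2C_V[OF this] show ?thesis by (simp add: oct_V_def G2C_linear G2C_one)
qed

lemma G2C_form: "oct_form (f x) (f y) = oct_form x y"
proof -
  have "oct_conj (f y) = f (oct_conj y)" by (simp add: oct_conj_tr G2C_tr G2C_linear G2C_one)
  then show ?thesis by (simp add: oct_form_def G2C_tr flip: G2C_mul)
qed

lemma G2C_norm3: "v \<in> norm3_vectors \<Longrightarrow> f v \<in> norm3_vectors"
  by (simp add: norm3_vectors_def G2C_V oct_n_def G2C_form)

lemma G2C_a: "f (oct_a v) = oct_a (f v)"
  by (simp add: oct_a_def G2C_linear G2C_one)

lemma G2C_inv_comp: "inv\<^bsub>G2_C\<^esub> f \<circ> f = id" "f \<circ> inv\<^bsub>G2_C\<^esub> f = id"
  "(inv\<^bsub>G2_C\<^esub> f) (f x) = x" "f ((inv\<^bsub>G2_C\<^esub> f) x) = x"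
proof -
  show *: "inv\<^bsub>G2_C\<^esub> f \<circ> f = id" "f \<circ> inv\<^bsub>G2_C\<^esub> f = id"
    using G2C.l_inv[OF f] G2C.r_inv[OF f] by simp_all
  show "(inv\<^bsub>G2_C\<^esub> f) (f x) = x" "f ((inv\<^bsub>G2_C\<^esub> f) x) = x"
    using *[THEN fun_cong, of x] by simp_all
qed

lemma G2C_conj:
  assumes "v \<in> norm3_vectors"
  shows "f \<circ> oct_T (oct_a v) \<circ> inv\<^bsub>G2_C\<^esub> f = oct_T (oct_a (f v))"
proof -
  have "f \<circ> oct_T (oct_a v) = oct_T (oct_a (f v)) \<circ> f"
    by (simp add: fun_eq_iff oct_T_eq assms G2C_norm3 octonion.conjugation_def G2C_mul G2C_linear G2C_one G2C_a)
  then have "f \<circ> oct_T (oct_a v) \<circ> inv\<^bsub>G2_C\<^esub> f = oct_T (oct_a (f v)) \<circ> (f \<circ> inv\<^bsub>G2_C\<^esub> f)"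
    by (simp only: comp_assoc)
  then show ?thesis by (simp add: G2C_inv_comp)
qed

end

lemma oct_norm3_minus: "v \<in> norm3_vectors \<Longrightarrow> - v \<in> norm3_vectors" "oct_a (- v) = oct_e 0 - oct_a v"
  by (simp_all add: norm3_vectors_def oct_V_def oct_n_def oct_form_alt oct_a_def vec_eq_iff)

lemma oct_T_inverse:
  assumes v: "v \<in> norm3_vectors"
  shows "oct_T (oct_a v) \<circ> oct_T (oct_a (- v)) = id" "oct_T (oct_a (- v)) \<circ> oct_T (oct_a v) = id"
  using octonion.conjugation_inverse[OF oct_a_sq[OF v]]
    octonion.conjugation_inverse[OF oct_a_sq[OF oct_norm3_minus(1)[OF v]]]
  unfolding oct_T_eq[OF v] oct_T_eq[OF oct_norm3_minus(1)[OF v]]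
  unfolding oct_norm3_minus(2)
  by (simp_all add: fun_eq_iff)

lemma oct_T_G2C:
  assumes v: "v \<in> norm3_vectors" shows "oct_T (oct_a v) \<in> carrier G2_C"
proof -
  have "bij (oct_T (oct_a v))" using oct_T_inverse[OF v] by (rule o_bij[rotated])
  then show ?thesis
    by (simp add: G2C_iff oct_T_eq[OF v] octonion.conjugation_add octonion.conjugation_scale
        octonion.conjugation_mul[OF oct_a_sq[OF v]])
qed

lemma oct_T_inv:
  assumes v: "v \<in> norm3_vectors" shows "inv\<^bsub>G2_C\<^esub> (oct_T (oct_a v)) = oct_T (oct_a (- v))"
  using v oct_T_inverse[OF v] by (intro G2C.inv_equality) (auto intro: oct_T_G2C oct_norm3_minus)

text \<open>The difference of \<open>T\<close> and its inverse is half the commutator with \<open>v\<close>.\<close>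

lemma oct_T_inject:
  assumes v: "v \<in> norm3_vectors" and w: "w \<in> norm3_vectors" and eq: "oct_T (oct_a v) = oct_T (oct_a w)"
  shows "v = w"
proof -
  have "oct_T (oct_a (- v)) = oct_T (oct_a (- w))"
    using oct_T_inv[OF v] oct_T_inv[OF w] eq by simp
  have d: "2 *s (oct_T (oct_a u) q - oct_T (oct_a (- u)) q) = u \<odot> q - q \<odot> u" if u: "u \<in> norm3_vectors" for u q
    unfolding oct_T_eq[OF u] oct_T_eq[OF oct_norm3_minus(1)[OF u]]
    by (simp add: octonion.conjugation_def oct_a_def octonion.mul_distribs vec_eq_iff)
  have c: "(v - w) \<odot> q = q \<odot> (v - w)" for q
  proof -
    have "v \<odot> q - q \<odot> v = w \<odot> q - q \<odot> w"
      unfolding d[OF v, symmetric] d[OF w, symmetric] eq \<open>oct_T (oct_a (- v)) = oct_T (oct_a (- w))\<close> ..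
    then show ?thesis by (simp add: octonion.mul_diff octonion.diff_mul algebra_simps)
  qed
  have "v - w \<in> oct_V" using norm3D(1) v w by (simp add: oct_V_def)
  then have "v - w = 0" using c[of "oct_e 1"] c[of "oct_e 2"]
    by (cases "v - w" rule: oct_cases) (auto simp: oct_e_oct oct_V_def oct_zero)
  then show ?thesis by simp
qed

section \<open>Triples with given invariants are conjugate\<close>

lemma alternative_algebra_prod:
  assumes "alternative_algebra s m e k" "alternative_algebra s' m' e' k'"
  shows "alternative_algebra (\<lambda>c. map_prod (s c) (s' c)) (\<lambda>x y. (m (fst x) (fst y), m' (snd x) (snd y)))
    (e, e') (map_prod k k')"
proof -
  interpret A: alternative_algebra s m e k by fact
  interpret B: alternative_algebra s' m' e' k' by fact
  show ?thesis
    by unfold_locales (auto simp: A.scale_right_distrib B.scale_right_distrib A.scale_left_distrib B.scale_left_distrib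
        A.mul_distribs B.mul_distribs A.left_alt B.left_alt A.cnj_add B.cnj_add A.cnj_scale B.cnj_scale A.cnj_mul B.cnj_mul)
qed

text \<open>This is where equality of the invariants enters: the relations for pairs hold because
  both components satisfy them with the same scalars.\<close>

lemma word_triple_prod:
  assumes "word_triple s m e k a b c p q r t" "word_triple s' m' e' k' a' b' c' p q r t"
  shows "word_triple (\<lambda>c. map_prod (s c) (s' c)) (\<lambda>x y. (m (fst x) (fst y), m' (snd x) (snd y)))
    (e, e') (map_prod k k') (a, a') (b, b') (c, c') p q r t"
proof -
  interpret A: word_triple s m e k a b c p q r t by fact
  interpret B: word_triple s' m' e' k' a' b' c' p q r t by fact
  show ?thesis
    by (intro word_triple.intro word_triple_axioms.intro alternative_algebra_prod
        A.alternative_algebra_axioms B.alternative_algebra_axioms)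
      (simp_all add: A.sq B.sq A.anti B.anti A.cnj B.cnj A.cnj3 B.cnj3)
qed

text \<open>Restricting scalars to the integers gives the complex octonions and the Zorn algebra a
  common scalar ring, so that their product can be formed.\<close>

lemma alternative_algebra_of_int:
  assumes "alternative_algebra s m e k"
  shows "alternative_algebra (\<lambda>j :: int. s (of_int j)) m e k"
proof -
  interpret A: alternative_algebra s m e k by fact
  show ?thesis
    by unfold_locales (auto simp: A.scale_right_distrib A.scale_left_distrib A.mul_distribs A.left_alt A.cnj_add
        A.cnj_scale A.cnj_mul)
qed

text \<open>Over the moduli point (x, y, z, b) the parameters are 1 - z, 1 - y, 1 - x and -1 - b;
  the last one vanishes on the slice of the Klein surface.\<close>

lemma word_triple_oct:
  assumes v: "v1 \<in> norm3_vectors" "v2 \<in> norm3_vectors" "v3 \<in> norm3_vectors"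
  shows "word_triple (*s) (\<odot>) (oct_e 0) oct_conj (oct_a v1) (oct_a v2) (oct_a v3)
    ((1 + oct_form v1 v2) / 2) ((1 + oct_form v1 v3) / 2) ((1 + oct_form v2 v3) / 2)
    ((1 - (oct_form v2 v3 + oct_form v1 v3 + oct_form v1 v2 + oct_form v1 (v2 \<odot> v3))) / 4)"
  by (intro word_triple.intro word_triple_axioms.intro alternative_algebra_octonion)
    (rule oct_a_sq oct_a_anticomm oct_a_conj oct_a_third norm3D(1) v)+

lemma vec_dim_octonion: "vec.dim (UNIV :: octonion set) = 8"
  by (simp only: vec_dim_card) simp

lemma oct_tr_nondegenerate:
  assumes "\<And>y. oct_tr (x \<odot> y) = 0" shows "x = 0"
proof -
  have "x $ i = 0" for i
  proof -
    have "\<forall>i. oct_tr (x \<odot> oct_e i) = (if i = 0 then x $ i else - x $ i)"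
      unfolding forall_8 by (cases x rule: oct_cases) (simp add: oct_e_oct)
    then show ?thesis using assms[of "oct_e i"] by (simp split: if_splits)
  qed
  then show ?thesis by (simp add: vec_eq_iff)
qed

text \<open>The span of the words in the product algebra is closed under multiplication and
  involution. The first components of the words form a basis, so this span is the graph of a linear
  map, which inherits both structures without any multiplication table.\<close>

lemma words_graph:
  fixes a b c a' b' c' :: octonion
  assumes w: "word_triple (*s) (\<odot>) (oct_e 0) oct_conj a b c p q r t"
    and w': "word_triple (*s) (\<odot>) (oct_e 0) oct_conj a' b' c' p q r t"
    and span: "vec.span (set (octonion.words a b c)) = UNIV"
  shows "\<exists>f\<in>carrier G2_C. f a = a' \<and> f b = b' \<and> f c = c'"
proof -
  let ?s = "\<lambda>c :: complex. map_prod ((*s) c :: octonion \<Rightarrow> octonion) ((*s) c :: octonion \<Rightarrow> octonion)"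
  interpret P: word_triple ?s "\<lambda>x y. (fst x \<odot> fst y, snd x \<odot> snd y)" "(oct_e 0, oct_e 0)"
    "map_prod oct_conj oct_conj" "(a, a')" "(b, b')" "(c, c')" p q r t
    by (rule word_triple_prod[OF w w'])
  let ?ws = "octonion.words a b c" and ?ws' = "octonion.words a' b' c'"
  let ?W = "set (P.words (a, a') (b, b') (c, c'))"
  have len: "length ?ws = 8" "length ?ws' = 8" by (simp_all add: octonion.words_def)
  have zip: "P.words (a, a') (b, b') (c, c') = zip ?ws ?ws'"
    by (simp add: octonion.words_def P.words_def)
  \<comment> \<open>Eight vectors spanning a space of dimension eight form a basis, so a linear map
    can be prescribed on the words.\<close>
  have "8 \<le> card (set ?ws)"
    using vec.dim_le_card[of UNIV "set ?ws"] span unfolding vec_dim_octonion by simp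
  then have card: "card (set ?ws) = 8" using card_length[of ?ws] len by simp
  then have dist: "distinct ?ws" using len by (intro card_distinct) simp
  have indep: "vec.independent (set ?ws)"
    using vec.card_le_dim_spanning[of "set ?ws" UNIV] span card unfolding vec_dim_octonion by simp
  obtain f where f: "Vector_Spaces.linear (*s) (*s) f"
      "\<And>x. x \<in> set ?ws \<Longrightarrow> f x = the (map_of (zip ?ws ?ws') x)"
    using vec.linear_independent_extend[OF indep, of "\<lambda>x. the (map_of (zip ?ws ?ws') x)"] by auto
  have lin: "f (x + y) = f x + f y" "f (k *s x) = k *s f x" for x y k
    using f(1) by (simp_all add: linear_iff_preserves[OF vector_space_octonion])
  have "snd x = f (fst x)" if "x \<in> set (zip ?ws ?ws')" for x
  proof -
    have "map_of (zip ?ws ?ws') (fst x) = Some (snd x)"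
      using that dist len by (intro map_of_is_SomeI) simp_all
    moreover have "fst x \<in> set ?ws" using that by (metis prod.collapse set_zip_leftD)
    ultimately show ?thesis using f(2)[of "fst x"] by simp
  qed
  then have "?W \<subseteq> {x. snd x = f (fst x)}" unfolding zip by blast
  moreover have "f 0 = 0" using lin(1)[of 0 0] by simp
  then have "P.subspace {x. snd x = f (fst x)}" by (intro P.subspaceI) (auto simp: lin)
  ultimately have S1: "snd x = f (fst x)" if "x \<in> P.W" for x
    using P.span_minimal that by blast
  \<comment> \<open>The first projection is a subspace containing the words of the spanning triple,
    hence everything; the span is therefore the whole graph of \<open>f\<close>.\<close>
  have "vec.subspace {x. \<exists>y. (x, y) \<in> P.W}"
  proof (rule vec.subspaceI)
    show "0 \<in> {x. \<exists>y. (x, y) \<in> P.W}" using P.span_zero[of ?W] by (auto simp: zero_prod_def)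
    fix x y k assume x: "x \<in> {x. \<exists>y. (x, y) \<in> P.W}"
    then show "k *s x \<in> {x. \<exists>y. (x, y) \<in> P.W}" using P.span_scale[of _ ?W k] by fastforce
    assume "y \<in> {x. \<exists>y. (x, y) \<in> P.W}"
    then show "x + y \<in> {x. \<exists>y. (x, y) \<in> P.W}" using x P.span_add[of _ ?W] by fastforce
  qed
  moreover have "set ?ws \<subseteq> {x. \<exists>y. (x, y) \<in> P.W}"
  proof
    fix x assume "x \<in> set ?ws"
    then obtain y where "(x, y) \<in> set (zip ?ws ?ws')"
      by (metis in_set_impl_in_set_zip1 len)
    then show "x \<in> {x. \<exists>y. (x, y) \<in> P.W}" unfolding zip[symmetric] using P.span_base by blast
  qed
  ultimately have "vec.span (set ?ws) \<subseteq> {x. \<exists>y. (x, y) \<in> P.W}" by (rule vec.span_minimal[rotated])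
  then have ex: "\<exists>y. (x, y) \<in> P.W" for x unfolding span by blast
  have S: "(x, f x) \<in> P.W" for x
  proof -
    obtain y where y: "(x, y) \<in> P.W" using ex by blast
    then have "y = f x" using S1[of "(x, y)"] by simp
    then show ?thesis using y by simp
  qed
  have mul: "f (x \<odot> y) = f x \<odot> f y" for x y using S1[OF P.W_mul[OF S[of x] S[of y]]] by simp
  have conj: "f (oct_conj x) = oct_conj (f x)" for x using S1[OF P.W_cnj[OF S[of x]]] by simp
  have vals: "f (oct_e 0) = oct_e 0" "f a = a'" "f b = b'" "f c = c'"
    using S1[OF P.W_words(1)] S1[OF P.W_words(2)] S1[OF P.W_words(3)] S1[OF P.W_words(4)] by simp_all
  have tr: "oct_tr (f x) = oct_tr x" for x
  proof -
    have "f x + f (oct_conj x) = (2 * oct_tr x) *s oct_e 0"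
    proof -
      have "x + oct_conj x = (2 * oct_tr x) *s oct_e 0" by (simp add: oct_conj_tr)
      then have "f (x + oct_conj x) = (2 * oct_tr x) *s oct_e 0" by (simp only: lin(2) vals(1))
      then show ?thesis by (simp only: lin(1))
    qed
    then have "oct_tr (f x + oct_conj (f x)) = 2 * oct_tr x" by (simp add: conj)
    then show ?thesis by (simp add: oct_conj_tr)
  qed
  \<comment> \<open>Traces of products are preserved, and the trace form is nondegenerate, so the
    kernel is zero.\<close>
  have "inj f"
  proof (rule injI)
    fix x y assume "f x = f y"
    then have 0: "f (x - y) = 0" using lin(1)[of "x - y" y] by simp
    have "oct_tr ((x - y) \<odot> z) = 0" for z using tr[of "(x - y) \<odot> z"] by (simp add: mul 0 oct_tr_def)
    then show "x = y" using oct_tr_nondegenerate by force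
  qed
  moreover have "surj f" by (rule vec.linear_inj_imp_surj[OF f(1) \<open>inj f\<close>])
  ultimately have "f \<in> carrier G2_C" by (simp add: G2C_iff bij_def lin mul)
  then show ?thesis using vals by blast
qed

lemma oct_a_inject: "oct_a v = oct_a w \<longleftrightarrow> v = w"
  by (metis oct_a_eq)

lemma G2C_transitive:
  assumes v: "v1 \<in> norm3_vectors" "v2 \<in> norm3_vectors" "v3 \<in> norm3_vectors"
    and w: "w1 \<in> norm3_vectors" "w2 \<in> norm3_vectors" "w3 \<in> norm3_vectors"
    and eq: "oct_form v2 v3 = oct_form w2 w3" "oct_form v1 v3 = oct_form w1 w3" "oct_form v1 v2 = oct_form w1 w2"
      "oct_form v1 (v2 \<odot> v3) = oct_form w1 (w2 \<odot> w3)"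
    and span: "vec.span (set (octonion.words (oct_a v1) (oct_a v2) (oct_a v3))) = UNIV"
  shows "\<exists>f\<in>carrier G2_C. f v1 = w1 \<and> f v2 = w2 \<and> f v3 = w3"
proof -
  obtain f where f: "f \<in> carrier G2_C" "f (oct_a v1) = oct_a w1" "f (oct_a v2) = oct_a w2" "f (oct_a v3) = oct_a w3"
    using words_graph[OF word_triple_oct[OF v] word_triple_oct[OF w, folded eq] span] by blast
  then show ?thesis using G2C_a[OF f(1)] oct_a_inject by metis
qed

text \<open>The sum equal to 1 is \<open>4 * b + 5\<close> at \<open>b = - 1\<close>. The span
  condition is what makes the fibre over the point a single conjugacy class.\<close>

fun spanning_triple :: "octonion \<times> octonion \<times> octonion \<Rightarrow> complex \<times> complex \<times> complex \<Rightarrow> bool" where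
  "spanning_triple (v1, v2, v3) (x, y, z) \<longleftrightarrow>
     v1 \<in> norm3_vectors \<and> v2 \<in> norm3_vectors \<and> v3 \<in> norm3_vectors \<and>
     oct_form v2 v3 = 1 - 2 * x \<and> oct_form v1 v3 = 1 - 2 * y \<and> oct_form v1 v2 = 1 - 2 * z \<and>
     oct_form v2 v3 + oct_form v1 v3 + oct_form v1 v2 + oct_form v1 (v2 \<odot> v3) = 1 \<and>
     vec.span (set (octonion.words (oct_a v1) (oct_a v2) (oct_a v3))) = UNIV"

fun vector_triple :: "octonion \<times> octonion \<times> octonion \<Rightarrow> g2_triple" where
  "vector_triple (v1, v2, v3) = (oct_T (oct_a v1), oct_T (oct_a v2), oct_T (oct_a v3))"

lemma klein_triples_eq_class:
  assumes "spanning_triple v P" shows "klein_triples P = triple_class (vector_triple v)"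
proof -
  obtain v1 v2 v3 x y z where vP: "v = (v1, v2, v3)" "P = (x, y, z)" by (metis prod.exhaust)
  have v: "v1 \<in> norm3_vectors" "v2 \<in> norm3_vectors" "v3 \<in> norm3_vectors"
    and form: "oct_form v2 v3 = 1 - 2 * x" "oct_form v1 v3 = 1 - 2 * y" "oct_form v1 v2 = 1 - 2 * z"
      "oct_form v2 v3 + oct_form v1 v3 + oct_form v1 v2 + oct_form v1 (v2 \<odot> v3) = 1"
    and span: "vec.span (set (octonion.words (oct_a v1) (oct_a v2) (oct_a v3))) = UNIV"
    using assms unfolding vP spanning_triple.simps by blast+
  have conj: "conj_triple f (vector_triple v) = vector_triple (f v1, f v2, f v3)" if "f \<in> carrier G2_C" for f
    using that v by (simp add: vP G2C_conj)
  show ?thesis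
  proof (intro equalityI subsetI)
    fix s assume s: "s \<in> klein_triples P"
    obtain s1 s2 s3 where s123: "s = (s1, s2, s3)" by (metis prod.exhaust)
    obtain w1 w2 w3 where w: "w1 \<in> norm3_vectors" "w2 \<in> norm3_vectors" "w3 \<in> norm3_vectors"
      and s': "s = vector_triple (w1, w2, w3)"
      and form': "oct_form w2 w3 = 1 - 2 * x" "oct_form w1 w3 = 1 - 2 * y" "oct_form w1 w2 = 1 - 2 * z"
        "oct_form w2 w3 + oct_form w1 w3 + oct_form w1 w2 + oct_form w1 (w2 \<odot> w3) = 1"
      using s by (auto simp: klein_triples_def vP s123)
    have eq: "oct_form v2 v3 = oct_form w2 w3" "oct_form v1 v3 = oct_form w1 w3" "oct_form v1 v2 = oct_form w1 w2"
      using form form' by simp_all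
    moreover have "oct_form v1 (v2 \<odot> v3) = oct_form w1 (w2 \<odot> w3)"
      using form(4) form'(4) unfolding eq by (metis add_left_cancel)
    ultimately obtain f where f: "f \<in> carrier G2_C" "f v1 = w1" "f v2 = w2" "f v3 = w3"
      using G2C_transitive[OF v w _ _ _ _ span] by blast
    then have "s = conj_triple f (vector_triple v)" using conj s' by simp
    then show "s \<in> triple_class (vector_triple v)" using f(1) unfolding triple_class_def by blast
  next
    fix s assume "s \<in> triple_class (vector_triple v)"
    then obtain f where f: "f \<in> carrier G2_C" "s = vector_triple (f v1, f v2, f v3)"
      using conj by (auto simp: triple_class_def)
    have "over_moduli_point s (klein_moduli P)"
      unfolding f(2) vP vector_triple.simps klein_moduli.simps over_moduli_point.simps
      by (rule bexI[OF _ G2C_norm3[OF f(1) v(1)]], rule bexI[OF _ G2C_norm3[OF f(1) v(2)]],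
          rule bexI[OF _ G2C_norm3[OF f(1) v(3)]])
        (use form in \<open>simp add: G2C_form[OF f(1)] flip: G2C_mul[OF f(1)]\<close>)
    then show "s \<in> klein_triples P" by (simp add: klein_triples_def)
  qed
qed

section \<open>The seven points of the Klein surface\<close>

lemma (in group) generate_braid:
  assumes "f \<in> carrier G" "g \<in> carrier G" "h \<in> carrier G"
  shows "generate G {g, inv g \<otimes> f \<otimes> g, h} = generate G {f, g, h}"
proof
  have c: "inv g \<otimes> f \<otimes> g \<in> carrier G" using assms by simp
  have i: "{f, g, h} \<subseteq> generate G {f, g, h}" "{g, inv g \<otimes> f \<otimes> g, h} \<subseteq> generate G {g, inv g \<otimes> f \<otimes> g, h}"
    by (auto intro: generate.incl)
  have s: "subgroup (generate G {f, g, h}) G" "subgroup (generate G {g, inv g \<otimes> f \<otimes> g, h}) G"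
    using assms c by (intro generate_is_subgroup; simp)+
  have "inv g \<otimes> f \<otimes> g \<in> generate G {f, g, h}"
    using i(1) by (intro subgroup.m_closed[OF s(1)] subgroup.m_inv_closed[OF s(1)]) auto
  then show "generate G {g, inv g \<otimes> f \<otimes> g, h} \<subseteq> generate G {f, g, h}"
    using i(1) by (intro generate_subgroup_incl s) auto
  have "g \<otimes> (inv g \<otimes> f \<otimes> g) \<otimes> inv g = f" using assms by (simp add: m_assoc) (simp flip: m_assoc)
  moreover have "g \<otimes> (inv g \<otimes> f \<otimes> g) \<otimes> inv g \<in> generate G {g, inv g \<otimes> f \<otimes> g, h}"
    using i(2) subgroup.m_closed[OF s(2)] subgroup.m_inv_closed[OF s(2)] by auto
  ultimately have "f \<in> generate G {g, inv g \<otimes> f \<otimes> g, h}" by simp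
  then show "generate G {f, g, h} \<subseteq> generate G {g, inv g \<otimes> f \<otimes> g, h}"
    using i(2) by (intro generate_subgroup_incl s) auto
qed

text \<open>The span of the words of norm 3 vectors is a subalgebra, so it contains whatever can be
  obtained from them by multiplication. A braid move can be undone in this way, hence keeps the
  spanning property.\<close>

lemma span_words_mono:
  assumes v: "v1 \<in> norm3_vectors" "v2 \<in> norm3_vectors" "v3 \<in> norm3_vectors"
    and W: "vec.span (set (octonion.words a b c)) = UNIV"
    and abc: "\<And>S. vec.subspace S \<Longrightarrow> (\<And>x y. x \<in> S \<Longrightarrow> y \<in> S \<Longrightarrow> x \<odot> y \<in> S) \<Longrightarrow> oct_e 0 \<in> S \<Longrightarrow>
      oct_a v1 \<in> S \<Longrightarrow> oct_a v2 \<in> S \<Longrightarrow> oct_a v3 \<in> S \<Longrightarrow> a \<in> S \<and> b \<in> S \<and> c \<in> S"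
  shows "vec.span (set (octonion.words (oct_a v1) (oct_a v2) (oct_a v3))) = UNIV"
proof -
  interpret W: word_triple "(*s)" "(\<odot>)" "oct_e 0" oct_conj "oct_a v1" "oct_a v2" "oct_a v3"
    "(1 + oct_form v1 v2) / 2" "(1 + oct_form v1 v3) / 2" "(1 + oct_form v2 v3) / 2"
    "(1 - (oct_form v2 v3 + oct_form v1 v3 + oct_form v1 v2 + oct_form v1 (v2 \<odot> v3))) / 4"
    by (rule word_triple_oct[OF v])
  have "a \<in> W.W \<and> b \<in> W.W \<and> c \<in> W.W"
    by (rule abc[OF vec.subspace_span W.W_mul W.W_words(1-4)])
  then have "set (octonion.words a b c) \<subseteq> W.W"
    using octonion.words_subset[OF W.W_mul W.W_words(1)] by blast
  then show ?thesis using W vec.span_minimal[OF _ vec.subspace_span] by blast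
qed

text \<open>The braid move on vectors: by equivariance, conjugating \<open>oct_T (oct_a w)\<close>
  by the inverse of \<open>oct_T (oct_a v)\<close> means applying that inverse, which belongs to
  \<open>- v\<close>, to \<open>w\<close>.\<close>

definition oct_braid :: "octonion \<Rightarrow> octonion \<Rightarrow> octonion" where
  "oct_braid v w = oct_T (oct_a (- v)) w"

lemma oct_braid_norm3: "v \<in> norm3_vectors \<Longrightarrow> w \<in> norm3_vectors \<Longrightarrow> oct_braid v w \<in> norm3_vectors"
  unfolding oct_braid_def by (rule G2C_norm3[OF oct_T_G2C[OF oct_norm3_minus(1)]])

lemma oct_T_braid:
  assumes v: "v \<in> norm3_vectors" and w: "w \<in> norm3_vectors"
  shows "oct_T (oct_a (oct_braid v w))
    = inv\<^bsub>G2_C\<^esub> (oct_T (oct_a v)) \<otimes>\<^bsub>G2_C\<^esub> oct_T (oct_a w) \<otimes>\<^bsub>G2_C\<^esub> oct_T (oct_a v)"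
  using G2C_conj[OF oct_T_G2C[OF oct_norm3_minus(1)[OF v]] w] oct_T_inv[OF v]
    oct_T_inv[OF oct_norm3_minus(1)[OF v]]
  by (simp add: oct_braid_def)

lemma oct_braid_recover:
  assumes v: "v \<in> norm3_vectors" and S: "\<And>x y. x \<in> S \<Longrightarrow> y \<in> S \<Longrightarrow> x \<odot> y \<in> S" "vec.subspace S" "oct_e 0 \<in> S"
    and a: "oct_a v \<in> S" "oct_a (oct_braid v w) \<in> S"
  shows "oct_a w \<in> S"
proof -
  have "oct_a (oct_braid v w) = oct_T (oct_a (- v)) (oct_a w)"
    unfolding oct_braid_def by (rule G2C_a[OF oct_T_G2C[OF oct_norm3_minus(1)[OF v]], symmetric])
  then have "oct_a w = oct_T (oct_a v) (oct_a (oct_braid v w))"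
    using oct_T_inverse(1)[OF v] by (simp add: fun_eq_iff)
  also have "\<dots> \<in> S" unfolding oct_T_eq[OF v] octonion.conjugation_def
    by (intro S(1) a vec.subspace_diff S(2,3))
  finally show ?thesis .
qed

lemma spanning_braid1:
  assumes "spanning_triple (v1, v2, v3) P"
    and "oct_form (oct_braid v2 v1) v3 = 1 - 2 * x" "oct_form v2 v3 = 1 - 2 * y" "oct_form v2 (oct_braid v2 v1) = 1 - 2 * z"
    and "oct_form (oct_braid v2 v1) v3 + oct_form v2 v3 + oct_form v2 (oct_braid v2 v1) + oct_form v2 (oct_braid v2 v1 \<odot> v3) = 1"
  shows "spanning_triple (v2, oct_braid v2 v1, v3) (x, y, z) \<and>
    generated_group (vector_triple (v2, oct_braid v2 v1, v3)) = generated_group (vector_triple (v1, v2, v3))"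
proof -
  obtain p q r where P: "P = (p, q, r)" by (metis prod.exhaust)
  have v: "v1 \<in> norm3_vectors" "v2 \<in> norm3_vectors" "v3 \<in> norm3_vectors"
    and span: "vec.span (set (octonion.words (oct_a v1) (oct_a v2) (oct_a v3))) = UNIV"
    using assms(1) unfolding P spanning_triple.simps by blast+
  have "vec.span (set (octonion.words (oct_a v2) (oct_a (oct_braid v2 v1)) (oct_a v3))) = UNIV"
    using oct_braid_recover[OF v(2)] by (intro span_words_mono[OF v(2) oct_braid_norm3[OF v(2,1)] v(3) span]) blast
  then show ?thesis
    using assms(2-) v oct_braid_norm3[OF v(2,1)] G2C.generate_braid[of "oct_T (oct_a v1)" "oct_T (oct_a v2)" "oct_T (oct_a v3)"]
      oct_T_G2C oct_T_braid[OF v(2,1)] unfolding spanning_triple.simps vector_triple.simps generated_group.simps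
    by simp
qed

lemma spanning_braid2:
  assumes "spanning_triple (v1, v2, v3) P"
    and "oct_form v3 (oct_braid v3 v2) = 1 - 2 * x" "oct_form v1 (oct_braid v3 v2) = 1 - 2 * y" "oct_form v1 v3 = 1 - 2 * z"
    and "oct_form v3 (oct_braid v3 v2) + oct_form v1 (oct_braid v3 v2) + oct_form v1 v3 + oct_form v1 (v3 \<odot> oct_braid v3 v2) = 1"
  shows "spanning_triple (v1, v3, oct_braid v3 v2) (x, y, z) \<and>
    generated_group (vector_triple (v1, v3, oct_braid v3 v2)) = generated_group (vector_triple (v1, v2, v3))"
proof -
  obtain p q r where P: "P = (p, q, r)" by (metis prod.exhaust)
  have v: "v1 \<in> norm3_vectors" "v2 \<in> norm3_vectors" "v3 \<in> norm3_vectors"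
    and span: "vec.span (set (octonion.words (oct_a v1) (oct_a v2) (oct_a v3))) = UNIV"
    using assms(1) unfolding P spanning_triple.simps by blast+
  have "vec.span (set (octonion.words (oct_a v1) (oct_a v3) (oct_a (oct_braid v3 v2)))) = UNIV"
    using oct_braid_recover[OF v(3)] by (intro span_words_mono[OF v(1,3) oct_braid_norm3[OF v(3,2)] span]) blast
  then show ?thesis
    using assms(2-) v oct_braid_norm3[OF v(3,2)] G2C.generate_braid[of "oct_T (oct_a v2)" "oct_T (oct_a v3)" "oct_T (oct_a v1)"]
      oct_T_G2C oct_T_braid[OF v(3,2)] unfolding spanning_triple.simps vector_triple.simps generated_group.simps
    by (simp add: insert_commute)
qed

lemma oct_norm3_oct: "oct a b c d e f g h \<in> norm3_vectors \<longleftrightarrow> a = 0 \<and> b*b + c*c + d*d + e*e + f*f + g*g + h*h = 3"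
  by (auto simp: norm3_vectors_def oct_V_def oct_n_def)

lemma oct_a_oct: "oct_a (oct a b c d e f g h) = oct ((1 + a) / 2) (b / 2) (c / 2) (d / 2) (e / 2) (f / 2) (g / 2) (h / 2)"
  by (simp add: oct_a_def oct_e_oct field_simps)

lemma oct_braid_alt:
  assumes "v \<in> norm3_vectors" shows "oct_braid v w = ((oct_e 0 - oct_a v) \<odot> w) \<odot> oct_a v"
  unfolding oct_braid_def oct_T_eq[OF oct_norm3_minus(1)[OF assms]]
  unfolding octonion.conjugation_def oct_norm3_minus(2) by simp

definition line1 :: octonion where "line1 = oct 0 1 0 1 0 0 0 1"
definition line2 :: octonion where "line2 = oct 0 0 1 0 0 0 1 1"
definition line3 :: octonion where "line3 = oct 0 0 0 0 1 1 0 1"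

lemma spanning_lines: "spanning_triple (line1, line2, line3) (0, 0, 0)"
proof -
  let ?w = "octonion.words (oct_a line1) (oct_a line2) (oct_a line3)"
  let ?S = "vec.span (set ?w)"
  define s where "s = (\<lambda>c0 c1 c2 c3 c4 c5 c6 c7 :: complex. c0 *s ?w ! 0 + c1 *s ?w ! 1 + c2 *s ?w ! 2 + c3 *s ?w ! 3
    + c4 *s ?w ! 4 + c5 *s ?w ! 5 + c6 *s ?w ! 6 + c7 *s ?w ! 7)"
  have mem: "s c0 c1 c2 c3 c4 c5 c6 c7 \<in> ?S" for c0 c1 c2 c3 c4 c5 c6 c7
    unfolding s_def by (intro vec.span_add vec.span_scale vec.span_base nth_mem) (simp_all add: octonion.words_def)
  \<comment> \<open>The coefficients come from inverting the 8 by 8 matrix that expresses the words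
    in the standard basis.\<close>
  have "oct x0 x1 x2 x3 x4 x5 x6 x7 = s (x0 - x2 - x3 - x4) (x1 + x2 + x3 - x6) (- x1 + x2 + x3 + x6) (2 * x4)
    (- x2 - x3 - x5 + x7) (- x2 - x4 + x5 + x6) (- x3 - x4 - x6 + x7) (x1 + x2 + x4 - x7)" for x0 x1 x2 x3 x4 x5 x6 x7
    unfolding s_def octonion.words_def
    by (simp add: line1_def line2_def line3_def oct_a_oct oct_e_oct field_simps)
  then have "?S = UNIV" using mem by (metis UNIV_eq_I oct_cases)
  then show ?thesis by (simp add: line1_def line2_def line3_def oct_norm3_oct)
qed

definition line_group :: "(octonion \<Rightarrow> octonion) set" where
  "line_group = generated_group (vector_triple (line1, line2, line3))"

lemma klein_orbit_triples:
  assumes "P \<in> {(0,0,0), (0,0,1), (0,1,0), (1,0,0), (1,1,0), (1,0,1), (0,1,1)}"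
  shows "\<exists>v. spanning_triple v P \<and> generated_group (vector_triple v) = line_group"
proof -
  \<comment> \<open>The new vectors arise from the braid moves recorded in \<open>b\<close>. These
    form a tree: the first generator leads from (0,0,0) to (1,0,0), (1,1,0) and (0,1,0); the second
    leads from (0,1,0) to (0,1,1) and (0,0,1), and from (1,1,0) to (1,0,1).\<close>
  define w1 where "w1 = oct 0 0 0 (-1) 0 (-1) 1 0"
  define w2 where "w2 = oct 0 1 (-1) 0 0 (-1) 0 0"
  define w3 where "w3 = oct 0 0 0 (-1) 0 1 1 0"
  define w4 where "w4 = oct 0 1 0 0 (-1) 0 1 0"
  define w5 where "w5 = oct 0 (-1) 0 0 (-1) 0 1 0"
  note defs = line1_def line2_def line3_def w1_def w2_def w3_def w4_def w5_def
  have n: "line1 \<in> norm3_vectors" "line2 \<in> norm3_vectors" "line3 \<in> norm3_vectors" "w1 \<in> norm3_vectors"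
    "w2 \<in> norm3_vectors" "w3 \<in> norm3_vectors"
    by (simp_all add: defs oct_norm3_oct)
  have b: "oct_braid line2 line1 = w1" "oct_braid w1 line2 = w2" "oct_braid w2 w1 = line1"
    "oct_braid line3 line1 = w3" "oct_braid w3 line3 = w4" "oct_braid line3 w2 = w5"
    by (simp_all add: oct_braid_alt n) (simp_all add: defs oct_a_oct oct_e_oct)
  note 0 = spanning_lines
  have 1: "spanning_triple (line2, w1, line3) (1, 0, 0) \<and> generated_group (vector_triple (line2, w1, line3)) = line_group"
    using spanning_braid1[OF 0, unfolded b, of 1 0 0] by (simp add: defs line_group_def)
  have 2: "spanning_triple (w1, w2, line3) (1, 1, 0) \<and> generated_group (vector_triple (w1, w2, line3)) = line_group"
    using spanning_braid1[OF conjunct1[OF 1], unfolded b conjunct2[OF 1], of 1 1 0] by (simp add: defs)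
  have 3: "spanning_triple (w2, line1, line3) (0, 1, 0) \<and> generated_group (vector_triple (w2, line1, line3)) = line_group"
    using spanning_braid1[OF conjunct1[OF 2], unfolded b conjunct2[OF 2], of 0 1 0] by (simp add: defs)
  have 4: "spanning_triple (w2, line3, w3) (0, 1, 1) \<and> generated_group (vector_triple (w2, line3, w3)) = line_group"
    using spanning_braid2[OF conjunct1[OF 3], unfolded b conjunct2[OF 3], of 0 1 1] by (simp add: defs)
  have 5: "spanning_triple (w2, w3, w4) (0, 0, 1) \<and> generated_group (vector_triple (w2, w3, w4)) = line_group"
    using spanning_braid2[OF conjunct1[OF 4], unfolded b conjunct2[OF 4], of 0 0 1] by (simp add: defs)
  have 6: "spanning_triple (w1, line3, w5) (1, 0, 1) \<and> generated_group (vector_triple (w1, line3, w5)) = line_group"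
    using spanning_braid2[OF conjunct1[OF 2], unfolded b conjunct2[OF 2], of 1 0 1] by (simp add: defs)
  show ?thesis using assms 0 1 2 3 4 5 6 unfolding line_group_def by blast
qed

section \<open>Reduction modulo 2\<close>

definition bpick :: "bool \<Rightarrow> o8 \<Rightarrow> o8" where
  "bpick b w = (if b then w else (False,False,False,False,False,False,False,False))"

definition bcomb :: "o8 \<Rightarrow> o8" where
  "bcomb = (\<lambda>(b0,b1,b2,b3,b4,b5,b6,b7). badd (badd (badd (badd (badd (badd (badd (bpick b0 bone) (bpick b1 gen1)) (bpick b2 gen2))
    (bpick b3 gen3)) (bpick b4 (bmul gen1 gen2))) (bpick b5 (bmul gen1 gen3))) (bpick b6 (bmul gen2 gen3))) (bpick b7 (bmul gen1 (bmul gen2 gen3))))"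

text \<open>Independence of the words modulo 2, by running through all coefficient vectors. It
  forces an integral combination with zero reduction to have even coefficients.\<close>

lemma bwords_independent:
  "list_all (\<lambda>b. bcomb b = bpick False bone \<longrightarrow> b = bpick False bone) bits8"
  by code_simp

context alternative_algebra
begin

definition comb8 :: "'a \<Rightarrow> 'a \<Rightarrow> 'a \<Rightarrow> (nat \<Rightarrow> 'k) \<Rightarrow> 'a" where
  "comb8 a b c z = z 0 *c \<e> + z 1 *c a + z 2 *c b + z 3 *c c + z 4 *c (a \<star> b) + z 5 *c (a \<star> c) + z 6 *c (b \<star> c)
     + z 7 *c (a \<star> (b \<star> c))"

lemma span_words_subset: "span (set (words a b c)) \<subseteq> range (comb8 a b c)"
proof (rule span_minimal)
  have u: "comb8 a b c (\<lambda>j. if j = i then 1 else 0) = words a b c ! i" if "i < 8" for i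
  proof -
    have "i \<in> {0, 1, 2, 3, 4, 5, 6, 7}" using that by auto
    then show ?thesis by (auto simp: comb8_def words_def)
  qed
  show "set (words a b c) \<subseteq> range (comb8 a b c)"
  proof
    fix x assume "x \<in> set (words a b c)"
    moreover have "length (words a b c) = 8" by (simp add: words_def)
    ultimately obtain i where "i < 8" "x = words a b c ! i" by (metis in_set_conv_nth)
    then show "x \<in> range (comb8 a b c)" using u by (metis rangeI)
  qed
  show "subspace (range (comb8 a b c))"
  proof (rule subspaceI)
    show "0 \<in> range (comb8 a b c)" by (rule range_eqI[of _ _ "\<lambda>_. 0"]) (simp add: comb8_def)
    fix x y k assume "x \<in> range (comb8 a b c)"
    then obtain z where z: "x = comb8 a b c z" by blast
    show "k *c x \<in> range (comb8 a b c)"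
      by (rule range_eqI[of _ _ "\<lambda>i. k * z i"]) (simp add: z comb8_def scale_right_distrib)
    assume "y \<in> range (comb8 a b c)"
    then obtain z' where z': "y = comb8 a b c z'" by blast
    show "x + y \<in> range (comb8 a b c)"
      by (rule range_eqI[of _ _ "\<lambda>i. z i + z' i"]) (simp add: z z' comb8_def scale_left_distrib algebra_simps)
  qed
qed

end

lemma word_triple_of_int:
  assumes "word_triple s m e k a b c (of_int p) (of_int q) (of_int r) (of_int t)"
  shows "word_triple (\<lambda>j :: int. s (of_int j)) m e k a b c p q r t"
proof -
  interpret A: word_triple s m e k a b c "of_int p" "of_int q" "of_int r" "of_int t" by fact
  show ?thesis
    by (intro word_triple.intro word_triple_axioms.intro alternative_algebra_of_int A.alternative_algebra_axioms)
      (rule A.sq A.anti A.cnj A.cnj3)+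
qed

text \<open>The parameters are the residues of those of the three lines, so that both triples
  combine into one triple over the integers.\<close>

lemma word_triple_zorn:
  "word_triple zorn_scale zorn_mult zorn_one zorn_cnj (zo gen1) (zo gen2) (zo gen3) 1 1 1 (0 :: bit)"
proof -
  have c: "zorn_cnj (zo gen1) = zorn_one - zo gen1" "zorn_cnj (zo gen2) = zorn_one - zo gen2" "zorn_cnj (zo gen3) = zorn_one - zo gen3"
    by (simp_all add: zorn_one_def gen1_def gen2_def gen3_def vec_eq_iff forall_3 vector_3)
  have anti: "zorn_mult y x = x + y - zorn_scale 1 zorn_one - zorn_mult x y" if "zorn_adj x y" for x y
    using that unfolding zorn_adj_def zorn.scale_one by (simp add: eq_diff_eq)
  have third: "zorn_cnj (zorn_mult (zo gen1) (zorn_mult (zo gen2) (zo gen3)))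
      = zorn_scale 0 zorn_one - zorn_mult (zo gen1) (zorn_mult (zo gen2) (zo gen3))"
    unfolding zorn.cnj_mul c zorn.scale_zero_left diff_0 zorn_char2(2)
    using zo_g_rel(4) unfolding zorn_third_def .
  show ?thesis
    by (intro word_triple.intro word_triple_axioms.intro alternative_algebra_zorn)
      (rule zorn_unitsD zo_g_units anti zo_g_rel c third)+
qed

lemma line_norm3: "line1 \<in> norm3_vectors" "line2 \<in> norm3_vectors" "line3 \<in> norm3_vectors"
  using spanning_lines by simp_all

lemma word_triple_lines:
  "word_triple (*s) (\<odot>) (oct_e 0) oct_conj (oct_a line1) (oct_a line2) (oct_a line3) 1 1 1 0"
  using word_triple_oct[OF line_norm3] by (simp add: line1_def line2_def line3_def)

text \<open>The reduction modulo 2 of the integral octonions generated by the three lines, as an integral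
  subalgebra of the product of the complex octonions and the octonions over the field with two elements.\<close>

interpretation R: word_triple "\<lambda>j :: int. map_prod ((*s) (of_int j) :: octonion \<Rightarrow> octonion) (zorn_scale (of_int j :: bit))"
  "\<lambda>x y. (fst x \<odot> fst y, zorn_mult (snd x) (snd y))" "(oct_e 0, zorn_one)" "map_prod oct_conj zorn_cnj"
  "(oct_a line1, zo gen1)" "(oct_a line2, zo gen2)" "(oct_a line3, zo gen3)" 1 1 1 0
  by (intro word_triple_prod word_triple_of_int) (simp_all add: word_triple_lines word_triple_zorn)

abbreviation red :: "octonion \<Rightarrow> bit zorn \<Rightarrow> bool" where "red q x \<equiv> (q, x) \<in> R.W"

lemma red_add: "red q x \<Longrightarrow> red r y \<Longrightarrow> red (q + r) (x + y)"
  and red_diff: "red q x \<Longrightarrow> red r y \<Longrightarrow> red (q - r) (x - y)"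
  and red_mul: "red q x \<Longrightarrow> red r y \<Longrightarrow> red (q \<odot> r) (zorn_mult x y)"
  and red_conj: "red q x \<Longrightarrow> red (oct_conj q) (zorn_cnj x)"
  and red_one: "red (oct_e 0) zorn_one"
  and red_gens: "red (oct_a line1) (zo gen1)" "red (oct_a line2) (zo gen2)" "red (oct_a line3) (zo gen3)"
  using R.span_add[of "(q, x)" _ "(r, y)"] R.span_diff[of "(q, x)" _ "(r, y)"] R.W_mul[of "(q, x)" "(r, y)"]
    R.W_cnj[of "(q, x)"] R.W_words by (simp_all del: split_paired_All)

lemma red_cases:
  assumes "red q x"
  obtains z :: "nat \<Rightarrow> int" where "q = octonion.comb8 (oct_a line1) (oct_a line2) (oct_a line3) (\<lambda>i. of_int (z i))"
    "x = zorn.comb8 (zo gen1) (zo gen2) (zo gen3) (\<lambda>i. of_int (z i))"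
proof -
  obtain z where "(q, x) = R.comb8 (oct_a line1, zo gen1) (oct_a line2, zo gen2) (oct_a line3, zo gen3) z"
    using assms R.span_words_subset by blast
  then show ?thesis by (intro that[of z]) (simp_all add: R.comb8_def octonion.comb8_def zorn.comb8_def)
qed

text \<open>The inverse of the change from words to coordinates. It makes coefficients unique, and
  for a scalar octonion \<open>z 0\<close> is the scalar itself.\<close>

lemma oct_comb_coords:
  assumes q: "q = octonion.comb8 (oct_a line1) (oct_a line2) (oct_a line3) z"
  shows "z 0 = q $ 0 - q $ 2 - q $ 3 - q $ 4" "z 1 = q $ 1 + q $ 2 + q $ 3 - q $ 6" "z 2 = q $ 2 + q $ 3 + q $ 6 - q $ 1"
    "z 3 = 2 * q $ 4" "z 4 = q $ 7 - q $ 2 - q $ 3 - q $ 5" "z 5 = q $ 5 + q $ 6 - q $ 2 - q $ 4"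
    "z 6 = q $ 7 - q $ 3 - q $ 4 - q $ 6" "z 7 = q $ 1 + q $ 2 + q $ 4 - q $ 7"
  unfolding q octonion.comb8_def
  by (simp_all add: line1_def line2_def line3_def oct_a_oct oct_e_oct field_simps)

lemma of_int_bit: "(of_int j :: bit) = of_bool (odd j)"
proof (cases "even j")
  case True
  then obtain k where "j = 2 * k" by blast
  then show ?thesis by simp
next
  case False
  then obtain k where "j = 2 * k + 1" by (rule oddE)
  then show ?thesis by (simp del: add_bit_eq_xor)
qed

lemma zorn_scale_zo: "zorn_scale (of_int j) (zo w) = zo (bpick (odd j) w)"
  by (cases "odd j"; cases w rule: zo.cases) (simp_all add: of_int_bit bpick_def vec_eq_iff forall_3 vector_3)

text \<open>Reduction is single valued because the words are independent over the complex
  numbers.\<close>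

lemma red_zero_left: "red 0 x \<Longrightarrow> x = 0"
proof (erule red_cases)
  fix z :: "nat \<Rightarrow> int"
  assume q: "0 = octonion.comb8 (oct_a line1) (oct_a line2) (oct_a line3) (\<lambda>i. of_int (z i))"
    and x: "x = zorn.comb8 (zo gen1) (zo gen2) (zo gen3) (\<lambda>i. of_int (z i))"
  have "z 0 = 0" "z 1 = 0" "z 2 = 0" "z 3 = 0" "z 4 = 0" "z 5 = 0" "z 6 = 0" "z 7 = 0"
    using oct_comb_coords[OF q] by simp_all
  then show "x = 0" by (simp add: x zorn.comb8_def)
qed

text \<open>The kernel of the reduction is twice the lattice, because the words stay independent
  modulo 2.\<close>

lemma red_zero_right:
  assumes "red q 0" shows "\<exists>r y. red r y \<and> q = 2 *s r"
proof -
  obtain z :: "nat \<Rightarrow> int" where q: "q = octonion.comb8 (oct_a line1) (oct_a line2) (oct_a line3) (\<lambda>i. of_int (z i))"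
    and x: "0 = zorn.comb8 (zo gen1) (zo gen2) (zo gen3) (\<lambda>i. of_int (z i))" using red_cases[OF assms] by blast
  let ?b = "(odd (z 0), odd (z 1), odd (z 2), odd (z 3), odd (z 4), odd (z 5), odd (z 6), odd (z 7))"
  have "zo (bpick False bone) = 0" by (simp add: bpick_def zero_prod_def vec_eq_iff forall_3 vector_3)
  also have "\<dots> = zo (bcomb ?b)"
    unfolding x zorn.comb8_def bcomb_def by (simp add: zo_one zorn_scale_zo)
  finally have "bcomb ?b = bpick False bone" unfolding zo_inject by simp
  then have "?b = bpick False bone" using bwords_independent set_bits8 unfolding list_all_iff by blast
  then have ev: "even (z 0)" "even (z 1)" "even (z 2)" "even (z 3)" "even (z 4)" "even (z 5)" "even (z 6)" "even (z 7)"
    by (simp_all add: bpick_def)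
  define p where "p = R.comb8 (oct_a line1, zo gen1) (oct_a line2, zo gen2) (oct_a line3, zo gen3) (\<lambda>i. z i div 2)"
  have "p \<in> R.W" unfolding p_def R.comb8_def by (intro R.span_add R.span_scale R.W_words)
  moreover have "of_int (z i) = 2 * (of_int (z i div 2) :: complex)" if "even (z i)" for i
    using that by (metis dvd_mult_div_cancel of_int_mult of_int_numeral)
  then have "q = 2 *s fst p"
    unfolding q p_def octonion.comb8_def R.comb8_def using ev by (simp add: vec.scale_right_distrib)
  ultimately show ?thesis by (intro exI[of _ "fst p"] exI[of _ "snd p"]) simp
qed

lemma red_surj: "\<exists>q. red q x"
proof -
  obtain y where y: "x = zo y" by (rule zorn_cases)
  define E where "E = {y. \<exists>q. red q (zo y)}"
  have add: "badd x y \<in> E" if xy: "x \<in> E" "y \<in> E" for x y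
  proof -
    obtain q r where "red q (zo x)" "red r (zo y)" using xy unfolding E_def by blast
    from red_add[OF this] show ?thesis unfolding E_def zo_add by blast
  qed
  have mul: "bmul x y \<in> E" if xy: "x \<in> E" "y \<in> E" for x y
  proof -
    obtain q r where "red q (zo x)" "red r (zo y)" using xy unfolding E_def by blast
    from red_mul[OF this] show ?thesis unfolding E_def zo_mul by blast
  qed
  have "bone \<in> E" "gen1 \<in> E" "gen2 \<in> E" "gen3 \<in> E" using red_one red_gens unfolding E_def zo_one by blast+
  then have "set bwords \<subseteq> E" by (simp add: bwords_def mul)
  then have "y \<in> E" using add bwords_closure by blast
  then show ?thesis unfolding E_def y by blast
qed

text \<open>The norm times the unit is \<open>q \<odot> oct_conj q\<close>, again an element of the
  lattice, and its coefficient at the unit is an integer. Definiteness holds because lattice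
  elements have real coordinates.\<close>

lemma red_norm:
  assumes "red q x"
  shows "oct_n q \<in> \<int>" "0 \<le> Re (oct_n q)" "oct_n q = 0 \<Longrightarrow> q = 0"
proof -
  have coord: "\<forall>i. q $ i \<in> \<real>" if r: "red q x" for q x
  proof -
    obtain z :: "nat \<Rightarrow> int" where "q = octonion.comb8 (oct_a line1) (oct_a line2) (oct_a line3) (\<lambda>i. of_int (z i))"
      using red_cases[OF r] by blast
    then show ?thesis unfolding forall_8 octonion.comb8_def
      by (simp add: line1_def line2_def line3_def oct_a_oct oct_e_oct)
  qed
  define u where "u i = Re (q $ i)" for i
  have u: "q $ i = of_real (u i)" for i using coord[OF assms] by (simp add: u_def)
  have n: "oct_n q = of_real ((u 0)\<^sup>2 + (u 1)\<^sup>2 + (u 2)\<^sup>2 + (u 3)\<^sup>2 + (u 4)\<^sup>2 + (u 5)\<^sup>2 + (u 6)\<^sup>2 + (u 7)\<^sup>2)"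
    by (simp add: oct_n_def oct_form_alt u power2_eq_square)
  then show "0 \<le> Re (oct_n q)" by simp
  show "q = 0" if "oct_n q = 0"
  proof -
    have "(u 0)\<^sup>2 + (u 1)\<^sup>2 + (u 2)\<^sup>2 + (u 3)\<^sup>2 + (u 4)\<^sup>2 + (u 5)\<^sup>2 + (u 6)\<^sup>2 + (u 7)\<^sup>2 = 0"
      using that unfolding n of_real_eq_0_iff .
    then have "\<forall>i. u i = 0" unfolding forall_8 by (simp add: add_nonneg_eq_0_iff)
    then show ?thesis by (simp add: vec_eq_iff u)
  qed
  have "red (oct_n q *s oct_e 0) (zorn_mult x (zorn_cnj x))"
    using red_mul[OF assms red_conj[OF assms]] unfolding oct_mul_conj .
  then obtain z :: "nat \<Rightarrow> int" where "oct_n q *s oct_e 0 = octonion.comb8 (oct_a line1) (oct_a line2) (oct_a line3) (\<lambda>i. of_int (z i))"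
    using red_cases by blast
  from oct_comb_coords(1)[OF this] have "oct_n q = of_int (z 0)" by (simp add: oct_e_def axis_def)
  then show "oct_n q \<in> \<int>" by simp
qed

text \<open>Congruent elements of norm 1 are equal or opposite, because half of their difference is integral
  of norm at most 1.\<close>

lemma red_unique:
  assumes p: "red p x" "oct_n p = 1" and q: "red q x" "oct_n q = 1"
  shows "q = p \<or> q = - p"
proof -
  have "red (p - q) 0" using red_diff[OF p(1) q(1)] by simp
  then obtain s y where s: "red s y" "p - q = 2 *s s" using red_zero_right by blast
  have q': "q = p - 2 *s s" using s(2) by (simp add: algebra_simps)
  have f: "oct_n (p - c *s s) = oct_n p - 2 * c * oct_form p s + c^2 * oct_n s" for c
    by (simp add: oct_n_def oct_form_alt power2_eq_square algebra_simps)
  have "oct_form p s = oct_n s" using f[of 2] p(2) q(2) unfolding q' by simp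
  then have ps: "oct_n (p - s) = 1 - oct_n s" using f[of 1] p(2) by simp
  obtain k where k: "oct_n s = of_int k" using red_norm(1)[OF s(1)] by (rule Ints_cases)
  have "0 \<le> k" using red_norm(2)[OF s(1)] k by simp
  moreover have "k \<le> 1" using red_norm(2)[OF red_diff[OF p(1) s(1)]] ps k by simp
  ultimately consider "k = 0" | "k = 1" by linarith
  then show ?thesis
  proof cases
    case 1
    then have "s = 0" using red_norm(3)[OF s(1)] k by simp
    then show ?thesis using q' by simp
  next
    case 2
    then have "p - s = 0" using red_norm(3)[OF red_diff[OF p(1) s(1)]] ps k by simp
    then show ?thesis using q' by (simp add: vec_eq_iff)
  qed
qed

section \<open>Comparison of the line group with its reduction\<close>

abbreviation line_gens :: "(octonion \<Rightarrow> octonion) set" where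
  "line_gens \<equiv> {oct_T (oct_a line1), oct_T (oct_a line2), oct_T (oct_a line3)}"

lemma line_group_eq: "line_group = generate G2_C line_gens"
  by (simp add: line_group_def)

lemma line_gens_G2C: "line_gens \<subseteq> carrier G2_C"
  using oct_T_G2C line_norm3 by blast

lemma subgroup_line_group: "subgroup line_group G2_C"
  unfolding line_group_eq by (rule G2C.generate_is_subgroup[OF line_gens_G2C])

text \<open>A relation instead of a function, so that counterparts can be built by induction over
  the generators from either side.\<close>

definition red_map :: "(octonion \<Rightarrow> octonion) \<Rightarrow> (bit zorn \<Rightarrow> bit zorn) \<Rightarrow> bool" where
  "red_map f g \<longleftrightarrow> (\<forall>q x. red q x \<longrightarrow> red (f q) (g x))"

lemma red_map_comp: "red_map f g \<Longrightarrow> red_map f' g' \<Longrightarrow> red_map (f \<circ> f') (g \<circ> g')"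
  by (simp add: red_map_def)

lemma red_map_conjugation:
  assumes "red a w" shows "red_map (octonion.conjugation a) (zorn.conjugation w)"
  unfolding red_map_def octonion.conjugation_def zorn.conjugation_def
  by (intro allI impI red_mul red_diff red_one assms)

lemma red_map_gens:
  assumes "(v, w) \<in> {(line1, zo gen1), (line2, zo gen2), (line3, zo gen3)}"
  shows "red_map (oct_T (oct_a v)) (zorn.conjugation w)"
    "red_map (inv\<^bsub>G2_C\<^esub> (oct_T (oct_a v))) (inv\<^bsub>G2_F2\<^esub> (zorn.conjugation w))"
proof -
  have v: "v \<in> norm3_vectors" and w: "w \<in> zorn_units" and r: "red (oct_a v) w"
    using assms line_norm3 zo_g_units red_gens by auto
  show "red_map (oct_T (oct_a v)) (zorn.conjugation w)"
    unfolding oct_T_eq[OF v] by (rule red_map_conjugation[OF r])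
  have "inv\<^bsub>G2_C\<^esub> (oct_T (oct_a v)) = octonion.conjugation (oct_e 0 - oct_a v)"
    unfolding oct_T_inv[OF v] oct_T_eq[OF oct_norm3_minus(1)[OF v]]
    unfolding oct_norm3_minus(2) ..
  then show "red_map (inv\<^bsub>G2_C\<^esub> (oct_T (oct_a v))) (inv\<^bsub>G2_F2\<^esub> (zorn.conjugation w))"
    unfolding zorn_conj_inv[OF w] by (simp add: red_map_conjugation red_diff red_one r)
qed

lemma line_group_red:
  assumes "f \<in> line_group" shows "\<exists>g\<in>unit_group. red_map f g"
  using assms unfolding line_group_eq
proof (induction rule: generate.induct)
  case one
  then show ?case using unit_group_id by (intro bexI[of _ id]) (simp_all add: red_map_def)
next
  case (incl f)
  then obtain v w where vw: "(v, w) \<in> {(line1, zo gen1), (line2, zo gen2), (line3, zo gen3)}" "f = oct_T (oct_a v)" by blast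
  then have "w \<in> zorn_units" using zo_g_units by blast
  then show ?case using red_map_gens(1)[OF vw(1)] conj_in_unit_group unfolding vw(2) by blast
next
  case (inv f)
  then obtain v w where vw: "(v, w) \<in> {(line1, zo gen1), (line2, zo gen2), (line3, zo gen3)}" "f = oct_T (oct_a v)" by blast
  then have "w \<in> zorn_units" using zo_g_units by blast
  then show ?case
    using red_map_gens(2)[OF vw(1)] unit_group_inv[OF conj_in_unit_group] unfolding vw(2) by blast
next
  case (eng f f')
  then show ?case unfolding mult_algebra_aut using red_map_comp unit_group_comp by blast
qed

lemma unit_group_red:
  assumes "g \<in> unit_group" shows "\<exists>f\<in>line_group. red_map f g"
  using assms unfolding unit_group_def
proof (induction rule: generate.induct)
  case one
  show ?case using subgroup.one_closed[OF subgroup_line_group]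
    by (intro bexI[of _ id]) (simp_all add: red_map_def)
next
  case (incl g)
  then obtain v w where vw: "(v, w) \<in> {(line1, zo gen1), (line2, zo gen2), (line3, zo gen3)}" "g = zorn.conjugation w" by blast
  have "oct_T (oct_a v) \<in> line_group" using vw(1) unfolding line_group_eq by (intro generate.incl) blast
  then show ?case using red_map_gens(1)[OF vw(1)] unfolding vw(2) by blast
next
  case (inv g)
  then obtain v w where vw: "(v, w) \<in> {(line1, zo gen1), (line2, zo gen2), (line3, zo gen3)}" "g = zorn.conjugation w" by blast
  have "inv\<^bsub>G2_C\<^esub> (oct_T (oct_a v)) \<in> line_group" using vw(1) unfolding line_group_eq by (intro generate.inv) blast
  then show ?case using red_map_gens(2)[OF vw(1)] unfolding vw(2) by blast
next
  case (eng g g')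
  then show ?case unfolding mult_algebra_aut
    using red_map_comp subgroup.m_closed[OF subgroup_line_group] by (metis mult_algebra_aut)
qed

text \<open>Every element of the Zorn algebra has a lift, and reduction is single valued.\<close>

lemma red_map_unique_right:
  assumes "red_map f g" "red_map f g'" shows "g = g'"
proof
  fix x
  obtain q where "red q x" using red_surj by blast
  then have "red (f q - f q) (g x - g' x)" using assms unfolding red_map_def by (intro red_diff) blast+
  then have "red 0 (g x - g' x)" by (simp only: diff_self)
  then have "g x - g' x = 0" by (rule red_zero_left)
  then show "g x = g' x" unfolding right_minus_eq .
qed

lemma G2C_eq_lines:
  assumes f: "f \<in> carrier G2_C" and g: "g \<in> carrier G2_C"
    and eq: "f (oct_a line1) = g (oct_a line1)" "f (oct_a line2) = g (oct_a line2)" "f (oct_a line3) = g (oct_a line3)"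
  shows "f = g"
proof -
  let ?E = "{x. f x = g x}"
  have "vec.subspace ?E"
    using G2C_linear(1,3)[OF f] G2C_linear(1,3)[OF g] G2C_linear(2)[OF f, of 0 0] G2C_linear(2)[OF g, of 0 0]
    by (intro vec.subspaceI) simp_all
  moreover have "set (octonion.words (oct_a line1) (oct_a line2) (oct_a line3)) \<subseteq> ?E"
    using eq by (intro octonion.words_subset) (simp_all add: G2C_mul[OF f] G2C_mul[OF g] G2C_one[OF f] G2C_one[OF g])
  ultimately have "vec.span (set (octonion.words (oct_a line1) (oct_a line2) (oct_a line3))) \<subseteq> ?E"
    by (rule vec.span_minimal[rotated])
  then show ?thesis using spanning_lines by auto
qed

text \<open>On the three generators both images have norm 1 and the same reduction, so they agree up
  to sign. Automorphisms preserve the trace 1/2, which rules out the opposite sign.\<close>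

lemma red_map_unique_left:
  assumes f: "f \<in> carrier G2_C" "red_map f g" and f': "f' \<in> carrier G2_C" "red_map f' g"
  shows "f = f'"
proof -
  have "f (oct_a v) = f' (oct_a v)" if v: "v \<in> {line1, line2, line3}" for v
  proof -
    obtain w where w: "red (oct_a v) w" using v red_gens by blast
    have n: "oct_n (oct_a v) = 1" and t: "oct_tr (oct_a v) = 1 / 2"
      using v by (auto simp: line1_def line2_def line3_def oct_a_oct oct_n_def)
    have "f' (oct_a v) = f (oct_a v) \<or> f' (oct_a v) = - f (oct_a v)"
    proof (rule red_unique)
      show "red (f (oct_a v)) (g w)" "red (f' (oct_a v)) (g w)" using f(2) f'(2) w by (auto simp: red_map_def)
      show "oct_n (f (oct_a v)) = 1" "oct_n (f' (oct_a v)) = 1"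
        using n by (simp_all add: oct_n_def G2C_form[OF f(1)] G2C_form[OF f'(1)])
    qed
    moreover have "f' (oct_a v) \<noteq> - f (oct_a v)"
    proof
      assume "f' (oct_a v) = - f (oct_a v)"
      then have "oct_tr (f' (oct_a v)) = - oct_tr (f (oct_a v))" by simp
      then show False by (simp add: G2C_tr[OF f(1)] G2C_tr[OF f'(1)] t)
    qed
    ultimately show ?thesis by simp
  qed
  then show ?thesis by (intro G2C_eq_lines f(1) f'(1)) simp_all
qed

text \<open>Counterparts exist in both directions and are unique on both sides, which makes the
  choice \<open>F\<close> a bijective homomorphism.\<close>

lemma line_group_iso: "G2_C\<lparr>carrier := line_group\<rparr> \<cong> G2_F2_derived"
proof -
  define F where "F f = (SOME g. g \<in> unit_group \<and> red_map f g)" for f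
  have F: "F f \<in> unit_group" "red_map f (F f)" if "f \<in> line_group" for f
    using someI_ex[of "\<lambda>g. g \<in> unit_group \<and> red_map f g"] line_group_red[OF that] unfolding F_def by blast+
  have "F \<in> iso (G2_C\<lparr>carrier := line_group\<rparr>) (G2_F2\<lparr>carrier := unit_group\<rparr>)"
  proof (rule isoI)
    show "F \<in> hom (G2_C\<lparr>carrier := line_group\<rparr>) (G2_F2\<lparr>carrier := unit_group\<rparr>)"
    proof (rule homI)
      fix f f' assume "f \<in> carrier (G2_C\<lparr>carrier := line_group\<rparr>)" "f' \<in> carrier (G2_C\<lparr>carrier := line_group\<rparr>)"
      then have ff': "f \<in> line_group" "f' \<in> line_group" by simp_all
      then have "f \<circ> f' \<in> line_group" using subgroup.m_closed[OF subgroup_line_group] by (metis mult_algebra_aut)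
      then have "F (f \<circ> f') = F f \<circ> F f'"
        using red_map_unique_right[OF F(2) red_map_comp[OF F(2) F(2)]] ff' by blast
      then show "F (f \<otimes>\<^bsub>G2_C\<lparr>carrier := line_group\<rparr>\<^esub> f') = F f \<otimes>\<^bsub>G2_F2\<lparr>carrier := unit_group\<rparr>\<^esub> F f'" by simp
    qed (simp add: F)
    show "bij_betw F (carrier (G2_C\<lparr>carrier := line_group\<rparr>)) (carrier (G2_F2\<lparr>carrier := unit_group\<rparr>))"
      unfolding bij_betw_def
    proof
      show "inj_on F (carrier (G2_C\<lparr>carrier := line_group\<rparr>))"
      proof (rule inj_onI, simp)
        fix f f' assume ff': "f \<in> line_group" "f' \<in> line_group" and eq: "F f = F f'"
        show "f = f'"
          using red_map_unique_left[of f "F f'" f'] F(2)[OF ff'(1)] F(2)[OF ff'(2)] eq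
            subgroup.mem_carrier[OF subgroup_line_group] ff' by simp
      qed
      show "F ` carrier (G2_C\<lparr>carrier := line_group\<rparr>) = carrier (G2_F2\<lparr>carrier := unit_group\<rparr>)"
      proof (simp, intro equalityI subsetI)
        fix g assume "g \<in> unit_group"
        then obtain f where f: "f \<in> line_group" "red_map f g" using unit_group_red by blast
        then have "F f = g" using red_map_unique_right F(2) by blast
        then show "g \<in> F ` line_group" using f(1) by blast
      next
        fix g assume "g \<in> F ` line_group"
        then show "g \<in> unit_group" using F(1) by blast
      qed
    qed
  qed
  then show ?thesis unfolding G2_F2_derived_def derived_G2_F2 by (rule is_isoI)
qed

lemma (in group) conj_generate:
  assumes S: "S \<subseteq> carrier G" and h: "h \<in> carrier G"
  shows "G\<lparr>carrier := generate G ((\<lambda>g. h \<otimes> g \<otimes> inv h) ` S)\<rparr> \<cong> G\<lparr>carrier := generate G S\<rparr>"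
proof -
  let ?c = "\<lambda>g. h \<otimes> g \<otimes> inv h"
  interpret c: group_hom G G ?c
    by (intro group_hom.intro group_hom_axioms.intro homI is_group) (simp_all add: h m_assoc inv_solve_left)
  have img: "?c ` generate G S = generate G (?c ` S)" by (rule c.generate_img[OF S, symmetric])
  have inj: "inj_on ?c (generate G S)"
  proof (rule inj_onI)
    fix x y assume "x \<in> generate G S" "y \<in> generate G S" "?c x = ?c y"
    moreover from this have "x \<in> carrier G" "y \<in> carrier G" using generate_incl[OF S] by blast+
    ultimately show "x = y" using h by simp
  qed
  have "?c \<in> iso (G\<lparr>carrier := generate G S\<rparr>) (G\<lparr>carrier := generate G (?c ` S)\<rparr>)"
  proof (rule isoI)
    show "?c \<in> hom (G\<lparr>carrier := generate G S\<rparr>) (G\<lparr>carrier := generate G (?c ` S)\<rparr>)"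
      using img generate_in_carrier[OF S] c.hom_mult by (intro homI) auto
    show "bij_betw ?c (carrier (G\<lparr>carrier := generate G S\<rparr>)) (carrier (G\<lparr>carrier := generate G (?c ` S)\<rparr>))"
      using inj img by (simp add: bij_betw_def)
  qed
  then show ?thesis
    by (intro group.iso_sym[OF subgroup_imp_group[OF generate_is_subgroup[OF S]]] is_isoI)
qed

lemma klein_triples_zero_iso:
  assumes "t \<in> klein_triples (0, 0, 0)"
  shows "G2_C\<lparr>carrier := generated_group t\<rparr> \<cong> G2_F2_derived"
proof -
  have "t \<in> triple_class (vector_triple (line1, line2, line3))"
    using assms unfolding klein_triples_eq_class[OF spanning_lines] .
  then obtain h where h: "h \<in> carrier G2_C" "t = conj_triple h (vector_triple (line1, line2, line3))"
    unfolding triple_class_def by blast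
  have "generated_group t = generate G2_C ((\<lambda>g. h \<otimes>\<^bsub>G2_C\<^esub> g \<otimes>\<^bsub>G2_C\<^esub> inv\<^bsub>G2_C\<^esub> h) ` line_gens)"
    unfolding h(2) by (simp only: vector_triple.simps conj_triple.simps generated_group.simps image_insert image_empty)
  then have "G2_C\<lparr>carrier := generated_group t\<rparr> \<cong> G2_C\<lparr>carrier := line_group\<rparr>"
    using G2C.conj_generate[OF line_gens_G2C h(1)] unfolding line_group_eq by simp
  then show ?thesis using line_group_iso by (rule iso_trans)
qed

section \<open>The braid orbit on the Klein surface\<close>

definition mat2 :: "complex \<Rightarrow> complex \<Rightarrow> complex \<Rightarrow> complex \<Rightarrow> complex ^ 2 ^ 2" where
  "mat2 a b c d = vector [vector [a, b], vector [c, d]]"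

lemma mat2_cases: obtains a b c d where "A = mat2 a b c d"
proof
  show "A = mat2 (A $ 1 $ 1) (A $ 1 $ 2) (A $ 2 $ 1) (A $ 2 $ 2)"
    by (simp add: mat2_def vec_eq_iff forall_2)
qed

lemma mat2_simps [simp]:
  "mat2 a b c d ** mat2 a' b' c' d' = mat2 (a*a' + b*c') (a*b' + b*d') (c*a' + d*c') (c*b' + d*d')"
  "trace (mat2 a b c d) = a + d" "det (mat2 a b c d) = a * d - b * c" "mat 1 = mat2 1 0 0 1"
  "mat2 a b c d = mat2 a' b' c' d' \<longleftrightarrow> a = a' \<and> b = b' \<and> c = c' \<and> d = d'"
  by (auto simp: mat2_def vec_eq_iff forall_2 matrix_matrix_mult_def sum_2 trace_def det_2 mat_def)

definition adj2 :: "complex ^ 2 ^ 2 \<Rightarrow> complex ^ 2 ^ 2" where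
  "adj2 A = mat2 (A $ 2 $ 2) (- A $ 1 $ 2) (- A $ 2 $ 1) (A $ 1 $ 1)"

lemma adj2_mat2 [simp]: "adj2 (mat2 a b c d) = mat2 d (- b) (- c) a"
  by (simp add: adj2_def mat2_def)

lemma SL2_simps [simp]: "A \<in> carrier SL2_C \<longleftrightarrow> det A = 1" "A \<otimes>\<^bsub>SL2_C\<^esub> B = A ** B" "\<one>\<^bsub>SL2_C\<^esub> = mat 1"
  by (simp_all add: SL2_C_def)

lemma adj2:
  assumes "det A = 1" shows "adj2 A ** A = mat 1" "A ** adj2 A = mat 1" "det (adj2 A) = 1"
  using assms by (cases A rule: mat2_cases; simp add: algebra_simps)+

interpretation SL2: group SL2_C
proof (rule groupI)
  fix A assume "A \<in> carrier SL2_C"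
  then show "\<exists>B\<in>carrier SL2_C. B \<otimes>\<^bsub>SL2_C\<^esub> A = \<one>\<^bsub>SL2_C\<^esub>" using adj2 by (intro bexI[of _ "adj2 A"]) auto
qed (simp_all add: det_mul matrix_mul_assoc del: mat2_simps(4))

lemma SL2_inv: "det A = 1 \<Longrightarrow> inv\<^bsub>SL2_C\<^esub> A = adj2 A"
  using adj2 by (intro SL2.inv_equality) auto

text \<open>A consequence of the Cayley-Hamilton theorem. With \<open>adj2 B\<close> as inverse of
  \<open>B\<close> in the special linear group, it makes the braid action polynomial in the trace
  coordinates.\<close>

lemma trace_conj_mult:
  "trace (adj2 B ** A ** B ** C) = trace B * trace (A ** B ** C) - trace (B ** C) * trace (A ** B)
     + det B * (trace A * trace C - trace (A ** C))"
  by (cases A rule: mat2_cases; cases B rule: mat2_cases; cases C rule: mat2_cases) (simp add: algebra_simps)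

lemma trace_mult_cyclic: "trace (A ** B) = trace (B ** A)" for A B :: "complex ^ 2 ^ 2"
  by (cases A rule: mat2_cases; cases B rule: mat2_cases) (simp add: algebra_simps)

lemma trace_conj: "det B = 1 \<Longrightarrow> trace (adj2 B ** A ** B) = trace A"
  by (metis adj2(2) matrix_mul_assoc matrix_mul_rid trace_mult_cyclic)

abbreviation c7 :: complex where "c7 \<equiv> complex_of_real (2 * cos (2 * pi / 7))"

text \<open>For t = 2 pi / 7 one has cos (4 t) = cos (3 t). In terms of \<open>c\<close> this is a
  quartic equation with the spurious root 2, and removing the factor \<open>c - 2\<close> leaves the
  cubic.\<close>

lemma cos7_minpoly:
  defines "c \<equiv> 2 * cos (2 * pi / 7)"
  shows "c ^ 3 + c\<^sup>2 - 2 * c - 1 = 0" "2 * cos (4 * pi / 7) = c\<^sup>2 - 2"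
proof -
  let ?t = "2 * pi / 7"
  have 2: "2 * cos (2 * ?t) = c\<^sup>2 - 2"
    unfolding cos_double_cos c_def by (simp add: power_mult_distrib)
  show "2 * cos (4 * pi / 7) = c\<^sup>2 - 2" using 2 by simp
  have 3: "2 * cos (3 * ?t) = c ^ 3 - 3 * c"
    unfolding cos_treble_cos c_def by (simp add: power_mult_distrib)
  have 4: "2 * cos (4 * ?t) = (c\<^sup>2 - 2)\<^sup>2 - 2"
  proof -
    have "2 * cos (4 * ?t) = (2 * cos (2 * ?t))\<^sup>2 - 2"
      using cos_double_cos[of "2 * ?t"] by (simp add: power_mult_distrib)
    then show ?thesis unfolding 2 .
  qed
  have "cos (4 * ?t) = cos (2 * pi - 3 * ?t)" by (rule arg_cong[of _ _ cos]) (simp add: field_simps)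
  also have "\<dots> = cos (3 * ?t)" by (rule cos_2pi_minus)
  finally have "(c\<^sup>2 - 2)\<^sup>2 - 2 = c ^ 3 - 3 * c" using 3 4 by simp
  then have "(c - 2) * (c ^ 3 + c\<^sup>2 - 2 * c - 1) = 0" by algebra
  moreover have "cos ?t < cos 0" by (rule cos_monotone_0_pi) (auto simp: field_simps)
  then have "c \<noteq> 2" by (simp add: c_def)
  ultimately show "c ^ 3 + c\<^sup>2 - 2 * c - 1 = 0" by simp
qed

lemma c7_minpoly: "c7 ^ 3 + c7\<^sup>2 - 2 * c7 - 1 = 0" and c7_double: "complex_of_real (2 * cos (4 * pi / 7)) = c7\<^sup>2 - 2"
proof -
  have "complex_of_real ((2 * cos (2 * pi / 7)) ^ 3 + (2 * cos (2 * pi / 7))\<^sup>2 - 2 * (2 * cos (2 * pi / 7)) - 1) = 0"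
    unfolding cos7_minpoly(1) by simp
  then show "c7 ^ 3 + c7\<^sup>2 - 2 * c7 - 1 = 0" by (simp only: of_real_add of_real_diff of_real_power of_real_mult of_real_numeral of_real_1)
  show "complex_of_real (2 * cos (4 * pi / 7)) = c7\<^sup>2 - 2"
    unfolding cos7_minpoly(2) by simp
qed

section \<open>The braid action in trace coordinates\<close>

lemma klein_sl2_iff: "(A, B, C) \<in> klein_sl2_triples \<longleftrightarrow> det A = 1 \<and> det B = 1 \<and> det C = 1 \<and>
    trace A = c7 \<and> trace B = c7 \<and> trace C = c7 \<and> trace (A ** B ** C) = c7\<^sup>2 - 2"
  unfolding klein_sl2_triples_def c7_double by simp

text \<open>The constant 1 is the contribution \<open>c7 * (c7^2 - 2) + c7^2\<close> of the fixed
  traces, evaluated by the minimal polynomial of \<open>c7\<close>.\<close>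

fun klein_move1 :: "complex \<times> complex \<times> complex \<Rightarrow> complex \<times> complex \<times> complex" where
  "klein_move1 (x, y, z) = (1 - y - x * z, x, z)"

fun klein_move2 :: "complex \<times> complex \<times> complex \<Rightarrow> complex \<times> complex \<times> complex" where
  "klein_move2 (x, y, z) = (x, 1 - z - x * y, y)"

lemma braid1_SL2:
  assumes "A \<in> carrier SL2_C" "B \<in> carrier SL2_C" "C \<in> carrier SL2_C"
  shows "braid1 SL2_C (A, B, C) \<in> klein_sl2_triples \<longleftrightarrow> (A, B, C) \<in> klein_sl2_triples"
    "(A, B, C) \<in> klein_sl2_triples \<Longrightarrow> sl2_coords (braid1 SL2_C (A, B, C)) = klein_move1 (sl2_coords (A, B, C))"
proof -
  have d: "det A = 1" "det B = 1" "det C = 1" using assms by simp_all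
  have b: "braid1 SL2_C (A, B, C) = (B, adj2 B ** A ** B, C)" using d by (simp add: SL2_inv)
  have BA: "B ** (adj2 B ** A ** B) = A ** B" using adj2(2)[OF d(2)] by (metis matrix_mul_assoc matrix_mul_lid)
  show "braid1 SL2_C (A, B, C) \<in> klein_sl2_triples \<longleftrightarrow> (A, B, C) \<in> klein_sl2_triples"
    unfolding b klein_sl2_iff BA trace_conj[OF d(2)] by (auto simp: det_mul d adj2)
  assume "(A, B, C) \<in> klein_sl2_triples"
  then have t: "trace A = c7" "trace B = c7" "trace C = c7" "trace (A ** B ** C) = c7\<^sup>2 - 2"
    unfolding klein_sl2_iff by blast+
  have "trace (adj2 B ** A ** B ** C) = 1 - trace (A ** C) - trace (B ** C) * trace (A ** B)"
    unfolding trace_conj_mult t d using c7_minpoly by algebra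
  then show "sl2_coords (braid1 SL2_C (A, B, C)) = klein_move1 (sl2_coords (A, B, C))"
    unfolding b by (simp add: BA)
qed

lemma braid2_SL2:
  assumes "A \<in> carrier SL2_C" "B \<in> carrier SL2_C" "C \<in> carrier SL2_C"
  shows "braid2 SL2_C (A, B, C) \<in> klein_sl2_triples \<longleftrightarrow> (A, B, C) \<in> klein_sl2_triples"
    "(A, B, C) \<in> klein_sl2_triples \<Longrightarrow> sl2_coords (braid2 SL2_C (A, B, C)) = klein_move2 (sl2_coords (A, B, C))"
proof -
  have d: "det A = 1" "det B = 1" "det C = 1" using assms by simp_all
  have b: "braid2 SL2_C (A, B, C) = (A, C, adj2 C ** B ** C)" using d by (simp add: SL2_inv)
  have CB: "C ** (adj2 C ** B ** C) = B ** C" using adj2(2)[OF d(3)] by (metis matrix_mul_assoc matrix_mul_lid)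
  have ACB: "A ** C ** (adj2 C ** B ** C) = A ** B ** C" using CB by (metis matrix_mul_assoc)
  show "braid2 SL2_C (A, B, C) \<in> klein_sl2_triples \<longleftrightarrow> (A, B, C) \<in> klein_sl2_triples"
    unfolding b klein_sl2_iff ACB trace_conj[OF d(3)] by (auto simp: det_mul d adj2)
  assume "(A, B, C) \<in> klein_sl2_triples"
  then have t: "trace A = c7" "trace B = c7" "trace C = c7" "trace (A ** B ** C) = c7\<^sup>2 - 2"
    unfolding klein_sl2_iff by blast+
  have "trace (A ** (adj2 C ** B ** C)) = trace (adj2 C ** B ** C ** A)" by (rule trace_mult_cyclic)
  also have "\<dots> = trace C * trace (B ** C ** A) - trace (C ** A) * trace (B ** C)
      + det C * (trace B * trace A - trace (B ** A))" by (rule trace_conj_mult)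
  also have "trace (B ** C ** A) = trace (A ** B ** C)" by (metis matrix_mul_assoc trace_mult_cyclic)
  also have "trace (C ** A) = trace (A ** C)" by (rule trace_mult_cyclic)
  also have "trace (B ** A) = trace (A ** B)" by (rule trace_mult_cyclic)
  finally have "trace (A ** (adj2 C ** B ** C)) = 1 - trace (A ** B) - trace (B ** C) * trace (A ** C)"
    unfolding t d using c7_minpoly by algebra
  then show "sl2_coords (braid2 SL2_C (A, B, C)) = klein_move2 (sl2_coords (A, B, C))"
    unfolding b by (simp add: CB)
qed

abbreviation (input) klein_points :: "(complex \<times> complex \<times> complex) set" where
  "klein_points \<equiv> {(0,0,0), (0,0,1), (0,1,0), (1,0,0), (1,1,0), (1,0,1), (0,1,1)}"

text \<open>Equivalences are needed because chains in \<open>braid_orbit\<close> may traverse a move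
  backwards.\<close>

lemma klein_move_points: "klein_move1 P \<in> klein_points \<longleftrightarrow> P \<in> klein_points" "klein_move2 P \<in> klein_points \<longleftrightarrow> P \<in> klein_points"
proof -
  obtain x y z where P: "P = (x, y, z)" by (metis prod.exhaust)
  have h: "1 - w = 0 \<longleftrightarrow> w = 1" "1 - w = 1 \<longleftrightarrow> w = 0" for w :: complex by auto
  show "klein_move1 P \<in> klein_points \<longleftrightarrow> P \<in> klein_points"
    unfolding P klein_move1.simps by (cases "x = 0"; cases "x = 1"; cases "z = 0"; cases "z = 1"; simp add: h disj_commute)
  show "klein_move2 P \<in> klein_points \<longleftrightarrow> P \<in> klein_points"
    unfolding P klein_move2.simps by (cases "x = 0"; cases "x = 1"; cases "y = 0"; cases "y = 1"; simp add: h disj_commute)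
qed

text \<open>Entries of a third matrix completing two fixed ones to a triple over the origin. The two
  vanishing pair traces are linear and give t and u in terms of s. The determinant condition becomes
  (2 s - c)^2 = -(c^2 + 4), and by the cubic c^2 + 4 is the square of 2 c^2 + c - 2, which makes s
  explicit. The sign of the root is fixed by the triple trace.\<close>

lemma klein_sl2_entries:
  fixes c :: complex
  assumes c: "c ^ 3 + c\<^sup>2 - 2 * c - 1 = 0"
    and s: "2 * s = c + \<i> * (2 * c\<^sup>2 + c - 2)" and t: "2 * t = c * s * (1 + \<i>) - c\<^sup>2" and u: "2 * u = c\<^sup>2 + c * s * (\<i> - 1)"
  shows "s * (c - s) - t * u = 1" "- \<i> * s + (c + c * \<i>) * t + \<i> * (c - s) = c\<^sup>2 - 2"
    "c * s + \<i> * u + \<i> * t = 0" "- u + t + c * (c - s) = 0"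
proof -
  have i: "\<i> * \<i> = -1" by simp
  have "(2 * s - c) * (2 * s - c) = (\<i> * \<i>) * ((2 * c\<^sup>2 + c - 2) * (2 * c\<^sup>2 + c - 2))" using s by algebra
  also have "(2 * c\<^sup>2 + c - 2) * (2 * c\<^sup>2 + c - 2) = c\<^sup>2 + 4" using c by algebra
  finally have s2: "4 * (s * s) = 4 * c * s - 2 * c\<^sup>2 - 4" unfolding i by algebra
  have tu: "4 * (t * u) = 2 * c ^ 3 * s - 2 * c\<^sup>2 * (s * s) - c ^ 4"
  proof -
    have "4 * (t * u) = (c * s * (1 + \<i>) - c\<^sup>2) * (c\<^sup>2 + c * s * (\<i> - 1))" using t u by algebra
    then show ?thesis using i by algebra
  qed
  have "4 * (s * (c - s) - t * u) = 4 * 1" using s2 tu by algebra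
  then show "s * (c - s) - t * u = 1" unfolding mult_cancel_left by simp
  have "2 * (- \<i> * s + (c + c * \<i>) * t + \<i> * (c - s)) = - 4 * \<i> * s + c * (1 + \<i>) * (c * s * (1 + \<i>) - c\<^sup>2) + 2 * \<i> * c"
    using t by algebra
  also have "\<dots> = \<i> * (2 * s) * (c\<^sup>2 - 2) - c ^ 3 * (1 + \<i>) + 2 * \<i> * c" using i by algebra
  also have "\<dots> = 2 * (c\<^sup>2 - 2)" unfolding s using c i by algebra
  finally show "- \<i> * s + (c + c * \<i>) * t + \<i> * (c - s) = c\<^sup>2 - 2" unfolding mult_cancel_left by simp
  have "2 * (c * s + \<i> * u + \<i> * t) = 2 * 0" using t u i by algebra
  then show "c * s + \<i> * u + \<i> * t = 0" unfolding mult_cancel_left by simp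
  have "2 * (- u + t + c * (c - s)) = 2 * 0" using t u by algebra
  then show "- u + t + c * (c - s) = 0" unfolding mult_cancel_left by simp
qed

lemma klein_sl2_origin: "\<exists>M\<in>klein_sl2_triples. sl2_coords M = (0, 0, 0)"
proof -
  define s where "s = c7 / 2 + \<i> * (c7\<^sup>2 + c7 / 2 - 1)"
  define t where "t = (c7 * s * (1 + \<i>) - c7\<^sup>2) / 2"
  define u where "u = (c7\<^sup>2 + c7 * s * (\<i> - 1)) / 2"
  have st: "2 * s = c7 + \<i> * (2 * c7\<^sup>2 + c7 - 2)" "2 * t = c7 * s * (1 + \<i>) - c7\<^sup>2" "2 * u = c7\<^sup>2 + c7 * s * (\<i> - 1)"
    by (simp_all add: s_def t_def u_def field_simps)
  note e = klein_sl2_entries[OF c7_minpoly st]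
  \<comment> \<open>The first two matrices have determinant 1 and trace \<open>c7\<close>, and are
    chosen so that their product has trace 0.\<close>
  let ?M = "(mat2 0 (-1) 1 c7, mat2 c7 \<i> \<i> 0, mat2 s t u (c7 - s))"
  have "?M \<in> klein_sl2_triples" unfolding klein_sl2_iff using e(1,2) by (simp add: algebra_simps)
  moreover have "sl2_coords ?M = (0, 0, 0)" using e(3,4) by (simp add: algebra_simps)
  ultimately show ?thesis by blast
qed

lemma klein_braid_orbit_origin: "klein_braid_orbit (0, 0, 0) = klein_points"
proof
  show "klein_braid_orbit (0, 0, 0) \<subseteq> klein_points"
  proof
    fix P assume "P \<in> klein_braid_orbit (0, 0, 0)"
    then obtain s M where M: "M \<in> klein_sl2_triples" "sl2_coords M = (0, 0, 0)" "s \<in> braid_orbit SL2_C M" "P = sl2_coords s"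
      unfolding klein_braid_orbit_def by blast
    have "(M, s) \<in> (braid_moves SL2_C \<union> (braid_moves SL2_C)\<inverse>)\<^sup>*" using M(3) unfolding braid_orbit_def by blast
    then have "s \<in> klein_sl2_triples \<and> sl2_coords s \<in> klein_points"
    proof (induction rule: rtrancl_induct)
      case base
      then show ?case using M by simp
    next
      case (step s s')
      have "s \<in> klein_sl2_triples \<and> sl2_coords s \<in> klein_points \<longleftrightarrow> s' \<in> klein_sl2_triples \<and> sl2_coords s' \<in> klein_points"
        if m: "(s, s') \<in> braid_moves SL2_C" for s s'
      proof -
        obtain A B C where s: "s = (A, B, C)" by (metis prod.exhaust)
        have c: "A \<in> carrier SL2_C" "B \<in> carrier SL2_C" "C \<in> carrier SL2_C"
          and "s' = braid1 SL2_C s \<or> s' = braid2 SL2_C s" using m by (auto simp: braid_moves_def s)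
        then consider "s' = braid1 SL2_C s" | "s' = braid2 SL2_C s" by blast
        then show ?thesis
        proof cases
          case 1
          show ?thesis unfolding 1 s using braid1_SL2[OF c] klein_move_points(1) by metis
        next
          case 2
          show ?thesis unfolding 2 s using braid2_SL2[OF c] klein_move_points(2) by metis
        qed
      qed
      then show ?case using step by blast
    qed
    then show "P \<in> klein_points" using M(4) by simp
  qed
  obtain M where M: "M \<in> klein_sl2_triples" "sl2_coords M = (0, 0, 0)" using klein_sl2_origin by blast
  define orb where "orb P \<longleftrightarrow> (\<exists>s\<in>braid_orbit SL2_C M. s \<in> klein_sl2_triples \<and> sl2_coords s = P)" for P
  have carr: "s \<in> carrier SL2_C \<times> carrier SL2_C \<times> carrier SL2_C" if "s \<in> klein_sl2_triples" for s
    using that unfolding klein_sl2_triples_def by blast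
  have step: "orb (klein_move1 P)" "orb (klein_move2 P)" if P: "orb P" for P
  proof -
    obtain s where s: "s \<in> braid_orbit SL2_C M" "s \<in> klein_sl2_triples" "sl2_coords s = P" using P unfolding orb_def by blast
    obtain A B C where ABC: "s = (A, B, C)" by (metis prod.exhaust)
    have c: "A \<in> carrier SL2_C" "B \<in> carrier SL2_C" "C \<in> carrier SL2_C" using carr[OF s(2)] unfolding ABC by blast+
    have "(s, braid1 SL2_C s) \<in> braid_moves SL2_C" "(s, braid2 SL2_C s) \<in> braid_moves SL2_C"
      using carr[OF s(2)] unfolding braid_moves_def by blast+
    then have "braid1 SL2_C s \<in> braid_orbit SL2_C M" "braid2 SL2_C s \<in> braid_orbit SL2_C M"
      using s(1) unfolding braid_orbit_def by (blast intro: rtrancl_into_rtrancl)+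
    then show "orb (klein_move1 P)" "orb (klein_move2 P)"
      using braid1_SL2[OF c] braid2_SL2[OF c] s unfolding orb_def ABC by blast+
  qed
  \<comment> \<open>The same tree of moves as for the octonion triples.\<close>
  have 0: "orb (0, 0, 0)" using M unfolding orb_def braid_orbit_def by blast
  have 1: "orb (1, 0, 0)" using step(1)[OF 0] by simp
  have 2: "orb (1, 1, 0)" using step(1)[OF 1] by simp
  have 3: "orb (0, 1, 0)" using step(1)[OF 2] by simp
  have 4: "orb (0, 1, 1)" using step(2)[OF 3] by simp
  have 5: "orb (0, 0, 1)" using step(2)[OF 4] by simp
  have 6: "orb (1, 0, 1)" using step(2)[OF 2] by simp
  have "orb P \<Longrightarrow> P \<in> klein_braid_orbit (0, 0, 0)" for P
    using M unfolding orb_def klein_braid_orbit_def by blast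
  then show "klein_points \<subseteq> klein_braid_orbit (0, 0, 0)" using 0 1 2 3 4 5 6 by simp
qed

section \<open>Lines through a point of the Fano plane\<close>

lemma conj_triple_comp:
  assumes "f \<in> carrier G2_C" "g \<in> carrier G2_C" "t \<in> carrier G2_C \<times> carrier G2_C \<times> carrier G2_C"
  shows "conj_triple f (conj_triple g t) = conj_triple (f \<otimes>\<^bsub>G2_C\<^esub> g) t"
proof -
  have "f \<otimes>\<^bsub>G2_C\<^esub> (g \<otimes>\<^bsub>G2_C\<^esub> x \<otimes>\<^bsub>G2_C\<^esub> inv\<^bsub>G2_C\<^esub> g) \<otimes>\<^bsub>G2_C\<^esub> inv\<^bsub>G2_C\<^esub> f
      = f \<otimes>\<^bsub>G2_C\<^esub> g \<otimes>\<^bsub>G2_C\<^esub> x \<otimes>\<^bsub>G2_C\<^esub> inv\<^bsub>G2_C\<^esub> (f \<otimes>\<^bsub>G2_C\<^esub> g)" if "x \<in> carrier G2_C" for x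
    using assms(1,2) that by (simp only: G2C.inv_mult_group G2C.m_assoc G2C.m_closed G2C.inv_closed)
  then show ?thesis using assms(3) by (cases t) (simp del: mult_algebra_aut)
qed

lemma (in group) conj_prod4:
  assumes "k \<in> carrier G" "a \<in> carrier G" "b \<in> carrier G" "c \<in> carrier G" "d \<in> carrier G"
    and "a \<otimes> b \<otimes> c \<otimes> d = \<one>"
  shows "(k \<otimes> a \<otimes> inv k) \<otimes> (k \<otimes> b \<otimes> inv k) \<otimes> (k \<otimes> c \<otimes> inv k) \<otimes> (k \<otimes> d \<otimes> inv k) = \<one>"
proof -
  have inv: "inv k \<otimes> (k \<otimes> x) = x" if "x \<in> carrier G" for x using assms(1) that by (simp flip: m_assoc)
  have "(k \<otimes> a \<otimes> inv k) \<otimes> (k \<otimes> b \<otimes> inv k) \<otimes> (k \<otimes> c \<otimes> inv k) \<otimes> (k \<otimes> d \<otimes> inv k)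
      = k \<otimes> (a \<otimes> b \<otimes> c \<otimes> d) \<otimes> inv k"
    using assms(1-5) by (simp add: m_assoc inv)
  then show ?thesis using assms by simp
qed

lemma klein_triples_carrier:
  assumes "t \<in> klein_triples P"
  shows "t \<in> carrier G2_C \<times> carrier G2_C \<times> carrier G2_C" "t \<in> six_dim_class \<times> six_dim_class \<times> six_dim_class"
proof -
  obtain g1 g2 g3 x y z where t: "t = (g1, g2, g3)" "P = (x, y, z)" by (metis prod.exhaust)
  obtain v1 v2 v3 where v: "v1 \<in> norm3_vectors" "v2 \<in> norm3_vectors" "v3 \<in> norm3_vectors"
    "g1 = oct_T (oct_a v1)" "g2 = oct_T (oct_a v2)" "g3 = oct_T (oct_a v3)"
    using assms unfolding klein_triples_def t klein_moduli.simps mem_Collect_eq over_moduli_point.simps by blast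
  then show "t \<in> carrier G2_C \<times> carrier G2_C \<times> carrier G2_C" "t \<in> six_dim_class \<times> six_dim_class \<times> six_dim_class"
    unfolding t six_dim_class_def by (auto simp: oct_T_G2C)
qed

text \<open>The realisation supplies one triple over \<open>P\<close>. All triples over
  \<open>P\<close> are conjugate to it, and \<open>character_triples Cinf\<close> is stable under
  conjugation because \<open>Cinf\<close> is a conjugacy class.\<close>

lemma klein_triples_subset_character_triples:
  assumes real: "klein_realised_by Cinf" and P: "P \<in> klein_surface" and v: "spanning_triple v P"
  shows "klein_triples P \<subseteq> character_triples Cinf"
proof
  fix s assume s: "s \<in> klein_triples P"
  have "klein_moduli ` klein_surface \<subseteq> character_variety Cinf"
    using real unfolding klein_realised_by_def by (blast dest: in_components_subset)
  then obtain t where t: "t \<in> character_triples Cinf" "over_moduli_point t (klein_moduli P)"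
    using P unfolding character_variety_def by blast
  have tP: "t \<in> klein_triples P" using t(2) unfolding klein_triples_def by blast
  let ?v = "vector_triple v"
  obtain f g where f: "f \<in> carrier G2_C" "t = conj_triple f ?v" and g: "g \<in> carrier G2_C" "s = conj_triple g ?v"
    using s tP unfolding klein_triples_eq_class[OF v] triple_class_def by blast
  have vc: "?v \<in> carrier G2_C \<times> carrier G2_C \<times> carrier G2_C"
  proof -
    obtain v1 v2 v3 x y z where "v = (v1, v2, v3)" "P = (x, y, z)" by (metis prod.exhaust)
    then show ?thesis using v oct_T_G2C by simp
  qed
  define k where "k = g \<otimes>\<^bsub>G2_C\<^esub> inv\<^bsub>G2_C\<^esub> f"
  have k: "k \<in> carrier G2_C" unfolding k_def by (intro G2C.m_closed G2C.inv_closed f(1) g(1))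
  have "k \<otimes>\<^bsub>G2_C\<^esub> f = g"
    unfolding k_def using f(1) g(1) G2C.l_inv[OF f(1)]
    by (simp only: G2C.m_assoc G2C.inv_closed G2C.r_one)
  then have sk: "s = conj_triple k t" unfolding f(2) g(2) conj_triple_comp[OF k f(1) vc] by simp
  obtain a b c d where abcd: "t = (a, b, c)" "d \<in> Cinf"
    "a \<otimes>\<^bsub>G2_C\<^esub> b \<otimes>\<^bsub>G2_C\<^esub> c \<otimes>\<^bsub>G2_C\<^esub> d = \<one>\<^bsub>G2_C\<^esub>" using t(1) unfolding character_triples_def by blast
  have abc: "a \<in> carrier G2_C" "b \<in> carrier G2_C" "c \<in> carrier G2_C"
    using klein_triples_carrier(1)[OF tP] unfolding abcd(1) by blast+
  obtain g0 where g0: "g0 \<in> carrier G2_C"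
    "Cinf = {h \<otimes>\<^bsub>G2_C\<^esub> g0 \<otimes>\<^bsub>G2_C\<^esub> inv\<^bsub>G2_C\<^esub> h | h. h \<in> carrier G2_C}"
    using real unfolding klein_realised_by_def regular_semisimple_class_def by blast
  obtain h where h: "h \<in> carrier G2_C" "d = h \<otimes>\<^bsub>G2_C\<^esub> g0 \<otimes>\<^bsub>G2_C\<^esub> inv\<^bsub>G2_C\<^esub> h"
    using abcd(2) unfolding g0(2) by blast
  have d: "d \<in> carrier G2_C" unfolding h(2) by (intro G2C.m_closed G2C.inv_closed h(1) g0(1))
  have "k \<otimes>\<^bsub>G2_C\<^esub> d \<otimes>\<^bsub>G2_C\<^esub> inv\<^bsub>G2_C\<^esub> k
      = (k \<otimes>\<^bsub>G2_C\<^esub> h) \<otimes>\<^bsub>G2_C\<^esub> g0 \<otimes>\<^bsub>G2_C\<^esub> inv\<^bsub>G2_C\<^esub> (k \<otimes>\<^bsub>G2_C\<^esub> h)"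
    unfolding h(2) using k h(1) g0(1) by (simp only: G2C.inv_mult_group G2C.m_assoc G2C.m_closed G2C.inv_closed)
  then have kd: "k \<otimes>\<^bsub>G2_C\<^esub> d \<otimes>\<^bsub>G2_C\<^esub> inv\<^bsub>G2_C\<^esub> k \<in> Cinf"
    unfolding g0(2) using G2C.m_closed[OF k h(1)] by blast
  show "s \<in> character_triples Cinf"
    using klein_triples_carrier(2)[OF s] kd G2C.conj_prod4[OF k abc d abcd(3)]
    unfolding sk abcd(1) conj_triple.simps character_triples_def by blast
qed

lemma oct_form_triple_alternating:
  assumes "u \<in> oct_V" "v \<in> oct_V" "w \<in> oct_V"
  shows "oct_form u (w \<odot> v) = - oct_form u (v \<odot> w)" "oct_form v (u \<odot> w) = - oct_form u (v \<odot> w)"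
  using assms
  by (cases u rule: oct_cases; cases v rule: oct_cases; cases w rule: oct_cases; simp add: oct_V_def algebra_simps)+

lemma oct_form_sym: "oct_form x y = oct_form y x"
  by (simp add: oct_form_alt mult.commute)

text \<open>The vectors quantified in \<open>over_moduli_point\<close> are unique by
  \<open>oct_T_inject\<close>, so membership can be tested on the given ones.\<close>

lemma vector_triple_klein_iff:
  assumes "v1 \<in> norm3_vectors" "v2 \<in> norm3_vectors" "v3 \<in> norm3_vectors"
  shows "vector_triple (v1, v2, v3) \<in> klein_triples (x, y, z) \<longleftrightarrow>
    oct_form v2 v3 = 1 - 2 * x \<and> oct_form v1 v3 = 1 - 2 * y \<and> oct_form v1 v2 = 1 - 2 * z \<and>
    oct_form v2 v3 + oct_form v1 v3 + oct_form v1 v2 + oct_form v1 (v2 \<odot> v3) = 1"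
proof -
  have e: "4 * (- 1) + 5 = (1 :: complex)" by simp
  show ?thesis (is "?l \<longleftrightarrow> ?r")
  proof
    assume ?l
    then obtain w1 w2 w3 where w: "w1 \<in> norm3_vectors" "w2 \<in> norm3_vectors" "w3 \<in> norm3_vectors"
      and T: "oct_T (oct_a v1) = oct_T (oct_a w1)" "oct_T (oct_a v2) = oct_T (oct_a w2)" "oct_T (oct_a v3) = oct_T (oct_a w3)"
      and form: "oct_form w2 w3 = 1 - 2 * x" "oct_form w1 w3 = 1 - 2 * y" "oct_form w1 w2 = 1 - 2 * z"
        "oct_form w2 w3 + oct_form w1 w3 + oct_form w1 w2 + oct_form w1 (w2 \<odot> w3) = 1"
      unfolding klein_triples_def mem_Collect_eq vector_triple.simps klein_moduli.simps over_moduli_point.simps e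
      by blast
    have "v1 = w1" "v2 = w2" "v3 = w3" using assms w T by (blast intro: oct_T_inject)+
    then show ?r using form by blast
  next
    assume ?r
    then show ?l
      unfolding klein_triples_def mem_Collect_eq vector_triple.simps klein_moduli.simps over_moduli_point.simps e
      by - (rule bexI[OF _ assms(1)], rule bexI[OF _ assms(2)], rule bexI[OF _ assms(3)], blast)
  qed
qed

lemma three_elements_perm:
  assumes "{p, q, r} = {a, b, c}" "a \<noteq> b" "a \<noteq> c" "b \<noteq> c"
  shows "(p, q, r) \<in> {(a, b, c), (b, c, a), (c, a, b)} \<union> {(b, a, c), (a, c, b), (c, b, a)}"
proof -
  have pqr: "p = a \<or> p = b \<or> p = c" "q = a \<or> q = b \<or> q = c" "r = a \<or> r = b \<or> r = c"
    and abc: "a = p \<or> a = q \<or> a = r" "b = p \<or> b = q \<or> b = r" "c = p \<or> c = q \<or> c = r"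
    using assms(1) by blast+
  show ?thesis using pqr by (elim disjE) (use abc assms(2-4) in auto)
qed

text \<open>The triple product is alternating, so an odd reordering of the lines changes it from -2
  to 2 and the sum of the four forms from 1 to 5, that is b from -1 to 0. Odd orders thus leave the
  slice of the Klein surface, while even ones are cyclic rotations.\<close>

lemma oriented_lines:
  assumes lines: "lines_through m = {L1, L2, L3}"
    and n: "line_vector L1 \<in> norm3_vectors" "line_vector L2 \<in> norm3_vectors" "line_vector L3 \<in> norm3_vectors"
    and form: "oct_form (line_vector L2) (line_vector L3) = 1" "oct_form (line_vector L1) (line_vector L3) = 1"
      "oct_form (line_vector L1) (line_vector L2) = 1"
      "oct_form (line_vector L1) (line_vector L2 \<odot> line_vector L3) = - 2"
  shows "\<exists>L1 L2 L3. lines_through m = {L1, L2, L3} \<and>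
             (line_element L1, line_element L2, line_element L3) \<in> klein_triples (0, 0, 0) \<and>
             G2_C\<lparr>carrier := generated_group (line_element L1, line_element L2, line_element L3)\<rparr>
               \<cong> G2_F2_derived \<and>
             (\<forall>K1 K2 K3. lines_through m = {K1, K2, K3} \<and>
                (\<exists>P\<in>klein_surface. (line_element K1, line_element K2, line_element K3) \<in> klein_triples P) \<longrightarrow>
                (K1, K2, K3) \<in> {(L1, L2, L3), (L2, L3, L1), (L3, L1, L2)})"
proof -
  let ?v = line_vector
  have vt: "(line_element K1, line_element K2, line_element K3) = vector_triple (?v K1, ?v K2, ?v K3)" for K1 K2 K3
    by (simp add: line_element_def)
  have mem: "(line_element L1, line_element L2, line_element L3) \<in> klein_triples (0, 0, 0)"
    unfolding vt vector_triple_klein_iff[OF n] using form by simp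
  have ne: "L1 \<noteq> L2" "L1 \<noteq> L3" "L2 \<noteq> L3" using form(1-3) n by (auto simp: norm3_vectors_def oct_n_def)
  have V: "?v L1 \<in> oct_V" "?v L2 \<in> oct_V" "?v L3 \<in> oct_V" using n norm3D(1) by blast+
  note sym = form(1-3)[unfolded oct_form_sym[of "?v L2" "?v L3"] oct_form_sym[of "?v L1" "?v L3"] oct_form_sym[of "?v L1" "?v L2"]]
  have odd1: "oct_form (?v L2) (?v L1 \<odot> ?v L3) = 2" and odd2: "oct_form (?v L1) (?v L3 \<odot> ?v L2) = 2"
    unfolding oct_form_triple_alternating(2)[OF V(1,2,3)] oct_form_triple_alternating(1)[OF V(1,2,3)] form(4) by simp_all
  have odd3: "oct_form (?v L3) (?v L2 \<odot> ?v L1) = 2"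
    unfolding oct_form_triple_alternating(1)[OF V(3,1,2)] oct_form_triple_alternating(2)[OF V(1,3,2)] odd2 by simp
  have key: "(K1, K2, K3) \<in> {(L1, L2, L3), (L2, L3, L1), (L3, L1, L2)}"
    if K: "lines_through m = {K1, K2, K3}" "(line_element K1, line_element K2, line_element K3) \<in> klein_triples P" for K1 K2 K3 P
  proof -
    have "{K1, K2, K3} = {L1, L2, L3}" using K(1) lines by simp
    from three_elements_perm[OF this ne] show ?thesis
    proof (rule UnE)
      assume K': "(K1, K2, K3) \<in> {(L2, L1, L3), (L1, L3, L2), (L3, L2, L1)}"
      obtain x y z where P: "P = (x, y, z)" by (metis prod.exhaust)
      have "vector_triple (?v K1, ?v K2, ?v K3) \<in> klein_triples (x, y, z)" using K(2) unfolding vt P .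
      moreover have "\<not> vector_triple (?v L2, ?v L1, ?v L3) \<in> klein_triples (x, y, z)"
        "\<not> vector_triple (?v L1, ?v L3, ?v L2) \<in> klein_triples (x, y, z)"
        "\<not> vector_triple (?v L3, ?v L2, ?v L1) \<in> klein_triples (x, y, z)"
        unfolding vector_triple_klein_iff[OF n(2,1,3)] vector_triple_klein_iff[OF n(1,3,2)]
          vector_triple_klein_iff[OF n(3,2,1)] using form(1-3) sym odd1 odd2 odd3 by simp_all
      ultimately have False using K' by (elim insertE emptyE) simp_all
      then show ?thesis ..
    qed
  qed
  show ?thesis
    by (rule exI[of _ L1], rule exI[of _ L2], rule exI[of _ L3], intro conjI allI impI lines mem klein_triples_zero_iso[OF mem])
      (elim conjE bexE, rule key)
qed

text \<open>At each point only the orientation has to be chosen: the orders below give the triple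
  product -2, the reversed ones 2.\<close>

lemma oriented_lines_through:
  assumes "m \<noteq> 0"
  shows "\<exists>L1 L2 L3. lines_through m = {L1, L2, L3} \<and>
    line_vector L1 \<in> norm3_vectors \<and> line_vector L2 \<in> norm3_vectors \<and> line_vector L3 \<in> norm3_vectors \<and>
    oct_form (line_vector L2) (line_vector L3) = 1 \<and> oct_form (line_vector L1) (line_vector L3) = 1 \<and>
    oct_form (line_vector L1) (line_vector L2) = 1 \<and>
    oct_form (line_vector L1) (line_vector L2 \<odot> line_vector L3) = - 2"
proof -
  have lv: "line_vector {1,2,4} = oct 0 1 1 0 1 0 0 0" "line_vector {2,3,5} = oct 0 0 1 1 0 1 0 0"
    "line_vector {3,4,6} = oct 0 0 0 1 1 0 1 0" "line_vector {4,5,7} = oct 0 0 0 0 1 1 0 1"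
    "line_vector {5,6,1} = oct 0 1 0 0 0 1 1 0" "line_vector {6,7,2} = oct 0 0 1 0 0 0 1 1"
    "line_vector {7,1,3} = oct 0 1 0 1 0 0 0 1"
    by (simp_all add: line_vector_def oct_e_oct)
  have fl: "fano_lines = {{1,2,4}, {2,3,5}, {3,4,6}, {4,5,7}, {5,6,1}, {6,7,2}, {7,1,3}}"
    by (simp add: fano_lines_def oriented_fano_lines_def)
  have lt: "lines_through 1 = {{1,2,4}, {7,1,3}, {5,6,1}}" "lines_through 2 = {{1,2,4}, {6,7,2}, {2,3,5}}"
    "lines_through 3 = {{2,3,5}, {7,1,3}, {3,4,6}}" "lines_through 4 = {{1,2,4}, {4,5,7}, {3,4,6}}"
    "lines_through 5 = {{2,3,5}, {5,6,1}, {4,5,7}}" "lines_through 6 = {{3,4,6}, {6,7,2}, {5,6,1}}"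
    "lines_through 7 = {{4,5,7}, {7,1,3}, {6,7,2}}"
    unfolding lines_through_def fl by (intro equalityI subsetI; elim CollectE conjE insertE emptyE; simp)+
  have "m \<in> {0, 1, 2, 3, 4, 5, 6, 7}" unfolding UNIV_8[symmetric] by simp
  then consider "m = 1" | "m = 2" | "m = 3" | "m = 4" | "m = 5" | "m = 6" | "m = 7" using assms by blast
  then show ?thesis
  proof cases
    case 1
    show ?thesis unfolding 1
      by (rule exI[of _ "{1,2,4}"], rule exI[of _ "{7,1,3}"], rule exI[of _ "{5,6,1}"], unfold lt lv) (simp add: oct_norm3_oct)
  next
    case 2
    show ?thesis unfolding 2
      by (rule exI[of _ "{1,2,4}"], rule exI[of _ "{6,7,2}"], rule exI[of _ "{2,3,5}"], unfold lt lv) (simp add: oct_norm3_oct)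
  next
    case 3
    show ?thesis unfolding 3
      by (rule exI[of _ "{2,3,5}"], rule exI[of _ "{7,1,3}"], rule exI[of _ "{3,4,6}"], unfold lt lv) (simp add: oct_norm3_oct)
  next
    case 4
    show ?thesis unfolding 4
      by (rule exI[of _ "{1,2,4}"], rule exI[of _ "{4,5,7}"], rule exI[of _ "{3,4,6}"], unfold lt lv) (simp add: oct_norm3_oct)
  next
    case 5
    show ?thesis unfolding 5
      by (rule exI[of _ "{2,3,5}"], rule exI[of _ "{5,6,1}"], rule exI[of _ "{4,5,7}"], unfold lt lv) (simp add: oct_norm3_oct)
  next
    case 6
    show ?thesis unfolding 6
      by (rule exI[of _ "{3,4,6}"], rule exI[of _ "{6,7,2}"], rule exI[of _ "{5,6,1}"], unfold lt lv) (simp add: oct_norm3_oct)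
  next
    case 7
    show ?thesis unfolding 7
      by (rule exI[of _ "{4,5,7}"], rule exI[of _ "{7,1,3}"], rule exI[of _ "{6,7,2}"], unfold lt lv) (simp add: oct_norm3_oct)
  qed
qed

lemma klein_points_surface: "klein_points \<subseteq> klein_surface"
  by (simp add: klein_surface_def)

theorem theorem2:
  shows
    "simple_group G2_F2_derived \<and> order G2_F2_derived = 6048
     \<and> klein_braid_orbit (0, 0, 0) =
         {(0,0,0), (0,0,1), (0,1,0), (1,0,0), (1,1,0), (1,0,1), (0,1,1)}
     \<and> card (klein_braid_orbit (0, 0, 0)) = 7
     \<and> klein_braid_orbit (0, 0, 0) \<subseteq> klein_surface
     \<and> (\<exists>\<Gamma>. subgroup \<Gamma> G2_C \<and> G2_C\<lparr>carrier := \<Gamma>\<rparr> \<cong> G2_F2_derived \<and>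
          (\<forall>P\<in>klein_braid_orbit (0, 0, 0).
             \<exists>t. generated_group t = \<Gamma> \<and> klein_triples P = triple_class t))
     \<and> (\<forall>Cinf. klein_realised_by Cinf \<longrightarrow>
          (\<forall>P\<in>klein_braid_orbit (0, 0, 0). klein_triples P \<subseteq> character_triples Cinf))
     \<and> (\<forall>m. m \<noteq> 0 \<longrightarrow>
          (\<exists>L1 L2 L3. lines_through m = {L1, L2, L3} \<and>
             (line_element L1, line_element L2, line_element L3) \<in> klein_triples (0, 0, 0) \<and>
             G2_C\<lparr>carrier := generated_group (line_element L1, line_element L2, line_element L3)\<rparr>
               \<cong> G2_F2_derived \<and>
             (\<forall>K1 K2 K3. lines_through m = {K1, K2, K3} \<and>
                (\<exists>P\<in>klein_surface. (line_element K1, line_element K2, line_element K3) \<in> klein_triples P) \<longrightarrow>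
                (K1, K2, K3) \<in> {(L1, L2, L3), (L2, L3, L1), (L3, L1, L2)})))"
proof (intro conjI)
  show "simple_group G2_F2_derived" by (rule simple_group_G2_F2_derived)
  show "order G2_F2_derived = 6048" by (rule order_G2_F2_derived)
  show "klein_braid_orbit (0, 0, 0) = klein_points" by (rule klein_braid_orbit_origin)
  show "card (klein_braid_orbit (0, 0, 0)) = 7" unfolding klein_braid_orbit_origin by simp
  show "klein_braid_orbit (0, 0, 0) \<subseteq> klein_surface"
    unfolding klein_braid_orbit_origin by (rule klein_points_surface)
  show "\<exists>\<Gamma>. subgroup \<Gamma> G2_C \<and> G2_C\<lparr>carrier := \<Gamma>\<rparr> \<cong> G2_F2_derived \<and>
      (\<forall>P\<in>klein_braid_orbit (0, 0, 0). \<exists>t. generated_group t = \<Gamma> \<and> klein_triples P = triple_class t)"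
  proof (intro exI[of _ line_group] conjI ballI subgroup_line_group line_group_iso)
    fix P assume "P \<in> klein_braid_orbit (0, 0, 0)"
    then obtain v where "spanning_triple v P" "generated_group (vector_triple v) = line_group"
      using klein_orbit_triples unfolding klein_braid_orbit_origin by blast
    then show "\<exists>t. generated_group t = line_group \<and> klein_triples P = triple_class t"
      using klein_triples_eq_class by blast
  qed
  show "\<forall>Cinf. klein_realised_by Cinf \<longrightarrow>
      (\<forall>P\<in>klein_braid_orbit (0, 0, 0). klein_triples P \<subseteq> character_triples Cinf)"
  proof (intro allI impI ballI)
    fix Cinf P assume real: "klein_realised_by Cinf" and "P \<in> klein_braid_orbit (0, 0, 0)"
    then have P: "P \<in> klein_points" unfolding klein_braid_orbit_origin by blast
    obtain v where "spanning_triple v P" using klein_orbit_triples[OF P] by blast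
    with real subsetD[OF klein_points_surface P] show "klein_triples P \<subseteq> character_triples Cinf"
      by (rule klein_triples_subset_character_triples)
  qed
next
  show "\<forall>m. m \<noteq> 0 \<longrightarrow>
          (\<exists>L1 L2 L3. lines_through m = {L1, L2, L3} \<and>
             (line_element L1, line_element L2, line_element L3) \<in> klein_triples (0, 0, 0) \<and>
             G2_C\<lparr>carrier := generated_group (line_element L1, line_element L2, line_element L3)\<rparr>
               \<cong> G2_F2_derived \<and>
             (\<forall>K1 K2 K3. lines_through m = {K1, K2, K3} \<and>
                (\<exists>P\<in>klein_surface. (line_element K1, line_element K2, line_element K3) \<in> klein_triples P) \<longrightarrow>
                (K1, K2, K3) \<in> {(L1, L2, L3), (L2, L3, L1), (L3, L1, L2)}))"
  proof (intro allI impI)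
    fix m :: 8 assume "m \<noteq> 0"
    from oriented_lines_through[OF this] show "\<exists>L1 L2 L3. lines_through m = {L1, L2, L3} \<and>
             (line_element L1, line_element L2, line_element L3) \<in> klein_triples (0, 0, 0) \<and>
             G2_C\<lparr>carrier := generated_group (line_element L1, line_element L2, line_element L3)\<rparr>
               \<cong> G2_F2_derived \<and>
             (\<forall>K1 K2 K3. lines_through m = {K1, K2, K3} \<and>
                (\<exists>P\<in>klein_surface. (line_element K1, line_element K2, line_element K3) \<in> klein_triples P) \<longrightarrow>
                (K1, K2, K3) \<in> {(L1, L2, L3), (L2, L3, L1), (L3, L1, L2)})"
      by (elim exE conjE) (rule oriented_lines)
  qed
qed

end
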